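(* Let $k$ be a field of characteristic $0$ and let $q\in k^\times$ be transcendental over $\mathbb{Q}$. Let $A$ be the quantized symplectic oscillator algebra of rank $1$ associated with the central element $$C_0=(q-q^{-1})^3C-(q-q^{-1})(q^{-2}+q^2)\in U_q(\mathfrak{sl}_2).$$ Then $V(q)=V_C(q)$, of dimension $2$ over $k$, is the unique finite dimensional simple $A$-module, and every finite dimensional $A$-module is a direct sum of copies of $V(q)$; in particular every finite dimensional $A$-module is completely reducible.
   Context: $U_q(\mathfrak{sl}_2)$ is the $k$-algebra generated by $E,F,K,K^{-1}$ with $KK^{-1}=K^{-1}K=1$, $KEK^{-1}=q^2E$, $KFK^{-1}=q^{-2}F$, $EF-FE=\frac{K-K^{-1}}{q-q^{-1}}$, and $C=FE+\frac{qK+q^{-1}K^{-1}}{(q-q^{-1})^2}$ is its Casimir element. For $C_0$ in the center of $U_q(\mathfrak{sl}_2)$, $A$ is the $k$-algebra generated by $E,F,K,K^{-1},X,Y$ with these relations together with $EX=qXE$, $EY=X+q^{-1}YE$, $FX=YK^{-1}+XF$, $FY=YF$, $KXK^{-1}=qX$, $KYK^{-1}=q^{-1}Y$, $qYX-XY=C_0$. For $r\in k^\times$, $V(r)$ is the unique simple quotient of the Verma module $Z(r)=A/(AE+AX+A(K-r))$, and $V_C(r)$ is the simple $U_q(\mathfrak{sl}_2)$-module of highest weight $r$; the equality $V(q)=V_C(q)$ is as $U_q(\mathfrak{sl}_2)$-modules. *)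

theory Defs
  imports
    "HOL-Library.Poly_Mapping"
    "HOL-Computational_Algebra.Polynomial"
    "HOL-Algebra.QuotRing"
    "Jordan_Normal_Form.VS_Connect"
begin

section \<open>Left modules over a not necessarily commutative ring\<close>

text \<open>The locale \<open>module\<close> of the library requires a commutative ring of scalars; the following is
  the same axiomatization over an arbitrary unital ring.\<close>

locale left_module = R?: ring R + M?: abelian_group M
  for R :: "('a, 'c) ring_scheme" (structure) and M :: "('a, 'b, 'd) module_scheme" (structure) +
  assumes smult_closed:
      "\<lbrakk>a \<in> carrier R; x \<in> carrier M\<rbrakk> \<Longrightarrow> a \<odot>\<^bsub>M\<^esub> x \<in> carrier M"
    and smult_l_distr:
      "\<lbrakk>a \<in> carrier R; b \<in> carrier R; x \<in> carrier M\<rbrakk> \<Longrightarrow>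
        (a \<oplus>\<^bsub>R\<^esub> b) \<odot>\<^bsub>M\<^esub> x = a \<odot>\<^bsub>M\<^esub> x \<oplus>\<^bsub>M\<^esub> b \<odot>\<^bsub>M\<^esub> x"
    and smult_r_distr:
      "\<lbrakk>a \<in> carrier R; x \<in> carrier M; y \<in> carrier M\<rbrakk> \<Longrightarrow>
        a \<odot>\<^bsub>M\<^esub> (x \<oplus>\<^bsub>M\<^esub> y) = a \<odot>\<^bsub>M\<^esub> x \<oplus>\<^bsub>M\<^esub> a \<odot>\<^bsub>M\<^esub> y"
    and smult_assoc:
      "\<lbrakk>a \<in> carrier R; b \<in> carrier R; x \<in> carrier M\<rbrakk> \<Longrightarrow>
        (a \<otimes>\<^bsub>R\<^esub> b) \<odot>\<^bsub>M\<^esub> x = a \<odot>\<^bsub>M\<^esub> (b \<odot>\<^bsub>M\<^esub> x)"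
    and smult_one: "x \<in> carrier M \<Longrightarrow> \<one>\<^bsub>R\<^esub> \<odot>\<^bsub>M\<^esub> x = x"

text \<open>\<open>Module.submodule\<close> and \<open>LinearCombinations.module_hom\<close> do not presuppose commutativity
  of the scalars, so they are used as they are. (Unqualified, \<open>submodule\<close> is a different predicate
  here, one that does require a commutative ring.)\<close>

definition simple_left_module ::
    "('a, 'c) ring_scheme \<Rightarrow> ('a, 'b, 'd) module_scheme \<Rightarrow> bool" where
  "simple_left_module R M \<longleftrightarrow>
     left_module R M \<and> carrier M \<noteq> {\<zero>\<^bsub>M\<^esub>} \<and>
     (\<forall>N. Module.submodule N R M \<longrightarrow> N = {\<zero>\<^bsub>M\<^esub>} \<or> N = carrier M)"

definition isomorphic_modules ::
    "('a, 'c) ring_scheme \<Rightarrow> ('a, 'b1, 'd1) module_scheme \<Rightarrow> ('a, 'b2, 'd2) module_scheme \<Rightarrow> bool" where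
  "isomorphic_modules R M N \<longleftrightarrow> (\<exists>f \<in> LinearCombinations.module_hom R M N. bij_betw f (carrier M) (carrier N))"

definition completely_reducible ::
    "('a, 'c) ring_scheme \<Rightarrow> ('a, 'b, 'd) module_scheme \<Rightarrow> bool" where
  "completely_reducible R M \<longleftrightarrow>
     (\<forall>N. Module.submodule N R M \<longrightarrow>
        (\<exists>N'. Module.submodule N' R M \<and> N \<inter> N' = {\<zero>\<^bsub>M\<^esub>} \<and> N <+>\<^bsub>M\<^esub> N' = carrier M))"

text \<open>In the module records below the fields \<open>mult\<close> and \<open>one\<close> carry no meaning.\<close>

definition regular_module :: "('a, 'c) ring_scheme \<Rightarrow> ('a, 'a) module" where
  "regular_module R =
     \<lparr>carrier = carrier R, mult = mult R, one = \<one>\<^bsub>R\<^esub>, zero = \<zero>\<^bsub>R\<^esub>, add = add R, smult = mult R\<rparr>"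

definition quotient_module :: "('a, 'b, 'd) module_scheme \<Rightarrow> 'b set \<Rightarrow> ('a, 'b set) module" where
  "quotient_module M N =
     \<lparr>carrier = a_rcosets\<^bsub>M\<^esub> N, mult = (\<lambda>_ _. N), one = N, zero = N, add = set_add M,
      smult = (\<lambda>a B. \<Union>x\<in>B. N +>\<^bsub>M\<^esub> (a \<odot>\<^bsub>M\<^esub> x))\<rparr>"

text \<open>\<open>M\<^sup>n\<close>, the direct sum of \<open>n\<close> copies of \<open>M\<close> (the zero module for \<open>n = 0\<close>).\<close>

definition direct_sum_copies :: "nat \<Rightarrow> ('a, 'b, 'd) module_scheme \<Rightarrow> ('a, nat \<Rightarrow> 'b) module" where
  "direct_sum_copies n M =
     \<lparr>carrier = {..<n} \<rightarrow>\<^sub>E carrier M,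
      mult = (\<lambda>_ _. \<lambda>i\<in>{..<n}. \<zero>\<^bsub>M\<^esub>), one = (\<lambda>i\<in>{..<n}. \<zero>\<^bsub>M\<^esub>),
      zero = (\<lambda>i\<in>{..<n}. \<zero>\<^bsub>M\<^esub>),
      add = (\<lambda>f g. \<lambda>i\<in>{..<n}. f i \<oplus>\<^bsub>M\<^esub> g i),
      smult = (\<lambda>a f. \<lambda>i\<in>{..<n}. a \<odot>\<^bsub>M\<^esub> f i)\<rparr>"

definition restrict_scalars :: "('s \<Rightarrow> 'a) \<Rightarrow> ('a, 'b, 'd) module_scheme \<Rightarrow> ('s, 'b) module" where
  "restrict_scalars \<phi> M =
     \<lparr>carrier = carrier M, mult = mult M, one = \<one>\<^bsub>M\<^esub>, zero = \<zero>\<^bsub>M\<^esub>, add = add M,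
      smult = (\<lambda>s. smult M (\<phi> s))\<rparr>"

text \<open>Only meaningful for a module with exactly one simple quotient, such as a Verma module.\<close>

definition unique_simple_quotient ::
    "('a, 'c) ring_scheme \<Rightarrow> ('a, 'b, 'd) module_scheme \<Rightarrow> ('a, 'b set) module" where
  "unique_simple_quotient R M =
     quotient_module M
       (THE N. Module.submodule N R M \<and> simple_left_module R (quotient_module M N))"


section \<open>Free algebras\<close>

text \<open>With concatenation as addition, words over \<open>'g\<close> form the free monoid on \<open>'g\<close>, so the
  convolution product makes \<open>'g list \<Rightarrow>\<^sub>0 'k\<close> the free unital associative \<open>'k\<close>-algebra on \<open>'g\<close>.\<close>

instantiation list :: (type) monoid_add
begin
definition zero_list :: "'a list" where "zero_list = []"
definition plus_list :: "'a list \<Rightarrow> 'a list \<Rightarrow> 'a list" where "plus_list = (@)"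
instance by standard (simp_all add: zero_list_def plus_list_def)
end

type_synonym ('g, 'k) free_algebra = "'g list \<Rightarrow>\<^sub>0 'k"

definition gen :: "'g \<Rightarrow> ('g, 'k::field) free_algebra" where
  "gen g = Poly_Mapping.single [g] 1"

definition const :: "'k \<Rightarrow> ('g, 'k::field) free_algebra" where
  "const c = Poly_Mapping.single [] c"

text \<open>The algebra homomorphism with \<open>gen g \<mapsto> gen (f g)\<close>.\<close>

definition free_map :: "('g \<Rightarrow> 'h) \<Rightarrow> ('g, 'k::field) free_algebra \<Rightarrow> ('h, 'k) free_algebra" where
  "free_map f p =
     (\<Sum>w\<in>Poly_Mapping.keys p. Poly_Mapping.single (map f w) (Poly_Mapping.lookup p w))"

text \<open>The algebra presented by generators \<open>'g\<close> and relations \<open>p = 0\<close> for \<open>p \<in> S\<close>. Its elements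
  are cosets; \<open>presented_class S p\<close> is the coset of \<open>p\<close>.\<close>

definition presented_algebra ::
    "('g, 'k::field) free_algebra set \<Rightarrow> ('g, 'k) free_algebra set ring" where
  "presented_algebra S = class_ring Quot (Idl\<^bsub>class_ring\<^esub> S)"

definition presented_class ::
    "('g, 'k::field) free_algebra set \<Rightarrow> ('g, 'k) free_algebra \<Rightarrow> ('g, 'k) free_algebra set" where
  "presented_class S p = (Idl\<^bsub>class_ring\<^esub> S) +>\<^bsub>class_ring\<^esub> p"


section \<open>The quantum group of \<open>sl\<^sub>2\<close>\<close>

datatype uq_gen = gE | gF | gK | gKinv

definition uq_relations :: "'k::field \<Rightarrow> (uq_gen, 'k) free_algebra set" where
  "uq_relations q =
     (let E = gen gE; F = gen gF; K = gen gK; Kinv = gen gKinv in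
      {K * Kinv - 1,
       Kinv * K - 1,
       K * E * Kinv - const (q ^ 2) * E,
       K * F * Kinv - const (inverse q ^ 2) * F,
       E * F - F * E - const (1 / (q - inverse q)) * (K - Kinv)})"

definition uq_algebra :: "'k::field \<Rightarrow> (uq_gen, 'k) free_algebra set ring" where
  "uq_algebra q = presented_algebra (uq_relations q)"

definition uq_class :: "'k::field \<Rightarrow> (uq_gen, 'k) free_algebra \<Rightarrow> (uq_gen, 'k) free_algebra set" where
  "uq_class q = presented_class (uq_relations q)"

text \<open>A representative of the Casimir element \<open>C\<close> in the free algebra.\<close>

definition casimir :: "'k::field \<Rightarrow> (uq_gen, 'k) free_algebra" where
  "casimir q =
     gen gF * gen gE
     + const (1 / (q - inverse q) ^ 2) * (const q * gen gK + const (inverse q) * gen gKinv)"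

text \<open>The Verma module \<open>U / (UE + U(K - r))\<close> and its simple quotient \<open>V\<^sub>C(r)\<close>.\<close>

definition uq_verma ::
    "'k::field \<Rightarrow> 'k \<Rightarrow>
     ((uq_gen, 'k) free_algebra set, (uq_gen, 'k) free_algebra set set) module" where
  "uq_verma q r =
     (let U = uq_algebra q; E = uq_class q (gen gE); Kr = uq_class q (gen gK - const r) in
      quotient_module (regular_module U)
        {a \<otimes>\<^bsub>U\<^esub> E \<oplus>\<^bsub>U\<^esub> b \<otimes>\<^bsub>U\<^esub> Kr | a b. a \<in> carrier U \<and> b \<in> carrier U})"

definition uq_simple ::
    "'k::field \<Rightarrow> 'k \<Rightarrow>
     ((uq_gen, 'k) free_algebra set, (uq_gen, 'k) free_algebra set set set) module" where
  "uq_simple q r = unique_simple_quotient (uq_algebra q) (uq_verma q r)"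


section \<open>The quantized symplectic oscillator algebra of rank 1\<close>

datatype osc_gen = Uq uq_gen | gX | gY

text \<open>The parameter \<open>C0\<close> is an element of \<open>uq_algebra q\<close> (intended to be central), that is, a coset;
  the relation \<open>qYX - XY = C0\<close> is imposed for each of its representatives, all of which are
  equivalent modulo the relations of \<open>uq_algebra q\<close>.\<close>

definition osc_relations ::
    "'k::field \<Rightarrow> (uq_gen, 'k) free_algebra set \<Rightarrow> (osc_gen, 'k) free_algebra set" where
  "osc_relations q C0 =
     (let E = gen (Uq gE); F = gen (Uq gF); K = gen (Uq gK); Kinv = gen (Uq gKinv);
          X = gen gX; Y = gen gY in
      free_map Uq ` uq_relations q \<union>
      {E * X - const q * X * E,
       E * Y - (X + const (inverse q) * Y * E),
       F * X - (Y * Kinv + X * F),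
       F * Y - Y * F,
       K * X * Kinv - const q * X,
       K * Y * Kinv - const (inverse q) * Y} \<union>
      {const q * Y * X - X * Y - free_map Uq c | c. c \<in> C0})"

definition osc_algebra ::
    "'k::field \<Rightarrow> (uq_gen, 'k) free_algebra set \<Rightarrow> (osc_gen, 'k) free_algebra set ring" where
  "osc_algebra q C0 = presented_algebra (osc_relations q C0)"

definition osc_class ::
    "'k::field \<Rightarrow> (uq_gen, 'k) free_algebra set \<Rightarrow>
     (osc_gen, 'k) free_algebra \<Rightarrow> (osc_gen, 'k) free_algebra set" where
  "osc_class q C0 = presented_class (osc_relations q C0)"

text \<open>The canonical homomorphism from \<open>uq_algebra q\<close> to \<open>osc_algebra q C0\<close>; the cosets in the union
  all coincide.\<close>

definition uq_to_osc ::
    "'k::field \<Rightarrow> (uq_gen, 'k) free_algebra set \<Rightarrow>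
     (uq_gen, 'k) free_algebra set \<Rightarrow> (osc_gen, 'k) free_algebra set" where
  "uq_to_osc q C0 u = (\<Union>p\<in>u. osc_class q C0 (free_map Uq p))"

text \<open>\<open>Z(r) = A / (AE + AX + A(K - r))\<close> and its simple quotient \<open>V(r)\<close>.\<close>

definition osc_verma ::
    "'k::field \<Rightarrow> (uq_gen, 'k) free_algebra set \<Rightarrow> 'k \<Rightarrow>
     ((osc_gen, 'k) free_algebra set, (osc_gen, 'k) free_algebra set set) module" where
  "osc_verma q C0 r =
     (let A = osc_algebra q C0; E = osc_class q C0 (gen (Uq gE)); X = osc_class q C0 (gen gX);
          Kr = osc_class q C0 (gen (Uq gK) - const r) in
      quotient_module (regular_module A)
        {a \<otimes>\<^bsub>A\<^esub> E \<oplus>\<^bsub>A\<^esub> b \<otimes>\<^bsub>A\<^esub> X \<oplus>\<^bsub>A\<^esub> c \<otimes>\<^bsub>A\<^esub> Kr | a b c.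
           a \<in> carrier A \<and> b \<in> carrier A \<and> c \<in> carrier A})"

definition osc_simple ::
    "'k::field \<Rightarrow> (uq_gen, 'k) free_algebra set \<Rightarrow> 'k \<Rightarrow>
     ((osc_gen, 'k) free_algebra set, (osc_gen, 'k) free_algebra set set set) module" where
  "osc_simple q C0 r = unique_simple_quotient (osc_algebra q C0) (osc_verma q C0 r)"

text \<open>The \<open>k\<close>-vector space underlying an \<open>A\<close>-module, with scalars acting through \<open>k \<rightarrow> A\<close>.\<close>

definition osc_vector_space ::
    "'k::field \<Rightarrow> (uq_gen, 'k) free_algebra set \<Rightarrow>
     ((osc_gen, 'k) free_algebra set, 'b, 'd) module_scheme \<Rightarrow> ('k, 'b) module" where
  "osc_vector_space q C0 M = restrict_scalars (\<lambda>c. osc_class q C0 (const c)) M"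

definition fin_dim_osc_module ::
    "'k::field \<Rightarrow> (uq_gen, 'k) free_algebra set \<Rightarrow>
     ((osc_gen, 'k) free_algebra set, 'b, 'd) module_scheme \<Rightarrow> bool" where
  "fin_dim_osc_module q C0 M \<longleftrightarrow>
     left_module (osc_algebra q C0) M \<and>
     vectorspace.fin_dim class_ring (osc_vector_space q C0 M)"

end

theory Submission
  imports Defs "HOL-Library.Product_Plus" "HOL-Library.Function_Algebras"
begin

text \<open>Let \<open>M\<close> be a finite dimensional \<open>A\<close>-module. Since \<open>K E = q\<^sup>2 E K\<close> with \<open>K\<close> invertible and \<open>q\<close> not a
root of unity, \<open>E\<close> is nilpotent on \<open>M\<close>, and so is \<open>F\<close> (\<open>skew_commuting_nilpotent\<close>). A vector killed
by \<open>E\<close> and by \<open>F\<close> to the power \<open>n\<close> is killed by the product of the \<open>K\<^sup>2 - q ^ (2 * i)\<close> with \<open>i < n\<close>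
(\<open>highest_weights\<close>), so all eigenvalues of \<open>K\<close> on \<open>M\<close> have the form \<open>\<plusminus> q powi n\<close> (\<open>K_weights\<close>).

The choice of \<open>C0\<close> enters through a trace. As \<open>K X = q X K\<close>, the trace of \<open>K (q Y X - X Y)\<close> vanishes, so
\<open>tr (K C0) = 0\<close>; when \<open>tr (K F E)\<close> is eliminated by means of the relation for \<open>E F - F E\<close>, what remains is
\<open>(q + 1/q) tr (K\<^sup>2) = (q\<^sup>2 + 1/q\<^sup>2) tr K\<close> (\<open>trace_identity\<close>). With eigenvalues \<open>\<plusminus> q powi n\<close> and \<open>q\<close>
transcendental this is an identity between Laurent polynomials with integer coefficients, and comparing
coefficients shows that \<open>q\<close> and \<open>1/q\<close> are the only possible eigenvalues (\<open>weights_from_trace\<close>).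

The operators \<open>X\<close>, \<open>Y\<close>, \<open>E\<^sup>2\<close>, \<open>F\<^sup>2\<close> multiply eigenvalues of \<open>K\<close> by \<open>q\<close>, \<open>1/q\<close>, \<open>q ^ 4\<close>, \<open>1/q ^ 4\<close> and
therefore vanish (\<open>shift_vanishes\<close>). On the kernel of \<open>E\<close> now \<open>K = q\<close> and \<open>E F = 1\<close>, so that
\<open>v = (v - F E v) + F (E v)\<close> decomposes \<open>M\<close> as \<open>ker E \<oplus> F (ker E)\<close>. A basis of \<open>ker E\<close> thus identifies
\<open>M\<close> with copies of the plane \<open>k\<^sup>2\<close> on which \<open>E\<close> and \<open>F\<close> are the elementary matrices, \<open>K\<close> is diagonal with
entries \<open>q\<close> and \<open>1/q\<close>, and \<open>X = Y = 0\<close> (\<open>fin_dim_osc_modules\<close>); and a linear complement of \<open>N \<inter> ker E\<close>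
in \<open>ker E\<close> generates an invariant complement of a submodule \<open>N\<close> (\<open>invariant_complement\<close>).

The plane is an \<open>A\<close>-module because \<open>C0\<close> acts on it as \<open>0\<close> (\<open>uq_plane_C0\<close>), and it is simple. It is the
only simple quotient of either Verma module: the words in the lowering generators (\<open>F\<close> for \<open>U\<^sub>q\<close>,
\<open>F\<close> and \<open>Y\<close> for \<open>A\<close>) applied to the highest weight vector \<open>v\<close> span the Verma module, and all of them
except the empty word have weights \<open>q / q ^ n\<close> with \<open>n > 0\<close>. Hence every element is carried into the
line of \<open>v\<close> by a polynomial in \<open>K\<close> that acts on \<open>v\<close> as a nonzero scalar (\<open>lspan_projection\<close>), and a
submodule outside the kernel of the map to the plane contains \<open>v\<close> (\<open>cyclic_simple_quotient\<close>). So
\<open>V(q)\<close> and \<open>V\<^sub>C(q)\<close> are both isomorphic to the plane.\<close>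

section \<open>Polynomials in an operator\<close>

locale operator_space = vector_space scale
  for scale :: "'a::field \<Rightarrow> 'b::ab_group_add \<Rightarrow> 'b" (infixr \<open>*s\<close> 75)
begin

abbreviation endo :: "('b \<Rightarrow> 'b) \<Rightarrow> bool" where
  "endo T \<equiv> Vector_Spaces.linear scale scale T"

lemma endo_simps:
  assumes "endo T"
  shows "T (x + y) = T x + T y" "T (c *s x) = c *s T x" "T 0 = 0" "T (x - y) = T x - T y" "T (- x) = - T x"
    "T (sum f I) = (\<Sum>i\<in>I. T (f i))"
proof -
  interpret T: Vector_Spaces.linear scale scale T by fact
  show "T (x + y) = T x + T y" "T (c *s x) = c *s T x" "T 0 = 0" "T (x - y) = T x - T y" "T (- x) = - T x"
    "T (sum f I) = (\<Sum>i\<in>I. T (f i))"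
    by (simp_all add: T.add T.scale T.diff T.neg T.sum)
qed

lemma endoI:
  assumes "\<And>x y. T (x + y) = T x + T y" "\<And>c x. T (c *s x) = c *s T x"
  shows "endo T"
  by (intro Vector_Spaces.linear.intro module_hom.intro module_hom_axioms.intro assms vector_space_axioms module_axioms)

definition poly_act :: "('b \<Rightarrow> 'b) \<Rightarrow> 'a poly \<Rightarrow> 'b \<Rightarrow> 'b" where
  "poly_act T p v = (\<Sum>i\<le>degree p. coeff p i *s (T ^^ i) v)"

lemma poly_act_bound: "degree p \<le> n \<Longrightarrow> poly_act T p v = (\<Sum>i\<le>n. coeff p i *s (T ^^ i) v)"
  unfolding poly_act_def by (rule sum.mono_neutral_left) (auto simp: not_le coeff_eq_0)

lemma poly_act_add: "poly_act T (p + r) v = poly_act T p v + poly_act T r v"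
proof -
  let ?n = "max (degree p) (degree r)"
  have "degree (p + r) \<le> ?n" by (rule degree_add_le) auto
  then show ?thesis
    by (simp add: poly_act_bound[where n = ?n] scale_left_distrib sum.distrib)
qed

lemma poly_act_smult: "poly_act T (Polynomial.smult c p) v = c *s poly_act T p v"
  by (subst poly_act_bound[where n = "degree p"])
     (auto simp: poly_act_def scale_sum_right intro: degree_smult_le)

lemma poly_act_0 [simp]: "poly_act T 0 v = 0" by (simp add: poly_act_def)

lemma poly_act_uminus: "poly_act T (- p) v = - poly_act T p v"
  using poly_act_smult[of T "-1" p v] by simp

lemma poly_act_diff: "poly_act T (p - r) v = poly_act T p v - poly_act T r v"
  using poly_act_add[of T p "- r" v] by (simp add: poly_act_uminus)

lemma poly_act_pCons:
  assumes "endo T"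
  shows "poly_act T (pCons a p) v = a *s v + T (poly_act T p v)"
proof -
  have "poly_act T (pCons a p) v = (\<Sum>i\<le>Suc (degree p). coeff (pCons a p) i *s (T ^^ i) v)"
    by (rule poly_act_bound) (rule degree_pCons_le)
  also have "\<dots> = a *s v + (\<Sum>i\<le>degree p. coeff p i *s (T ^^ Suc i) v)"
    by (subst sum.atMost_Suc_shift) simp
  also have "(\<Sum>i\<le>degree p. coeff p i *s (T ^^ Suc i) v) = T (poly_act T p v)"
    by (simp add: poly_act_def endo_simps[OF assms])
  finally show ?thesis .
qed

lemma poly_act_linear:
  assumes "endo T" shows "endo (poly_act T p)"
proof (rule endoI)
  show "poly_act T p (x + y) = poly_act T p x + poly_act T p y" for x y
    by (induction p) (simp_all add: poly_act_pCons[OF assms] endo_simps[OF assms] scale_right_distrib)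
  show "poly_act T p (c *s x) = c *s poly_act T p x" for c x
    by (induction p) (simp_all add: poly_act_pCons[OF assms] endo_simps[OF assms] scale_right_distrib mult.commute)
qed

lemma poly_act_mult:
  assumes "endo T" shows "poly_act T (p * r) v = poly_act T p (poly_act T r v)"
  by (induction p) (simp_all add: poly_act_pCons[OF assms] poly_act_add poly_act_smult)

lemma poly_act_const [simp]: "poly_act T [:c:] v = c *s v"
  by (simp add: poly_act_def)

lemma poly_act_lin:
  assumes "endo T" shows "poly_act T [:a, b:] v = a *s v + b *s T v"
  using assms by (simp add: poly_act_pCons endo_simps)

lemma poly_act_closed:
  assumes "endo T" "subspace S" "\<And>v. v \<in> S \<Longrightarrow> T v \<in> S" "v \<in> S"
  shows "poly_act T p v \<in> S"
  by (induction p) (use assms in \<open>auto simp: poly_act_pCons subspace_0 intro: subspace_add subspace_scale\<close>)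

lemma poly_act_swap:
  assumes "endo K" "endo T" "subspace S" "\<And>v. v \<in> S \<Longrightarrow> K v \<in> S"
    and sw: "\<And>v. v \<in> S \<Longrightarrow> K (T v) = c *s T (K v)" and "v \<in> S"
  shows "poly_act K p (T v) = T (poly_act K (pcompose p [:0, c:]) v)"
  using \<open>v \<in> S\<close>
proof (induction p arbitrary: v)
  case 0
  then show ?case by (simp add: endo_simps(3)[OF assms(2)])
next
  case (pCons a p)
  have "poly_act K (pcompose p [:0, c:]) v \<in> S" using assms(1,3,4) pCons(3) by (rule poly_act_closed)
  then have "K (T (poly_act K (pcompose p [:0, c:]) v)) = c *s T (K (poly_act K (pcompose p [:0, c:]) v))"
    by (rule sw)
  then show ?case using pCons
    by (simp add: poly_act_pCons[OF assms(1)] pcompose_pCons poly_act_add poly_act_smult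
        endo_simps[OF assms(2)] endo_simps[OF assms(1)])
qed

lemma funpow_closed: "(\<And>v. v \<in> S \<Longrightarrow> T v \<in> S) \<Longrightarrow> v \<in> S \<Longrightarrow> (T ^^ n) v \<in> S"
  by (induction n) simp_all

lemma poly_act_monom: "poly_act T (monom c n) v = c *s (T ^^ n) v"
proof -
  have "poly_act T (monom c n) v = (\<Sum>i\<le>n. coeff (monom c n) i *s (T ^^ i) v)"
    by (rule poly_act_bound) (rule degree_monom_le)
  also have "\<dots> = (\<Sum>i\<le>n. if i = n then c *s (T ^^ i) v else 0)" by (rule sum.cong) auto
  finally show ?thesis by simp
qed

lemma poly_act_sum: "poly_act T (\<Sum>i\<in>I. f i) v = (\<Sum>i\<in>I. poly_act T (f i) v)"
  by (induction I rule: infinite_finite_induct) (simp_all add: poly_act_add)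

text \<open>Infinitely many iterates in a finite dimensional space: either two of them coincide,
or they form an infinite set, which is linearly dependent. The cases are separate because dependence is
a property of sets, not of families.\<close>

lemma pointwise_annihilator:
  assumes S: "\<And>i. (T ^^ i) v \<in> span B" and "finite B"
  obtains p where "p \<noteq> 0" "poly_act T p v = 0"
proof (cases "inj (\<lambda>i. (T ^^ i) v)")
  case False
  then obtain i j where ij: "i \<noteq> j" "(T ^^ i) v = (T ^^ j) v" by (auto simp: inj_def)
  have "coeff (monom 1 i - monom (1::'a) j) i = 1" using ij by simp
  then have "monom 1 i - monom (1::'a) j \<noteq> 0" by (metis coeff_0 zero_neq_one)
  moreover have "poly_act T (monom 1 i - monom 1 j) v = 0"
    by (simp add: poly_act_diff poly_act_monom ij)
  ultimately show ?thesis using that by blast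
next
  case True
  let ?g = "\<lambda>i. (T ^^ i) v"
  have inf: "infinite (range ?g)" using True finite_imageD by blast
  have "dependent (range ?g)"
    using independent_span_bound[OF \<open>finite B\<close>, of "range ?g"] S inf by auto
  then obtain t u w where t: "finite t" "t \<subseteq> range ?g" "(\<Sum>v\<in>t. u v *s v) = 0" "w \<in> t" "u w \<noteq> 0"
    unfolding dependent_explicit by blast
  obtain I where I: "finite I" "t = ?g ` I" using finite_subset_image[OF t(1,2)] by auto
  have injI: "inj_on ?g I" using True inj_on_subset by blast
  obtain i0 where i0: "i0 \<in> I" "w = ?g i0" using I t(4) by auto
  let ?p = "\<Sum>i\<in>I. monom (u (?g i)) i"
  have "coeff ?p i0 = u w"
    by (simp add: coeff_sum I i0 if_distrib sum.delta cong: if_cong)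
  then have "?p \<noteq> 0" using t(5) by (metis coeff_0)
  moreover have "poly_act T ?p v = 0"
    using t(3) by (simp add: poly_act_sum poly_act_monom I sum.reindex[OF injI])
  ultimately show ?thesis using that by blast
qed

text \<open>Polynomials in \<open>T\<close> commute, so the product of polynomials annihilating the single
spanning vectors annihilates them all.\<close>

lemma annihilator:
  assumes T: "endo T" and S: "S \<subseteq> span B" "finite B" "B \<subseteq> S" "subspace S" "\<And>v. v \<in> S \<Longrightarrow> T v \<in> S"
  obtains p where "p \<noteq> 0" "\<And>v. v \<in> S \<Longrightarrow> poly_act T p v = 0"
proof -
  have "\<exists>p. p \<noteq> 0 \<and> poly_act T p b = 0" if "b \<in> B" for b
  proof -
    have "(T ^^ i) b \<in> span B" for i
      using funpow_closed[of S T b i] S(1,3,5) that by blast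
    then obtain p where "p \<noteq> 0" "poly_act T p b = 0" by (rule pointwise_annihilator[OF _ S(2)])
    then show ?thesis by blast
  qed
  then obtain f where f: "\<And>b. b \<in> B \<Longrightarrow> f b \<noteq> 0 \<and> poly_act T (f b) b = 0" by metis
  let ?p = "\<Prod>b\<in>B. f b"
  have "poly_act T ?p b = 0" if "b \<in> B" for b
  proof -
    have "?p = (\<Prod>b\<in>B-{b}. f b) * f b" using that S(2) by (subst prod.remove[of _ b]) (simp_all add: mult.commute)
    then show ?thesis using f that by (simp add: poly_act_mult T endo_simps poly_act_linear)
  qed
  moreover have "{v. poly_act T ?p v = 0} = {v. poly_act T ?p v \<in> {0}}" by simp
  moreover have "subspace {v. poly_act T ?p v = 0}"
    unfolding subspace_def by (simp add: endo_simps[OF poly_act_linear[OF T]])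
  ultimately have "span B \<subseteq> {v. poly_act T ?p v = 0}" by (intro span_minimal) auto
  with S(1) f S(2) show ?thesis by (intro that[of ?p]) (auto simp: prod_zero_iff)
qed

text \<open>Among all nonzero polynomials \<open>p\<close> and exponents \<open>N\<close> such that \<open>p(K)\<close> kills the image of
\<open>T ^^ N\<close> choose a pair with \<open>p\<close> of least degree. Then \<open>p(K)\<close> and \<open>p(K/c)\<close> both kill the image of the next
power of \<open>T\<close>; after scaling, their difference has smaller degree and so must be zero. As the powers of
\<open>c\<close> are distinct, \<open>p\<close> is a monomial, and since \<open>K\<close> is injective, \<open>T ^^ N\<close> vanishes.\<close>

lemma skew_commuting_nilpotent:
  assumes K: "endo K" and T: "endo T" and S: "subspace S" "S \<subseteq> span B" "finite B" "B \<subseteq> S"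
    and KS: "\<And>v. v \<in> S \<Longrightarrow> K v \<in> S" and TS: "\<And>v. v \<in> S \<Longrightarrow> T v \<in> S"
    and inj: "\<And>v. v \<in> S \<Longrightarrow> K v = 0 \<Longrightarrow> v = 0"
    and sw: "\<And>v. v \<in> S \<Longrightarrow> K (T v) = c *s T (K v)"
    and c: "c \<noteq> 0" "\<And>n. n > 0 \<Longrightarrow> c ^ n \<noteq> 1"
  obtains N where "\<And>v. v \<in> S \<Longrightarrow> (T ^^ N) v = 0"
proof -
  define Q where "Q d \<longleftrightarrow> (\<exists>p N. p \<noteq> 0 \<and> degree p = d \<and> (\<forall>v\<in>S. poly_act K p ((T ^^ N) v) = 0))" for d
  have "\<exists>p. p \<noteq> 0 \<and> (\<forall>v\<in>S. poly_act K p v = 0)"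
    by (rule annihilator[OF K S(2,3,4,1) KS]) blast+
  then obtain p0 where "p0 \<noteq> 0" "\<And>v. v \<in> S \<Longrightarrow> poly_act K p0 v = 0" by blast
  then have "Q (degree p0)" unfolding Q_def by (intro exI[of _ p0] exI[of _ 0]) auto
  then obtain d where Qd: "Q d" and dmin: "\<And>e. e < d \<Longrightarrow> \<not> Q e"
    using exists_least_iff[of Q] by blast
  then obtain p N where p: "p \<noteq> 0" "degree p = d" "\<And>v. v \<in> S \<Longrightarrow> poly_act K p ((T ^^ N) v) = 0"
    unfolding Q_def by blast
  note d_def = p(2)[symmetric]
  have TN: "(T ^^ n) v \<in> S" if "v \<in> S" for n v by (rule funpow_closed[OF TS that])
  \<comment> \<open>\<open>p'(K) = p(K/c)\<close>; moving \<open>p'(K)\<close> past \<open>T\<close> turns it back into \<open>p(K)\<close>\<close>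
  define p' where "p' = pcompose p [:0, inverse c:]"
  have pp: "pcompose p' [:0, c:] = p" unfolding p'_def
    using c by (simp flip: pcompose_assoc add: pcompose_pCons pcompose_idR)
  have coeffp': "coeff p' i = inverse c ^ i * coeff p i" for i
    unfolding p'_def by (simp add: coeff_pcompose_linear)
  have k1: "poly_act K p ((T ^^ Suc N) v) = 0" if "v \<in> S" for v
    using p(3)[OF TS[OF that]] by (simp add: funpow_swap1)
  have k2: "poly_act K p' ((T ^^ Suc N) v) = 0" if "v \<in> S" for v
    using poly_act_swap[OF K T S(1) KS sw TN[OF that, of N], of p'] p(3)[OF that] endo_simps(3)[OF T]
    by (simp add: pp)
  define r where "r = Polynomial.smult (inverse c ^ d) p - p'"
  have r0: "poly_act K r ((T ^^ Suc N) v) = 0" if "v \<in> S" for v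
    using k1[OF that] k2[OF that] by (simp add: r_def poly_act_diff poly_act_smult)
  have coeffr: "coeff r i = (inverse c ^ d - inverse c ^ i) * coeff p i" for i
    by (simp add: r_def coeffp' algebra_simps)
  have "r = 0"
  proof (rule ccontr)
    assume r: "r \<noteq> 0"
    have "degree r \<le> d" by (rule degree_le) (auto simp: coeffr d_def coeff_eq_0)
    moreover have "degree r \<noteq> d"
      using r leading_coeff_0_iff[of r] coeffr[of d] by auto
    ultimately have "degree r < d" by simp
    moreover have "Q (degree r)" unfolding Q_def using r r0 by blast
    ultimately show False using dmin by blast
  qed
  have "coeff p i = 0" if "i \<noteq> d" for i
  proof (cases "i < d")
    case True
    have "inverse c ^ d \<noteq> inverse c ^ i"
    proof
      assume "inverse c ^ d = inverse c ^ i"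
      then have "c ^ d = c ^ i" by (metis inverse_inverse_eq power_inverse)
      moreover have "c ^ d = c ^ i * c ^ (d - i)" using True by (metis le_add_diff_inverse less_imp_le power_add)
      ultimately have "c ^ i * c ^ (d - i) = c ^ i * 1" by (simp only: mult_1_right)
      then have "c ^ (d - i) = 1" using c(1) by (metis mult_cancel_left power_not_zero)
      then show False using c(2)[of "d - i"] True by simp
    qed
    moreover have "(inverse c ^ d - inverse c ^ i) * coeff p i = 0"
      unfolding coeffr[symmetric] \<open>r = 0\<close> by (rule coeff_0)
    ultimately show ?thesis by (metis mult_eq_0_iff right_minus_eq)
  next
    case False
    then have "degree p < i" using that unfolding d_def by linarith
    then show ?thesis by (rule coeff_eq_0)
  qed
  then obtain a where pa: "p = monom a d" using coeff_monom by (metis poly_eqI)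
  then have pv: "poly_act K p v = a *s (K ^^ d) v" for v by (simp add: poly_act_monom)
  have "a \<noteq> 0" using p(1) pa by auto
  then have z: "(K ^^ d) ((T ^^ N) v) = 0" if "v \<in> S" for v
    using p(3)[OF that] pv by simp
  have KN: "(K ^^ n) v \<in> S" if "v \<in> S" for n v by (rule funpow_closed[OF KS that])
  have "(K ^^ n) v = 0 \<Longrightarrow> v = 0" if "v \<in> S" for n v
    by (induction n) (use inj KN[OF that] in auto)
  then show ?thesis using that z TN by blast
qed

section \<open>Traces and triangular bases\<close>

text \<open>The operators of interest act on a finite dimensional subspace of an ambient space that may
be infinite dimensional, so the trace is taken with respect to a basis of that subspace.\<close>

definition btrace :: "'b set \<Rightarrow> ('b \<Rightarrow> 'b) \<Rightarrow> 'a" where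
  "btrace B T = (\<Sum>b\<in>B. representation B (T b) b)"

lemma btrace_commute:
  assumes B: "independent B" "finite B" and T: "endo T" and U: "endo U"
    and TB: "\<And>v. v \<in> span B \<Longrightarrow> T v \<in> span B" and UB: "\<And>v. v \<in> span B \<Longrightarrow> U v \<in> span B"
  shows "btrace B (\<lambda>v. T (U v)) = btrace B (\<lambda>v. U (T v))"
proof -
  have expand: "representation B (T' (U' b)) b = (\<Sum>c\<in>B. representation B (U' b) c * representation B (T' c) b)"
    if T': "endo T'" and T'B: "\<And>v. v \<in> span B \<Longrightarrow> T' v \<in> span B"
      and U'B: "\<And>v. v \<in> span B \<Longrightarrow> U' v \<in> span B" and b: "b \<in> B" for T' U' b
  proof -
    have "U' b \<in> span B" by (rule U'B[OF span_base[OF b]])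
    then have "U' b = (\<Sum>c\<in>B. representation B (U' b) c *s c)"
      by (rule sum_representation_eq[OF B(1) _ B(2) order_refl, symmetric])
    then have "T' (U' b) = T' (\<Sum>c\<in>B. representation B (U' b) c *s c)"
      by (rule arg_cong)
    also have "\<dots> = (\<Sum>c\<in>B. representation B (U' b) c *s T' c)"
      by (simp only: endo_simps[OF T'])
    finally have eq: "T' (U' b) = (\<Sum>c\<in>B. representation B (U' b) c *s T' c)" .
    have "T' c \<in> span B" if "c \<in> B" for c by (rule T'B[OF span_base[OF that]])
    then show ?thesis unfolding eq
      by (simp add: representation_sum[OF B(1)] representation_scale[OF B(1)] span_scale)
  qed
  have "btrace B (\<lambda>v. T (U v)) = (\<Sum>b\<in>B. \<Sum>c\<in>B. representation B (U b) c * representation B (T c) b)"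
    unfolding btrace_def using expand[of T U, OF T TB UB] by (intro sum.cong) auto
  also have "\<dots> = (\<Sum>c\<in>B. \<Sum>b\<in>B. representation B (T c) b * representation B (U b) c)"
    by (subst sum.swap) (simp add: mult.commute)
  also have "\<dots> = btrace B (\<lambda>v. U (T v))"
    unfolding btrace_def using expand[of U T, OF U UB TB] by (intro sum.cong) auto
  finally show ?thesis .
qed

lemma btrace_cong: "(\<And>b. b \<in> B \<Longrightarrow> T b = U b) \<Longrightarrow> btrace B T = btrace B U"
  by (simp add: btrace_def)

lemma btrace_add:
  assumes "independent B" "\<And>b. b \<in> B \<Longrightarrow> T b \<in> span B" "\<And>b. b \<in> B \<Longrightarrow> U b \<in> span B"
  shows "btrace B (\<lambda>v. T v + U v) = btrace B T + btrace B U"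
  using assms by (simp add: btrace_def representation_add sum.distrib)

lemma btrace_diff:
  assumes "independent B" "\<And>b. b \<in> B \<Longrightarrow> T b \<in> span B" "\<And>b. b \<in> B \<Longrightarrow> U b \<in> span B"
  shows "btrace B (\<lambda>v. T v - U v) = btrace B T - btrace B U"
  using assms by (simp add: btrace_def representation_diff sum_subtractf)

lemma btrace_scale:
  assumes "independent B" "\<And>b. b \<in> B \<Longrightarrow> T b \<in> span B"
  shows "btrace B (\<lambda>v. c *s T v) = c * btrace B T"
  using assms by (simp add: btrace_def representation_scale sum_distrib_left)

definition linear_factors :: "'a list \<Rightarrow> 'a poly" where
  "linear_factors as = (\<Prod>a\<leftarrow>as. [:- a, 1:])"

lemma linear_factors_simps [simp]: "linear_factors [] = 1" "linear_factors (a # as) = [:- a, 1:] * linear_factors as" "linear_factors (as @ bs) = linear_factors as * linear_factors bs"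
  by (simp_all add: linear_factors_def)

lemma poly_linear_factors_0: "poly (linear_factors as) x = 0 \<longleftrightarrow> x \<in> set as"
  by (induction as) auto

lemma poly_act_1 [simp]: "poly_act T 1 v = v"
  by (simp add: poly_act_def)

lemma poly_act_commute: "endo T \<Longrightarrow> poly_act T p (poly_act T r v) = poly_act T r (poly_act T p v)"
  by (metis poly_act_mult mult.commute)

lemma poly_act_eigenvector:
  assumes T: "endo T" and v: "T v = b *s v"
  shows "poly_act T p v = poly p b *s v"
  by (induction p) (simp_all add: poly_act_pCons[OF T] endo_simps[OF T] v scale_left_distrib mult.commute)

text \<open>The coprimality of two products of linear factors, without Bezout coefficients: the factors
of the second product are removed one at a time, and each time what is left is an eigenvector of \<open>T\<close>
whose eigenvalue is not a root of the first product.\<close>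

lemma poly_act_linear_factors_disjoint:
  assumes T: "endo T" and dis: "set as \<inter> set bs = {}"
    and v: "poly_act T (linear_factors as) v = 0" "poly_act T (linear_factors bs) v = 0"
  shows "v = 0"
  using dis v
proof (induction bs arbitrary: v)
  case (Cons b bs)
  note L = endo_simps(3)[OF poly_act_linear[OF T]]
  define w where "w = poly_act T [:- b, 1:] v"
  have "poly_act T (linear_factors as) w = poly_act T [:- b, 1:] (poly_act T (linear_factors as) v)"
    unfolding w_def by (rule poly_act_commute[OF T])
  then have "poly_act T (linear_factors as) w = 0" using Cons.prems(2) by (simp only: L)
  moreover have "poly_act T (linear_factors bs) w = poly_act T (linear_factors (b # bs)) v"
    unfolding w_def linear_factors_simps by (metis poly_act_mult[OF T] mult.commute)
  then have "poly_act T (linear_factors bs) w = 0" using Cons.prems(3) by (simp only:)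
  ultimately have "w = 0" using Cons.IH[of w] Cons.prems(1) by simp
  then have "T v = b *s v" by (simp add: w_def poly_act_lin[OF T])
  then have "poly (linear_factors as) b *s v = 0"
    using Cons.prems(2) poly_act_eigenvector[OF T, of v b "linear_factors as"] by (simp only:)
  moreover have "poly (linear_factors as) b \<noteq> 0" using Cons.prems(1) by (simp add: poly_linear_factors_0)
  ultimately show ?case by simp
qed simp

text \<open>In a suitable order of the basis \<open>B\<close> of \<open>W\<close> the operator \<open>K\<close> is triangular with diagonal \<open>\<alpha>\<close>;
recorded are the two consequences for traces, namely the diagonals of \<open>K\<close> and of \<open>K\<^sup>2\<close>. The list \<open>cs\<close>
transfers information on the diagonal back to \<open>K\<close>: its linear factors, all of them taken from
the diagonal, multiply to a polynomial that annihilates \<open>K\<close>.\<close>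

definition triangular_on where
  "triangular_on K W B \<alpha> cs \<longleftrightarrow> finite B \<and> independent B \<and> span B = W
    \<and> set cs \<subseteq> \<alpha> ` B \<and> (\<forall>v\<in>W. poly_act K (linear_factors cs) v = 0)
    \<and> (\<forall>b\<in>B. representation B (K b) b = \<alpha> b \<and> representation B (K (K b)) b = \<alpha> b ^ 2)"

text \<open>The subspaces killed by the products over the suffixes of \<open>as\<close> form a flag. \<open>K - a\<close> maps the
subspace of \<open>a # as\<close> into that of \<open>as\<close>, so that extending a basis of the smaller one to a basis of the
larger one adds only diagonal entries \<open>a\<close>. An \<open>a\<close> that adds no basis vector is left out of \<open>cs\<close>.\<close>

lemma triangular_basis:
  assumes K: "endo K" and S: "subspace S" "S \<subseteq> span D" "finite D" and KS: "\<And>v. v \<in> S \<Longrightarrow> K v \<in> S"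
  shows "\<exists>B \<alpha> cs. triangular_on K {v \<in> S. poly_act K (linear_factors as) v = 0} B \<alpha> cs \<and> \<alpha> ` B \<subseteq> set as"
proof (induction as)
  case Nil
  have "triangular_on K {v \<in> S. poly_act K (linear_factors []) v = 0} {} (\<lambda>_. 0) []"
    using S(1) by (auto simp: triangular_on_def subspace_0 independent_empty)
  moreover have "(\<lambda>_. 0) ` {} \<subseteq> set []" by simp
  ultimately show ?case by blast
next
  case (Cons a as)
  note L = poly_act_linear[OF K]
  define W where "W as = {v \<in> S. poly_act K (linear_factors as) v = 0}" for as
  have Wexp: "W bs = {v \<in> S. poly_act K (linear_factors bs) v = 0}" for bs
    by (rule W_def)
  have W: "subspace (W as)" for as
    using S(1) unfolding W_def subspace_def by (auto simp: endo_simps[OF L])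
  obtain B \<alpha> cs where IH: "triangular_on K (W as) B \<alpha> cs" and \<alpha>1: "\<alpha> ` B \<subseteq> set as"
    using Cons unfolding Wexp by blast
  from IH have B: "finite B" "independent B" "span B = W as"
    and \<alpha>2: "set cs \<subseteq> \<alpha> ` B" and cs: "\<forall>v\<in>W as. poly_act K (linear_factors cs) v = 0"
    and diag: "\<forall>b\<in>B. representation B (K b) b = \<alpha> b \<and> representation B (K (K b)) b = \<alpha> b ^ 2"
    unfolding triangular_on_def by auto
  note \<alpha> = \<alpha>1 \<alpha>2
  have KW: "K v \<in> W bs" if "v \<in> W bs" for v bs
  proof -
    have "poly_act K (linear_factors bs) (K v) = K (poly_act K (linear_factors bs) v)"
      using poly_act_commute[OF K, of "linear_factors bs" "[:0,1:]" v] by (simp add: poly_act_lin[OF K])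
    then show ?thesis using that KS by (auto simp: W_def endo_simps[OF K])
  qed
  have sub: "W as \<subseteq> W (a # as)"
    by (auto simp only: W_def linear_factors_simps poly_act_mult[OF K] endo_simps(3)[OF L])
  have step: "K v - a *s v \<in> W as" if "v \<in> W (a # as)" for v
  proof -
    have "poly_act K (linear_factors as) (K v - a *s v) = poly_act K (linear_factors as * [:- a, 1:]) v"
      by (simp only: poly_act_mult[OF K] poly_act_lin[OF K]) simp
    also have "\<dots> = 0" using that by (simp add: W_def mult.commute)
    finally show ?thesis using that KS S(1) by (auto simp: W_def intro!: subspace_diff subspace_scale)
  qed
  have "B \<subseteq> W (a # as)" using B(3) sub span_base by blast
  then obtain B' where B': "B \<subseteq> B'" "B' \<subseteq> W (a # as)" "independent B'" "W (a # as) \<subseteq> span B'"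
    using maximal_independent_subset_extend[OF _ B(2), of "W (a # as)"] by blast
  have sp': "span B' = W (a # as)" using B'(2,4) W span_minimal by blast
  have fin': "finite B'"
  proof -
    have "B' \<subseteq> span D" using B'(2) S(2) by (auto simp: W_def)
    then show ?thesis using independent_span_bound[OF S(3) B'(3)] by blast
  qed
  define \<alpha>' where "\<alpha>' b = (if b \<in> B then \<alpha> b else a)" for b
  have ext: "representation B' v = representation B v" if "v \<in> span B" for v
    using representation_extend[OF B'(3) that B'(1)] .
  have diag': "representation B' (K b) b = \<alpha>' b \<and> representation B' (K (K b)) b = \<alpha>' b ^ 2" if b: "b \<in> B'" for b
  proof (cases "b \<in> B")
    case True
    then have "b \<in> W as" using B(3) span_base by blast
    then have "K b \<in> span B" "K (K b) \<in> span B" using KW B(3) by blast+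
    then show ?thesis using True diag by (simp add: ext \<alpha>'_def)
  next
    case False
    have bW: "b \<in> W (a # as)" using b B' by blast
    \<comment> \<open>a new basis vector does not occur in the smaller subspace\<close>
    have z: "representation B' u b = 0" if "u \<in> span B" for u
      using False that by (metis ext representation_ne_zero)
    have u1: "K b - a *s b \<in> span B" using step[OF bW] B(3) by simp
    then have "K (K b - a *s b) \<in> span B" using KW B(3) by blast
    then have "K (K b - a *s b) + a *s (K b - a *s b) \<in> span B" using u1 by (intro span_add span_scale)
    then have u2: "K (K b) - a^2 *s b \<in> span B"
      by (simp add: endo_simps[OF K] scale_right_diff_distrib power2_eq_square)
    have sp: "K b \<in> span B'" "K (K b) \<in> span B'" "b \<in> span B'" using bW KW sp' by auto
    have e: "representation B' b b = 1" using b B'(3) by (simp add: representation_basis)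
    have "representation B' (K b - a *s b) b = representation B' (K b) b - a"
      "representation B' (K (K b) - a^2 *s b) b = representation B' (K (K b)) b - a^2"
      using sp e by (simp_all add: representation_diff[OF B'(3)] representation_scale[OF B'(3)] span_scale)
    then have "representation B' (K b) b - a = 0" "representation B' (K (K b)) b - a^2 = 0"
      using z[OF u1] z[OF u2] by (simp_all only:)
    then have "representation B' (K b) b = a" "representation B' (K (K b)) b = a^2"
      by (simp_all only: right_minus_eq)
    moreover have "\<alpha>' b = a" using False by (simp add: \<alpha>'_def)
    ultimately show ?thesis by (simp only:)
  qed
  have "\<exists>B \<alpha> cs. triangular_on K (W (a # as)) B \<alpha> cs \<and> \<alpha> ` B \<subseteq> set (a # as)"
  proof (cases "B' = B")
    case True
    then have "W (a # as) = W as" using sp' B(3) by metis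
    then have "triangular_on K (W (a # as)) B \<alpha> cs" using IH by metis
    moreover have "\<alpha> ` B \<subseteq> set (a # as)" using \<alpha>(1) by auto
    ultimately show ?thesis by blast
  next
    case False
    then obtain b where b: "b \<in> B'" "b \<notin> B" using B'(1) by blast
    have im: "\<alpha>' ` B' \<subseteq> set (a # as)" using \<alpha>(1) by (auto simp: \<alpha>'_def)
    have "a \<in> \<alpha>' ` B'" using b by (force simp: \<alpha>'_def)
    moreover have "\<alpha> ` B \<subseteq> \<alpha>' ` B'" using B'(1) by (force simp: \<alpha>'_def)
    ultimately have "set (cs @ [a]) \<subseteq> \<alpha>' ` B'" using \<alpha>(2) by auto
    moreover have "poly_act K (linear_factors (cs @ [a])) v = 0" if "v \<in> W (a # as)" for v
    proof -
      have "poly_act K (linear_factors (cs @ [a])) v = poly_act K (linear_factors cs) (K v - a *s v)"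
        by (simp only: linear_factors_simps poly_act_mult[OF K]) (simp add: poly_act_lin[OF K])
      also have "\<dots> = 0" using cs step[OF that] by blast
      finally show ?thesis .
    qed
    ultimately have "triangular_on K (W (a # as)) B' \<alpha>' (cs @ [a])"
      using B'(3) fin' sp' diag' unfolding triangular_on_def by blast
    with im show ?thesis by blast
  qed
  then show ?case by (simp only: Wexp)
qed

end


section \<open>Weights of finite dimensional representations of quantum sl(2)\<close>

context operator_space
begin

lemma endo_funpow: "endo T \<Longrightarrow> endo (T ^^ n)"
  by (induction n) (auto intro!: endoI simp: endo_simps)

text \<open>\<open>T\<close> carries the generalized eigenspace of \<open>K\<close> for \<open>a\<close> into the one for \<open>c a\<close>.\<close>

lemma poly_act_linear_factors_shift:
  assumes K: "endo K" and T: "endo T" and S: "subspace S" and KS: "\<And>v. v \<in> S \<Longrightarrow> K v \<in> S"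
    and sw: "\<And>v. v \<in> S \<Longrightarrow> K (T v) = c *s T (K v)" and v: "v \<in> S"
  shows "poly_act K (linear_factors (map ((*) c) as)) (T v) = c ^ length as *s T (poly_act K (linear_factors as) v)"
proof (induction as)
  case (Cons a as)
  define u where "u = poly_act K (linear_factors as) v"
  have u: "u \<in> S" unfolding u_def using K S KS v by (rule poly_act_closed)
  have "poly_act K (linear_factors (map ((*) c) (a # as))) (T v) = poly_act K [:- (c * a), 1:] (c ^ length as *s T u)"
    by (simp only: list.map linear_factors_simps poly_act_mult[OF K] Cons.IH u_def)
  also have "\<dots> = c ^ length (a # as) *s T (K u - a *s u)"
    by (simp add: poly_act_lin[OF K] endo_simps[OF K] endo_simps[OF T] sw[OF u] scale_right_diff_distrib mult.commute
        mult.left_commute)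
  also have "K u - a *s u = poly_act K (linear_factors (a # as)) v"
    by (simp only: linear_factors_simps poly_act_mult[OF K] u_def[symmetric]) (simp add: poly_act_lin[OF K])
  finally show ?case .
qed simp

end

text \<open>\<open>L\<close> stands for the inverse of \<open>K\<close>. The relations are required only on an invariant subspace \<open>S\<close>
with finite spanning set \<open>D\<close>, because the module to be analysed will be a subspace, of coordinate vectors,
of a function type.\<close>

locale sl2_operators = operator_space scale
  for scale :: "'a::field \<Rightarrow> 'b::ab_group_add \<Rightarrow> 'b" (infixr \<open>*s\<close> 75) +
  fixes q :: 'a and S D :: "'b set" and E F K L :: "'b \<Rightarrow> 'b"
  assumes q0: "q \<noteq> 0" and q_pow: "\<And>n. n > 0 \<Longrightarrow> q ^ n \<noteq> 1"
    and S: "subspace S" "S \<subseteq> span D" "finite D" "D \<subseteq> S"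
    and endo_E: "endo E" and endo_F: "endo F" and endo_K: "endo K" and endo_L: "endo L"
    and E_S: "\<And>v. v \<in> S \<Longrightarrow> E v \<in> S" and F_S: "\<And>v. v \<in> S \<Longrightarrow> F v \<in> S"
    and K_S: "\<And>v. v \<in> S \<Longrightarrow> K v \<in> S" and L_S: "\<And>v. v \<in> S \<Longrightarrow> L v \<in> S"
    and KL: "\<And>v. v \<in> S \<Longrightarrow> K (L v) = v" and LK: "\<And>v. v \<in> S \<Longrightarrow> L (K v) = v"
    and KE: "\<And>v. v \<in> S \<Longrightarrow> K (E v) = q ^ 2 *s E (K v)"
    and KF: "\<And>v. v \<in> S \<Longrightarrow> K (F v) = inverse q ^ 2 *s F (K v)"
    and EF: "\<And>v. v \<in> S \<Longrightarrow> E (F v) - F (E v) = (1 / (q - inverse q)) *s (K v - L v)"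
begin

lemmas lin = endo_simps[OF endo_E] endo_simps[OF endo_F] endo_simps[OF endo_K] endo_simps[OF endo_L]

lemma q_minus_inv: "q - inverse q \<noteq> 0"
proof
  assume "q - inverse q = 0"
  then have "q ^ 2 = 1" using q0 by (simp add: power2_eq_square field_simps)
  then show False using q_pow[of 2] by simp
qed

lemma E_pow_S: "v \<in> S \<Longrightarrow> (E ^^ n) v \<in> S"
  by (rule funpow_closed[of S E, OF E_S])

lemma F_pow_S: "v \<in> S \<Longrightarrow> (F ^^ n) v \<in> S"
  by (rule funpow_closed[of S F, OF F_S])

lemma nilpotent:
  "\<exists>N. \<forall>v\<in>S. (E ^^ N) v = 0 \<and> (F ^^ N) v = 0"
proof -
  have inj: "v = 0" if "v \<in> S" "K v = 0" for v using LK[OF that(1)] that(2) lin(21) by (simp add: lin)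
  have "(q ^ 2) ^ n \<noteq> 1" if "n > 0" for n using q_pow[of "2 * n"] that by (simp add: power_mult)
  then obtain N1 where N1: "\<And>v. v \<in> S \<Longrightarrow> (E ^^ N1) v = 0"
    using skew_commuting_nilpotent[OF endo_K endo_E S K_S E_S inj KE] q0 by (metis power_not_zero)
  have "(inverse q ^ 2) ^ n \<noteq> 1" if "n > 0" for n
    using q_pow[of "2 * n"] that by (simp add: power_mult power_inverse)
  then obtain N2 where N2: "\<And>v. v \<in> S \<Longrightarrow> (F ^^ N2) v = 0"
    using skew_commuting_nilpotent[OF endo_K endo_F S K_S F_S inj KF] q0
    by (metis power_not_zero inverse_nonzero_iff_nonzero)
  have "(E ^^ (N2 + N1)) v = 0" "(F ^^ (N2 + N1)) v = 0" if "v \<in> S" for v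
    using N1[OF that] N2[OF F_pow_S[OF that]] endo_simps(3)[OF endo_funpow[OF endo_E]]
    by (simp_all only: funpow_add comp_def)
  then show ?thesis by blast
qed

lemma K_funpow:
  assumes "v \<in> S" shows "K ((E ^^ n) v) = (q ^ 2) ^ n *s (E ^^ n) (K v)"
    and "K ((F ^^ n) v) = (inverse q ^ 2) ^ n *s (F ^^ n) (K v)"
    and "L ((F ^^ n) v) = (q ^ 2) ^ n *s (F ^^ n) (L v)"
proof -
  show "K ((E ^^ n) v) = (q ^ 2) ^ n *s (E ^^ n) (K v)"
    by (induction n) (simp_all add: KE[OF E_pow_S[OF assms]] lin)
  have F: "K ((F ^^ n) u) = (inverse q ^ 2) ^ n *s (F ^^ n) (K u)" if "u \<in> S" for u
    by (induction n) (simp_all add: KF[OF F_pow_S[OF that]] lin)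
  show "K ((F ^^ n) v) = (inverse q ^ 2) ^ n *s (F ^^ n) (K v)" by (rule F[OF assms])
  have "K ((F ^^ n) (L v)) = (inverse q ^ 2) ^ n *s (F ^^ n) v"
    using F[OF L_S[OF assms]] KL[OF assms] by simp
  then have "L (K ((F ^^ n) (L v))) = (inverse q ^ 2) ^ n *s L ((F ^^ n) v)" by (simp add: lin)
  then have "(F ^^ n) (L v) = (inverse q ^ 2) ^ n *s L ((F ^^ n) v)"
    using LK[OF F_pow_S[OF L_S[OF assms]]] by simp
  then show "L ((F ^^ n) v) = (q ^ 2) ^ n *s (F ^^ n) (L v)"
    using q0 by (simp flip: power_mult_distrib)
qed

text \<open>The commutator of \<open>E\<close> with a power of \<open>F\<close>, applied to a vector killed by \<open>E\<close>. Up to a power of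
\<open>q\<close> the sum is the quantum integer \<open>[n + 1]\<close>.\<close>

lemma E_F_funpow:
  assumes v: "v \<in> S" "E v = 0"
  shows "E ((F ^^ Suc n) v) =
    ((\<Sum>i<Suc n. (inverse q ^ 2) ^ i) / (q - inverse q)) *s (F ^^ n) (K v - (q ^ 2) ^ n *s L v)"
proof -
  \<comment> \<open>the coefficients of \<open>K v\<close> and of \<open>L v\<close>; they are proportional to each other\<close>
  define a b where "a n = (\<Sum>i<n. (inverse q ^ 2) ^ i)" and "b n = (\<Sum>i<n. (q ^ 2) ^ i)" for n :: nat
  let ?c = "1 / (q - inverse q)"
  have *: "E ((F ^^ Suc n) v) = ?c *s (F ^^ n) (a (Suc n) *s K v - b (Suc n) *s L v)" for n
  proof (induction n)
    case 0
    then show ?case using EF[OF v(1)] v(2) by (simp add: a_def b_def lin)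
  next
    case (Suc n)
    let ?u = "(F ^^ Suc n) v"
    note G = endo_simps[OF endo_funpow[OF endo_F]]
    have u: "?u \<in> S" by (rule F_pow_S[OF v(1)])
    have "E ((F ^^ Suc (Suc n)) v) = F (E ?u) + ?c *s (K ?u - L ?u)"
      using EF[OF u] by (simp add: algebra_simps)
    also have "F (E ?u) = ?c *s (F ^^ Suc n) (a (Suc n) *s K v - b (Suc n) *s L v)"
      unfolding Suc by (simp add: lin)
    also have "K ?u - L ?u = (F ^^ Suc n) ((inverse q ^ 2) ^ Suc n *s K v - (q ^ 2) ^ Suc n *s L v)"
      by (simp only: K_funpow[OF v(1)] G)
    finally have "E ((F ^^ Suc (Suc n)) v) = ?c *s (F ^^ Suc n)
       (a (Suc n) *s K v - b (Suc n) *s L v + ((inverse q ^ 2) ^ Suc n *s K v - (q ^ 2) ^ Suc n *s L v))"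
      by (simp only: G scale_right_distrib)
    also have "a (Suc n) *s K v - b (Suc n) *s L v + ((inverse q ^ 2) ^ Suc n *s K v - (q ^ 2) ^ Suc n *s L v)
       = a (Suc (Suc n)) *s K v - b (Suc (Suc n)) *s L v"
      by (simp add: a_def b_def scale_left_distrib algebra_simps)
    finally show ?case .
  qed
  have "b (Suc n) = (q ^ 2) ^ n * a (Suc n)"
  proof -
    have "(q ^ 2) ^ n * a (Suc n) = (\<Sum>i<Suc n. (q ^ 2) ^ (n - i))"
      unfolding a_def sum_distrib_left
    proof (rule sum.cong)
      fix i assume "i \<in> {..<Suc n}"
      then have "(q ^ 2) ^ n = (q ^ 2) ^ (n - i) * (q ^ 2) ^ i" by (simp flip: power_add)
      then show "(q ^ 2) ^ n * (inverse q ^ 2) ^ i = (q ^ 2) ^ (n - i)"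
        using q0 by (simp add: power_inverse)
    qed simp
    also have "\<dots> = b (Suc n)" unfolding b_def
      using sum.nat_diff_reindex[of "\<lambda>i. (q ^ 2) ^ i" "Suc n"] by simp
    finally show ?thesis by simp
  qed
  then have "a (Suc n) *s K v - b (Suc n) *s L v = a (Suc n) *s (K v - (q ^ 2) ^ n *s L v)"
    by (simp add: scale_right_diff_distrib mult.commute)
  then show ?thesis using *[of n] by (simp add: endo_simps[OF endo_funpow[OF endo_F]] a_def)
qed

primrec candidate_weights :: "nat \<Rightarrow> 'a list" where
  "candidate_weights 0 = []"
| "candidate_weights (Suc n) = candidate_weights n @ [q ^ n, - (q ^ n)]"

text \<open>Applying \<open>E\<close> to \<open>F ^^ Suc n\<close> at \<open>v\<close> gives a nonzero multiple of \<open>F ^^ n\<close> at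
\<open>w = K v - q ^ (2 * n) L v\<close>. So the claim for \<open>n\<close> holds for \<open>w\<close>, and \<open>K w\<close> is
\<open>K\<^sup>2 - q ^ (2 * n)\<close> applied to \<open>v\<close>.\<close>

lemma highest_weights:
  assumes "v \<in> S" "E v = 0" "(F ^^ n) v = 0"
  shows "poly_act K (linear_factors (candidate_weights n)) v = 0"
  using assms
proof (induction n arbitrary: v)
  case (Suc n)
  define w where "w = K v - (q ^ 2) ^ n *s L v"
  have "E (K v) = 0"
  proof -
    have "q ^ 2 *s E (K v) = 0" using KE[OF Suc.prems(1)] Suc.prems(2) by (simp add: lin)
    then show ?thesis using q0 by simp
  qed
  moreover have "E (L v) = 0"
  proof -
    have "K (E (L v)) = 0" using KE[OF L_S[OF Suc.prems(1)]] KL[OF Suc.prems(1)] Suc.prems(2) by simp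
    then have "L (K (E (L v))) = 0" by (simp add: lin)
    then show ?thesis using LK[OF E_S[OF L_S[OF Suc.prems(1)]]] by simp
  qed
  ultimately have Ew: "E w = 0" by (simp add: w_def lin)
  have wS: "w \<in> S" unfolding w_def using S(1) K_S L_S Suc.prems(1) by (intro subspace_diff subspace_scale)
  let ?a = "\<Sum>i<Suc n. (inverse q ^ 2) ^ i"
  have "(?a / (q - inverse q)) *s (F ^^ n) w = 0"
    using E_F_funpow[OF Suc.prems(1,2), of n] Suc.prems(3) unfolding w_def by (simp only: lin)
  moreover have "?a \<noteq> 0"
  proof
    assume "?a = 0"
    then have "(inverse q ^ 2) ^ Suc n = 1"
      using power_diff_1_eq[of "inverse q ^ 2" "Suc n"] by simp
    then have "(q ^ 2) ^ Suc n = 1" by (metis inverse_1 inverse_inverse_eq power_inverse)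
    then have "q ^ (2 * Suc n) = 1" by (simp only: power_mult)
    then show False using q_pow[of "2 * Suc n"] by simp
  qed
  ultimately have "(F ^^ n) w = 0" using q_minus_inv by simp
  then have IH: "poly_act K (linear_factors (candidate_weights n)) w = 0" by (rule Suc.IH[OF wS Ew])
  have "poly_act K (linear_factors [q ^ n, - (q ^ n)]) v = K w"
    by (simp add: poly_act_pCons[OF endo_K] lin w_def KL[OF Suc.prems(1)] flip: power_mult)
       (simp add: power_mult_distrib mult.commute power2_eq_square power_mult algebra_simps)
  then have "poly_act K (linear_factors (candidate_weights (Suc n))) v = poly_act K (linear_factors (candidate_weights n)) (K w)"
    by (simp only: candidate_weights.simps linear_factors_simps poly_act_mult[OF endo_K])
  also have "\<dots> = K (poly_act K (linear_factors (candidate_weights n)) w)"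
    using poly_act_commute[OF endo_K, of "linear_factors (candidate_weights n)" "[:0, 1:]" w] by (simp add: poly_act_lin[OF endo_K])
  finally show ?case using IH by (simp add: lin)
qed simp

definition weights :: "'a set" where
  "weights = {x. \<exists>n::int. x = q powi n \<or> x = - (q powi n)}"

lemma candidate_weights_weights: "set (candidate_weights n) \<subseteq> weights"
proof (induction n)
  case (Suc n)
  have "q ^ n \<in> weights" "- (q ^ n) \<in> weights" unfolding weights_def by (auto intro: exI[of _ "int n"])
  with Suc show ?case by simp
qed simp

text \<open>If \<open>E ^^ Suc r\<close> kills \<open>v\<close>, then \<open>E\<close> kills \<open>(E ^^ r) v\<close>, whose weights are known. Divided by
\<open>q ^ (2 * r)\<close> they yield a polynomial in \<open>K\<close> that moves \<open>v\<close> into the kernel of \<open>E ^^ r\<close>, and induction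
applies.\<close>

lemma E_power_weights:
  assumes "v \<in> S" "(E ^^ r) v = 0" and N: "\<And>v. v \<in> S \<Longrightarrow> (F ^^ N) v = 0"
  shows "\<exists>as. set as \<subseteq> weights \<and> poly_act K (linear_factors as) v = 0"
  using assms(1,2)
proof (induction r arbitrary: v)
  case 0
  then show ?case by (intro exI[of _ "[]"]) simp
next
  case (Suc r)
  have ES: "(E ^^ r) v \<in> S" by (rule E_pow_S[OF Suc.prems(1)])
  have z: "poly_act K (linear_factors (candidate_weights N)) ((E ^^ r) v) = 0"
    by (rule highest_weights[OF ES _ N[OF ES]]) (use Suc.prems(2) in simp)
  let ?c = "(q ^ 2) ^ r"
  define as where "as = map (\<lambda>a. a / ?c) (candidate_weights N)"
  have c0: "?c \<noteq> 0" using q0 by simp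
  have "map ((*) ?c) as = candidate_weights N" using q0 by (simp add: as_def comp_def)
  then have "?c ^ length as *s (E ^^ r) (poly_act K (linear_factors as) v) = 0"
    using poly_act_linear_factors_shift[OF endo_K endo_funpow[OF endo_E] S(1) K_S K_funpow(1) Suc.prems(1), of r as] z by (simp only:)
  then have "(E ^^ r) (poly_act K (linear_factors as) v) = 0" using power_not_zero[OF c0] by (simp only: scale_eq_0_iff simp_thms)
  moreover have "poly_act K (linear_factors as) v \<in> S" 
    by (rule poly_act_closed[OF endo_K S(1) K_S Suc.prems(1)])
  ultimately obtain bs where bs: "set bs \<subseteq> weights" "poly_act K (linear_factors bs) (poly_act K (linear_factors as) v) = 0"
    using Suc.IH by blast
  have "x / ?c \<in> weights" if "x \<in> weights" for x
  proof -
    from that obtain n where n: "x = q powi n \<or> x = - (q powi n)" unfolding weights_def by blast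
    have eq: "q powi n / ?c = q powi (n - int (2 * r))"
      by (simp only: power_int_diff[OF disjI1[OF q0]] power_int_of_nat power_mult)
    from n have "x / ?c = q powi (n - int (2 * r)) \<or> x / ?c = - (q powi (n - int (2 * r)))"
    proof
      assume "x = - (q powi n)"
      then have "x / ?c = - (q powi n / ?c)" by simp
      then show ?thesis unfolding eq by blast
    qed (simp only: eq simp_thms)
    then show ?thesis unfolding weights_def by blast
  qed
  then have "set as \<subseteq> weights" unfolding as_def using candidate_weights_weights by auto
  then show ?case using bs by (intro exI[of _ "bs @ as"]) (simp add: poly_act_mult[OF endo_K])
qed

lemma K_weights: "\<exists>as. set as \<subseteq> weights \<and> (\<forall>v\<in>S. poly_act K (linear_factors as) v = 0)"
proof -
  note L = endo_simps[OF poly_act_linear[OF endo_K]]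
  obtain N where N: "\<And>v. v \<in> S \<Longrightarrow> (E ^^ N) v = 0" "\<And>v. v \<in> S \<Longrightarrow> (F ^^ N) v = 0"
    using nilpotent by blast
  have "\<exists>as. set as \<subseteq> weights \<and> (\<forall>v\<in>D'. poly_act K (linear_factors as) v = 0)" if "finite D'" "D' \<subseteq> S" for D'
    using that
  proof (induction D' rule: finite_induct)
    case empty
    then show ?case by (intro exI[of _ "[]"]) simp
  next
    case (insert d D')
    then obtain as where as: "set as \<subseteq> weights" "\<forall>v\<in>D'. poly_act K (linear_factors as) v = 0" by auto
    have "d \<in> S" using insert.prems by simp
    then obtain bs where bs: "set bs \<subseteq> weights" "poly_act K (linear_factors bs) d = 0"
      using E_power_weights[OF _ N(1) N(2)] by blast
    have "poly_act K (linear_factors (as @ bs)) d = 0"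
      by (simp only: linear_factors_simps poly_act_mult[OF endo_K] bs(2) L(3))
    moreover have "poly_act K (linear_factors (as @ bs)) v = 0" if "v \<in> D'" for v
    proof -
      have "poly_act K (linear_factors (as @ bs)) v = poly_act K (linear_factors bs) (poly_act K (linear_factors as) v)"
        by (simp only: linear_factors_simps poly_act_mult[OF endo_K] poly_act_commute[OF endo_K, of "linear_factors as" "linear_factors bs"])
      then show ?thesis using as(2) that by (simp only: L(3))
    qed
    ultimately have "\<forall>v\<in>insert d D'. poly_act K (linear_factors (as @ bs)) v = 0" by blast
    then show ?case using as(1) bs(1) by (intro exI[of _ "as @ bs"]) simp
  qed
  from this[OF S(3,4)] obtain as where as: "set as \<subseteq> weights" "\<forall>v\<in>D. poly_act K (linear_factors as) v = 0" by blast
  have sub: "subspace {v. poly_act K (linear_factors as) v = 0}"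
    unfolding subspace_def by (simp add: L(1-3))
  have "D \<subseteq> {v. poly_act K (linear_factors as) v = 0}" using as(2) by blast
  then have "span D \<subseteq> {v. poly_act K (linear_factors as) v = 0}" by (rule span_minimal[OF _ sub])
  then have "S \<subseteq> {v. poly_act K (linear_factors as) v = 0}" by (rule subset_trans[OF S(2)])
  then have "\<forall>v\<in>S. poly_act K (linear_factors as) v = 0" by blast
  with as(1) show ?thesis by blast
qed

end


section \<open>Eigenvalues determined by a trace\<close>

text \<open>Multiplication by a high power of \<open>q\<close> turns the sum into the value at \<open>q\<close> of a polynomial
with integer coefficients, which must be the zero polynomial. Exponents may repeat in the family, so each
coefficient is itself a sum.\<close>

lemma laurent_coefficients:
  fixes q :: "'a::field_char_0" and c e :: "'i \<Rightarrow> int"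
  assumes q: "q \<noteq> 0" "\<not> algebraic q" and "finite I"
    and z: "(\<Sum>i\<in>I. of_int (c i) * q powi e i) = 0"
  shows "(\<Sum>i\<in>I. if e i = m then c i else 0) = 0"
proof -
  define M where "M = \<bar>m\<bar> + (\<Sum>i\<in>I. \<bar>e i\<bar>)"
  have nn: "0 \<le> e i + M" if "i \<in> I" for i
  proof -
    have "\<bar>e i\<bar> \<le> (\<Sum>i\<in>I. \<bar>e i\<bar>)" using \<open>finite I\<close> that by (intro member_le_sum) auto
    then show ?thesis unfolding M_def by linarith
  qed
  have "0 \<le> (\<Sum>i\<in>I. \<bar>e i\<bar>)" by (intro sum_nonneg) simp
  then have nm: "0 \<le> m + M" unfolding M_def by linarith
  define p :: "'a poly" where "p = (\<Sum>i\<in>I. monom (of_int (c i)) (nat (e i + M)))"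
  have "poly p q = (\<Sum>i\<in>I. of_int (c i) * q ^ nat (e i + M))"
    by (simp add: p_def poly_sum poly_monom)
  also have "\<dots> = (\<Sum>i\<in>I. q powi M * (of_int (c i) * q powi e i))"
  proof (rule sum.cong)
    fix i assume "i \<in> I"
    then have "q ^ nat (e i + M) = q powi (e i + M)" using nn by (simp add: power_int_def)
    also have "\<dots> = q powi e i * q powi M" using q(1) by (simp add: power_int_add)
    finally show "of_int (c i) * q ^ nat (e i + M) = q powi M * (of_int (c i) * q powi e i)" by simp
  qed simp
  also have "\<dots> = 0" using z by (simp flip: sum_distrib_left)
  finally have root: "poly p q = 0" .
  have co: "coeff p k = of_int (\<Sum>i\<in>I. if nat (e i + M) = k then c i else 0)" for k
    by (simp add: p_def coeff_sum if_distrib cong: if_cong)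
  have "p = 0"
  proof (rule ccontr)
    assume "p \<noteq> 0"
    then have "algebraic q" using root co by (intro algebraicI[of p]) auto
    then show False using q by simp
  qed
  then have "(\<Sum>i\<in>I. if nat (e i + M) = nat (m + M) then c i else 0) = 0"
    using co[of "nat (m + M)"] by (metis coeff_0 of_int_eq_0_iff)
  moreover have "(nat (e i + M) = nat (m + M)) = (e i = m)" if "i \<in> I" for i
    using nn[OF that] nm by auto
  ultimately show ?thesis by (simp cong: sum.cong)
qed

text \<open>In terms of signs and exponents the trace identity reads: the sum over \<open>b\<close> of
\<open>q powi (2 n + 1) + q powi (2 n - 1)\<close> equals the sum over \<open>b\<close> of \<open>\<epsilon> (q powi (n + 2) + q powi (n - 2))\<close>.
If the largest exponent \<open>N\<close> were at least \<open>2\<close>, then \<open>2 N + 1\<close> would exceed all \<open>n + 2\<close>, and the positive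
coefficient at \<open>q powi (2 N + 1)\<close> would not be balanced; likewise for the smallest exponent. So all
exponents are \<open>-1\<close>, \<open>0\<close> or \<open>1\<close>. Comparing coefficients at \<open>q powi 3\<close> and \<open>q powi (-3)\<close> then
forces the sign \<open>1\<close> when \<open>n\<close> is \<open>1\<close> or \<open>-1\<close>, and those at \<open>q\<close> and \<open>1/q\<close> exclude the exponent \<open>0\<close>.\<close>

lemma weights_from_trace:
  fixes q :: "'a::field_char_0" and \<epsilon> n :: "'i \<Rightarrow> int"
  assumes q: "q \<noteq> 0" "\<not> algebraic q" and fin: "finite B"
    and \<epsilon>: "\<And>b. b \<in> B \<Longrightarrow> \<epsilon> b = 1 \<or> \<epsilon> b = -1"
    and \<alpha>: "\<And>b. b \<in> B \<Longrightarrow> \<alpha> b = of_int (\<epsilon> b) * q powi n b"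
    and tr: "(q + inverse q) * (\<Sum>b\<in>B. \<alpha> b ^ 2) = (q ^ 2 + inverse q ^ 2) * (\<Sum>b\<in>B. \<alpha> b)"
    and b: "b \<in> B"
  shows "\<alpha> b = q \<or> \<alpha> b = inverse q"
proof -
  \<comment> \<open>each \<open>b\<close> contributes four monomials to the difference of the two sides\<close>
  define c where "c i = (if snd i < 2 then 1 else - \<epsilon> (fst i))" for i :: "'i \<times> nat"
  define e where "e i = (if snd i = 0 then 2 * n (fst i) + 1 else if snd i = 1 then 2 * n (fst i) - 1
     else if snd i = 2 then n (fst i) + 2 else n (fst i) - 2)" for i :: "'i \<times> nat"
  define I where "I = B \<times> {0,1,2,3::nat}"
  have prodsum: "(\<Sum>i\<in>I. f i) = (\<Sum>b\<in>B. f (b,0) + f (b,1) + f (b,2) + f (b,3))" for f :: "'i \<times> nat \<Rightarrow> 'z::comm_monoid_add"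
  proof -
    have "(\<Sum>i\<in>I. f i) = (\<Sum>b\<in>B. \<Sum>j\<in>{0,1,2,3::nat}. f (b, j))"
      unfolding I_def sum.cartesian_product by (rule sum.cong) auto
    then show ?thesis by (simp add: add.assoc)
  qed
  have "(\<Sum>i\<in>I. of_int (c i) * q powi e i) = (\<Sum>b\<in>B. (q + inverse q) * \<alpha> b ^ 2 - (q ^ 2 + inverse q ^ 2) * \<alpha> b)"
    unfolding prodsum
  proof (rule sum.cong)
    fix b assume b: "b \<in> B"
    have sq: "\<alpha> b ^ 2 = q powi (2 * n b)"
      using \<epsilon>[OF b] by (auto simp: \<alpha>[OF b] power_int_mult power2_eq_square mult.commute simp flip: power_int_add)
    have "of_int (c (b, 0)) * q powi e (b, 0) = q * \<alpha> b ^ 2"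
      "of_int (c (b, 1)) * q powi e (b, 1) = inverse q * \<alpha> b ^ 2"
      "of_int (c (b, 2)) * q powi e (b, 2) = - (q ^ 2 * \<alpha> b)"
      "of_int (c (b, 3)) * q powi e (b, 3) = - (inverse q ^ 2 * \<alpha> b)"
      using q(1) unfolding sq by (simp_all add: c_def e_def power_int_add power_int_diff \<alpha>[OF b] field_simps)
    then show "of_int (c (b, 0)) * q powi e (b, 0) + of_int (c (b, 1)) * q powi e (b, 1)
        + of_int (c (b, 2)) * q powi e (b, 2) + of_int (c (b, 3)) * q powi e (b, 3)
      = (q + inverse q) * \<alpha> b ^ 2 - (q ^ 2 + inverse q ^ 2) * \<alpha> b"
      by (simp only:) (simp add: algebra_simps)
  qed simp
  also have "\<dots> = 0" using tr by (simp add: sum_subtractf flip: sum_distrib_left)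
  finally have z: "(\<Sum>i\<in>I. of_int (c i) * q powi e i) = 0" .
  have "finite I" using fin by (simp add: I_def)
  \<comment> \<open>the contribution of \<open>b\<close> to the coefficient at \<open>q powi m\<close>\<close>
  define g where "g m b = (if 2 * n b + 1 = m then 1 else 0) + (if 2 * n b - 1 = m then 1 else 0)
     - (if n b + 2 = m then \<epsilon> b else 0) - (if n b - 2 = m then \<epsilon> b else 0)" for m b
  have G: "(\<Sum>b\<in>B. g m b) = 0" for m
  proof -
    have "(\<Sum>b\<in>B. g m b) = (\<Sum>i\<in>I. if e i = m then c i else 0)"
      unfolding prodsum by (rule sum.cong) (auto simp: g_def e_def c_def)
    then show ?thesis using laurent_coefficients[OF q \<open>finite I\<close> z] by simp
  qed
  have pos: "g m b = 0" if "\<And>b. b \<in> B \<Longrightarrow> 0 \<le> g m b" "b \<in> B" for m b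
    using sum_nonneg_0[OF fin _ G that(2)] that(1) by blast
  have upper: "n b \<le> 1" if "b \<in> B" for b
  proof (rule ccontr)
    assume "\<not> n b \<le> 1"
    define N where "N = Max (n ` B)"
    have N: "\<And>b. b \<in> B \<Longrightarrow> n b \<le> N" "N \<in> n ` B" using fin that by (auto simp: N_def intro: Max_in)
    then have "N \<ge> 2" using \<open>\<not> n b \<le> 1\<close> that by force
    have g: "g (2 * N + 1) b = (if n b = N then 1 else 0)" if "b \<in> B" for b
      using N(1)[OF that] \<open>N \<ge> 2\<close> unfolding g_def by auto
    from N(2) obtain b0 where b0: "b0 \<in> B" "n b0 = N" by auto
    have "g (2 * N + 1) b0 = 0" by (rule pos) (use g b0 in auto)
    then show False using g[OF b0(1)] b0(2) by simp
  qed
  have lower: "- 1 \<le> n b" if "b \<in> B" for b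
  proof (rule ccontr)
    assume "\<not> - 1 \<le> n b"
    define N where "N = Min (n ` B)"
    have N: "\<And>b. b \<in> B \<Longrightarrow> N \<le> n b" "N \<in> n ` B" using fin that by (auto simp: N_def intro: Min_in)
    then have "N \<le> -2" using \<open>\<not> - 1 \<le> n b\<close> that by force
    have g: "g (2 * N - 1) b = (if n b = N then 1 else 0)" if "b \<in> B" for b
      using N(1)[OF that] \<open>N \<le> -2\<close> unfolding g_def by auto
    from N(2) obtain b0 where b0: "b0 \<in> B" "n b0 = N" by auto
    have "g (2 * N - 1) b0 = 0" by (rule pos) (use g b0 in auto)
    then show False using g[OF b0(1)] b0(2) by simp
  qed
  have cases: "n b = 0 \<or> n b = 1 \<or> n b = -1" if "b \<in> B" for b using upper[OF that] lower[OF that] by auto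
  have g3: "g 3 b = (if n b = 1 then 1 - \<epsilon> b else 0)" "g (-3) b = (if n b = -1 then 1 - \<epsilon> b else 0)"
    "g 1 b + g (-1) b = (if n b = 0 then 2 else 1 - \<epsilon> b)" if "b \<in> B" for b
    using cases[OF that] unfolding g_def by auto
  have "g 3 b = 0" by (rule pos) (use g3(1) \<epsilon> b in force)+
  moreover have "g (-3) b = 0" by (rule pos) (use g3(2) \<epsilon> b in force)+
  moreover have "g 1 b + g (-1) b = 0"
  proof (rule sum_nonneg_0[OF fin])
    show "(\<Sum>b\<in>B. g 1 b + g (-1) b) = 0" using G by (simp add: sum.distrib)
    show "0 \<le> g 1 b + g (-1) b" if "b \<in> B" for b using g3(3)[OF that] \<epsilon>[OF that] by auto
  qed (rule b)
  ultimately have "\<epsilon> b = 1 \<and> (n b = 1 \<or> n b = -1)" using g3[OF b] cases[OF b] by auto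
  then show ?thesis using \<alpha>[OF b] by (auto simp: power_int_minus)
qed


section \<open>The operators of a finite dimensional module over the oscillator algebra\<close>

locale osc_operators = sl2_operators scale q S D E F K L
  for scale :: "'a::field_char_0 \<Rightarrow> 'b::ab_group_add \<Rightarrow> 'b" (infixr \<open>*s\<close> 75)
    and q S D E F K L +
  fixes X Y :: "'b \<Rightarrow> 'b"
  assumes transcendental: "\<not> algebraic q"
    and endo_X: "endo X" and endo_Y: "endo Y"
    and X_S: "\<And>v. v \<in> S \<Longrightarrow> X v \<in> S" and Y_S: "\<And>v. v \<in> S \<Longrightarrow> Y v \<in> S"
    and KX: "\<And>v. v \<in> S \<Longrightarrow> K (X v) = q *s X (K v)"
    and KY: "\<And>v. v \<in> S \<Longrightarrow> K (Y v) = inverse q *s Y (K v)"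
    and YX: "\<And>v. v \<in> S \<Longrightarrow> q *s Y (X v) - X (Y v) =
      (q - inverse q) ^ 3 *s (F (E v) + (1 / (q - inverse q) ^ 2) *s (q *s K v + inverse q *s L v))
      - ((q - inverse q) * (inverse q ^ 2 + q ^ 2)) *s v"
begin

text \<open>By \<open>K X = q X K\<close> and the symmetry of the trace, \<open>tr (K X Y) = q tr (X K Y) = q tr (K Y X)\<close>, so
\<open>tr (K C0) = 0\<close>. Besides traces of powers of \<open>K\<close> this involves only \<open>tr (K F E)\<close>, which is computed
from the trace of \<open>K (E F - F E)\<close>, since \<open>tr (K E F) = tr (F K E) = q\<^sup>2 tr (K F E)\<close>. The dimension of the
space cancels.\<close>

lemma trace_identity:
  assumes B: "independent B" "finite B" "span B = S"
  shows "(q + inverse q) * btrace B (\<lambda>v. K (K v)) = (q ^ 2 + inverse q ^ 2) * btrace B K"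
proof -
  define \<delta> where "\<delta> = q - inverse q"
  have \<delta>: "\<delta> \<noteq> 0" using q_minus_inv by (simp add: \<delta>_def)
  have BS: "b \<in> S" if "b \<in> B" for b using that B(3) span_base by blast
  have endo_comp: "endo (\<lambda>v. T (U v))" if "endo T" "endo U" for T U
    by (rule endoI) (simp_all add: endo_simps[OF that(1)] endo_simps[OF that(2)])
  have comm: "btrace B (\<lambda>v. T (U v)) = btrace B (\<lambda>v. U (T v))"
    if "endo T" "endo U" "\<And>v. v \<in> S \<Longrightarrow> T v \<in> S" "\<And>v. v \<in> S \<Longrightarrow> U v \<in> S" for T U
    by (rule btrace_commute[OF B(1,2) that(1,2)]) (simp_all only: B(3) that(3,4))
  have scale: "btrace B (\<lambda>v. c *s T v) = c * btrace B T" if "\<And>v. v \<in> S \<Longrightarrow> T v \<in> S" for c T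
    by (rule btrace_scale[OF B(1)]) (simp only: B(3) that BS)
  have add: "btrace B (\<lambda>v. T v + U v) = btrace B T + btrace B U"
    if "\<And>v. v \<in> S \<Longrightarrow> T v \<in> S" "\<And>v. v \<in> S \<Longrightarrow> U v \<in> S" for T U
    by (rule btrace_add[OF B(1)]) (simp_all only: B(3) that BS)
  have diff: "btrace B (\<lambda>v. T v - U v) = btrace B T - btrace B U"
    if "\<And>v. v \<in> S \<Longrightarrow> T v \<in> S" "\<And>v. v \<in> S \<Longrightarrow> U v \<in> S" for T U
    by (rule btrace_diff[OF B(1)]) (simp_all only: B(3) that BS)
  note cl = E_S F_S K_S L_S X_S Y_S subspace_scale[OF S(1)] subspace_add[OF S(1)] subspace_diff[OF S(1)]
  define n where "n = btrace B (\<lambda>v. v)"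
  define t1 where "t1 = btrace B K"
  define t2 where "t2 = btrace B (\<lambda>v. K (K v))"
  define f where "f = btrace B (\<lambda>v. K (F (E v)))"
  have "btrace B (\<lambda>v. K (X (Y v))) = btrace B (\<lambda>v. q *s X (K (Y v)))"
    by (rule btrace_cong) (simp only: KX Y_S BS)
  also have "\<dots> = q * btrace B (\<lambda>v. X (K (Y v)))" by (rule scale) (simp only: cl)
  also have "btrace B (\<lambda>v. X (K (Y v))) = btrace B (\<lambda>v. K (Y (X v)))"
    by (rule comm[OF endo_X endo_comp[OF endo_K endo_Y]]) (simp_all only: cl)
  finally have "btrace B (\<lambda>v. q *s K (Y (X v)) - K (X (Y v))) = 0"
    using diff[of "\<lambda>v. q *s K (Y (X v))" "\<lambda>v. K (X (Y v))"] scale[of "\<lambda>v. K (Y (X v))" q]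
    by (simp add: cl)
  moreover have "btrace B (\<lambda>v. q *s K (Y (X v)) - K (X (Y v))) =
    btrace B (\<lambda>v. \<delta> ^ 3 *s K (F (E v)) + ((\<delta> * q) *s K (K v) + (\<delta> * inverse q) *s v)
       - (\<delta> * (inverse q ^ 2 + q ^ 2)) *s K v)"
  proof (rule btrace_cong)
    fix b assume "b \<in> B"
    then have b: "b \<in> S" by (rule BS)
    have "q *s K (Y (X b)) - K (X (Y b)) = K (q *s Y (X b) - X (Y b))" by (simp add: lin)
    also have "\<dots> = \<delta> ^ 3 *s K (F (E b)) + (\<delta> ^ 3 * (1 / \<delta> ^ 2)) *s (q *s K (K b) + inverse q *s b)
       - (\<delta> * (inverse q ^ 2 + q ^ 2)) *s K b"
      unfolding YX[OF b] \<delta>_def[symmetric] by (simp add: lin KL[OF b] scale_right_distrib)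
    also have "\<delta> ^ 3 * (1 / \<delta> ^ 2) = \<delta>" using \<delta> by (simp add: power3_eq_cube power2_eq_square)
    finally show "q *s K (Y (X b)) - K (X (Y b)) =
      \<delta> ^ 3 *s K (F (E b)) + ((\<delta> * q) *s K (K b) + (\<delta> * inverse q) *s b)
       - (\<delta> * (inverse q ^ 2 + q ^ 2)) *s K b"
      by (simp add: scale_right_distrib)
  qed
  moreover have "\<dots> = \<delta> ^ 3 * f + (\<delta> * q * t2 + \<delta> * inverse q * n) - \<delta> * (inverse q ^ 2 + q ^ 2) * t1"
    unfolding f_def t2_def n_def t1_def
    by (subst diff, (simp only: cl)+, subst add, (simp only: cl)+, subst add, (simp only: cl)+)
       (simp only: scale cl)
  ultimately have C0: "\<delta> ^ 3 * f + (\<delta> * q * t2 + \<delta> * inverse q * n) - \<delta> * (inverse q ^ 2 + q ^ 2) * t1 = 0"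
    by simp
  have "btrace B (\<lambda>v. K (E (F v))) = btrace B (\<lambda>v. F (K (E v)))"
    by (rule comm[OF endo_comp[OF endo_K endo_E] endo_F]) (simp_all only: cl)
  also have "\<dots> = btrace B (\<lambda>v. q ^ 2 *s K (F (E v)))"
    by (rule btrace_cong) (use q0 in \<open>simp add: KF cl BS flip: power_mult_distrib\<close>)
  also have "\<dots> = q ^ 2 * f" unfolding f_def by (rule scale) (simp only: cl)
  finally have "btrace B (\<lambda>v. K (E (F v)) - K (F (E v))) = q ^ 2 * f - f"
    unfolding f_def by (subst diff) (simp_all only: cl)
  moreover have "btrace B (\<lambda>v. K (E (F v)) - K (F (E v))) = btrace B (\<lambda>v. (1 / \<delta>) *s (K (K v) - v))"
  proof (rule btrace_cong)
    fix b assume "b \<in> B"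
    then have b: "b \<in> S" by (rule BS)
    have "K (E (F b)) - K (F (E b)) = K (E (F b) - F (E b))" by (simp add: lin)
    then show "K (E (F b)) - K (F (E b)) = (1 / \<delta>) *s (K (K b) - b)"
      by (simp add: EF[OF b] lin KL[OF b] \<delta>_def)
  qed
  moreover have "\<dots> = (1 / \<delta>) * (t2 - n)"
    unfolding t2_def n_def by (subst scale, (simp only: cl)+, subst diff) (simp_all only: cl)
  ultimately have EFt: "q ^ 2 * f - f = (1 / \<delta>) * (t2 - n)" by simp
  have "q ^ 2 - 1 = q * \<delta>" using q0 by (simp add: \<delta>_def power2_eq_square algebra_simps)
  then have "q * \<delta> * f = (1 / \<delta>) * (t2 - n)" using EFt by (metis left_diff_distrib mult_1)
  then have f: "\<delta> ^ 2 * f = inverse q * (t2 - n)"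
    using \<delta> q0 by (simp add: field_simps power2_eq_square)
  have "\<delta> ^ 3 * f = \<delta> * (\<delta> ^ 2 * f)" by (simp add: power3_eq_cube power2_eq_square)
  then have "\<delta> * (inverse q * (t2 - n) + (q * t2 + inverse q * n) - (inverse q ^ 2 + q ^ 2) * t1) = 0"
    using C0 unfolding f by (simp add: algebra_simps)
  then have "inverse q * (t2 - n) + (q * t2 + inverse q * n) - (inverse q ^ 2 + q ^ 2) * t1 = 0"
    using \<delta> by simp
  then show ?thesis unfolding t1_def[symmetric] t2_def[symmetric] by (simp add: algebra_simps)
qed

lemma q_powi: "n \<noteq> m \<Longrightarrow> q powi n \<noteq> q powi m"
proof (induction n m rule: linorder_wlog)
  case (le n m)
  show ?case
  proof
    assume "q powi n = q powi m"
    then have "q powi (m - n) = 1" using q0 by (simp add: power_int_diff)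
    then have "q ^ nat (m - n) = 1" using le by (simp add: power_int_def)
    then show False using q_pow[of "nat (m - n)"] le by simp
  qed
qed auto

lemma K_eigenvalues: "\<exists>cs. set cs \<subseteq> {q, inverse q} \<and> (\<forall>v\<in>S. poly_act K (linear_factors cs) v = 0)"
proof -
  obtain as where as: "set as \<subseteq> weights" "\<forall>v\<in>S. poly_act K (linear_factors as) v = 0" using K_weights by blast
  obtain B \<alpha> cs where tri: "triangular_on K {v \<in> S. poly_act K (linear_factors as) v = 0} B \<alpha> cs" and im: "\<alpha> ` B \<subseteq> set as"
    using triangular_basis[OF endo_K S(1-3) K_S] by blast
  have "{v \<in> S. poly_act K (linear_factors as) v = 0} = S" using as(2) by blast
  with tri have B: "finite B" "independent B" "span B = S"
    and cs: "set cs \<subseteq> \<alpha> ` B" "\<forall>v\<in>S. poly_act K (linear_factors cs) v = 0"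
    and diag: "\<forall>b\<in>B. representation B (K b) b = \<alpha> b \<and> representation B (K (K b)) b = \<alpha> b ^ 2"
    unfolding triangular_on_def by metis+
  have t1: "btrace B K = (\<Sum>b\<in>B. \<alpha> b)"
    unfolding btrace_def by (rule sum.cong) (simp_all add: diag)
  have t2: "btrace B (\<lambda>v. K (K v)) = (\<Sum>b\<in>B. \<alpha> b ^ 2)"
    unfolding btrace_def by (rule sum.cong) (simp_all add: diag)
  have "\<forall>b\<in>B. \<exists>\<epsilon> n. (\<epsilon> = 1 \<or> \<epsilon> = -1) \<and> \<alpha> b = of_int \<epsilon> * q powi n"
  proof
    fix b assume "b \<in> B"
    then have "\<alpha> b \<in> weights" using im as(1) by blast
    then obtain n where n: "\<alpha> b = q powi n \<or> \<alpha> b = - (q powi n)" unfolding weights_def by blast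
    then have "\<alpha> b = of_int 1 * q powi n \<or> \<alpha> b = of_int (-1) * q powi n" by simp
    then show "\<exists>\<epsilon> n. (\<epsilon> = 1 \<or> \<epsilon> = -1) \<and> \<alpha> b = of_int \<epsilon> * q powi n" by blast
  qed
  then obtain \<epsilon> n where \<epsilon>: "\<And>b. b \<in> B \<Longrightarrow> \<epsilon> b = 1 \<or> \<epsilon> b = -1" "\<And>b. b \<in> B \<Longrightarrow> \<alpha> b = of_int (\<epsilon> b) * q powi n b"
    by metis
  have tr: "(q + inverse q) * (\<Sum>b\<in>B. \<alpha> b ^ 2) = (q ^ 2 + inverse q ^ 2) * (\<Sum>b\<in>B. \<alpha> b)"
    using trace_identity[OF B(2,1,3)] unfolding t1 t2 .
  have "\<alpha> b = q \<or> \<alpha> b = inverse q" if "b \<in> B" for b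
    by (rule weights_from_trace[OF q0 transcendental B(1) \<epsilon> tr that])
  then have "set cs \<subseteq> {q, inverse q}" using cs(1) by blast
  with cs(2) show ?thesis by blast
qed

text \<open>The image of \<open>T\<close> has its eigenvalues in \<open>{q * q powi m, q powi m / q}\<close>, which is disjoint from
\<open>{q, 1/q}\<close>.\<close>

lemma shift_vanishes:
  assumes T: "endo T" "\<And>v. v \<in> S \<Longrightarrow> T v \<in> S" "\<And>v. v \<in> S \<Longrightarrow> K (T v) = q powi m *s T (K v)"
    and m: "m \<noteq> 0" "m \<noteq> 2" "m \<noteq> -2" and v: "v \<in> S"
  shows "T v = 0"
proof -
  obtain cs where cs: "set cs \<subseteq> {q, inverse q}" "\<forall>v\<in>S. poly_act K (linear_factors cs) v = 0" using K_eigenvalues by blast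
  have "poly_act K (linear_factors (map ((*) (q powi m)) cs)) (T v) = 0"
    by (simp only: poly_act_linear_factors_shift[OF endo_K T(1) S(1) K_S T(3) v] bspec[OF cs(2) v] endo_simps(3)[OF T(1)] scale_zero_right)
  moreover have "poly_act K (linear_factors cs) (T v) = 0" using cs(2) T(2)[OF v] by blast
  moreover have "set (map ((*) (q powi m)) cs) \<inter> set cs = {}"
  proof -
    have eqs: "q powi 1 = q" "q powi (-1) = inverse q"
      "q powi (m + 1) = q powi m * q" "q powi (m - 1) = q powi m * inverse q"
      using q0 by (simp_all add: power_int_minus power_int_add power_int_diff divide_inverse)
    have "q powi (m + 1) \<noteq> q powi 1" "q powi (m + 1) \<noteq> q powi (-1)"
      "q powi (m - 1) \<noteq> q powi 1" "q powi (m - 1) \<noteq> q powi (-1)"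
      by (rule q_powi, use m in linarith)+
    then have "{q powi m * q, q powi m * inverse q} \<inter> {q, inverse q} = {}"
      unfolding eqs by blast
    moreover have "set (map ((*) (q powi m)) cs) \<subseteq> {q powi m * q, q powi m * inverse q}"
      using cs(1) by auto
    ultimately show ?thesis using cs(1) by blast
  qed
  ultimately show ?thesis using poly_act_linear_factors_disjoint[OF endo_K] by blast
qed

lemma X_0: "v \<in> S \<Longrightarrow> X v = 0"
  by (rule shift_vanishes[OF endo_X X_S, of 1]) (simp_all only: KX, simp_all)

lemma Y_0: "v \<in> S \<Longrightarrow> Y v = 0"
  by (rule shift_vanishes[OF endo_Y Y_S, of "-1"]) (simp_all only: KY, simp_all add: power_int_minus)

lemma E_E: "v \<in> S \<Longrightarrow> E (E v) = 0"
  by (rule shift_vanishes[of "\<lambda>v. E (E v)" 4])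
     (auto intro!: endoI simp: lin E_S KE power_int_def simp flip: power_add)

lemma F_F: "v \<in> S \<Longrightarrow> F (F v) = 0"
proof (rule shift_vanishes[of "\<lambda>v. F (F v)" "-4"])
  fix v assume v: "v \<in> S"
  have "(inverse q) ^ 2 * (inverse q) ^ 2 = (inverse q) ^ (2 + 2)" by (simp only: power_add)
  then have "(inverse q) ^ 2 * (inverse q) ^ 2 = q powi (-4)"
    unfolding power_int_def by simp
  then show "K (F (F v)) = q powi (-4) *s F (F (K v))"
    by (simp only: KF[OF F_S[OF v]] KF[OF v] lin scale_scale)
qed (auto intro!: endoI simp: lin F_S)

text \<open>As \<open>F\<^sup>2 = 0\<close>, the eigenvalues of \<open>K\<close> on the kernel of \<open>E\<close> are among \<open>1\<close>, \<open>-1\<close>, \<open>q\<close>, \<open>-q\<close>; of these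
only \<open>q\<close> lies in \<open>{q, 1/q}\<close>, and its factor occurs once.\<close>

lemma K_ker_E:
  assumes v: "v \<in> S" "E v = 0"
  shows "K v = q *s v"
proof -
  obtain cs where cs: "set cs \<subseteq> {q, inverse q}" "\<forall>v\<in>S. poly_act K (linear_factors cs) v = 0" using K_eigenvalues by blast
  define u where "u = poly_act K (linear_factors [q]) v"
  have u: "u \<in> S" unfolding u_def by (rule poly_act_closed[OF endo_K S(1) K_S v(1)])
  have "(F ^^ 2) v = 0" using F_F[OF v(1)] by (simp add: numeral_2_eq_2)
  then have hw: "poly_act K (linear_factors (candidate_weights 2)) v = 0" by (rule highest_weights[OF v])
  have "linear_factors (candidate_weights 2) = linear_factors [1, -1, - q] * linear_factors [q]"
    by (simp add: numeral_2_eq_2 algebra_simps)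
  then have "poly_act K (linear_factors [1, -1, - q]) u = 0" using hw by (simp only: poly_act_mult[OF endo_K] u_def)
  moreover have "poly_act K (linear_factors cs) u = 0" using cs(2) u by blast
  moreover have "set [1, -1, - q] \<inter> set cs = {}"
  proof -
    have "q \<noteq> 1" "q ^ 2 \<noteq> 1" "q ^ 4 \<noteq> 1" using q_pow[of 1] q_pow[of 2] q_pow[of 4] by simp_all
    then have "q \<noteq> -1" by auto
    moreover have "inverse q \<noteq> 1" using \<open>q \<noteq> 1\<close> by simp
    moreover have "inverse q \<noteq> -1" using \<open>q \<noteq> -1\<close> by (metis inverse_inverse_eq inverse_minus_eq inverse_1)
    moreover have "q \<noteq> - q" using q0 by (simp add: eq_neg_iff_add_eq_0)
    moreover have "inverse q \<noteq> - q"
    proof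
      assume "inverse q = - q"
      then have "q * inverse q = q * (- q)" by (rule arg_cong)
      then have "q ^ 2 = -1" using q0 by (simp add: power2_eq_square equation_minus_iff[of 1])
      moreover have "q ^ 4 = q ^ 2 * q ^ 2" by (simp flip: power_add)
      ultimately have "q ^ 4 = (-1) * (-1)" by (simp only:)
      then show False using \<open>q ^ 4 \<noteq> 1\<close> by simp
    qed
    ultimately show ?thesis using cs(1) \<open>q \<noteq> 1\<close> by auto
  qed
  ultimately have "u = 0" using poly_act_linear_factors_disjoint[OF endo_K] by blast
  then show ?thesis by (simp add: u_def poly_act_lin[OF endo_K])
qed

lemma L_ker_E: "v \<in> S \<Longrightarrow> E v = 0 \<Longrightarrow> L v = inverse q *s v"
  using LK[of v] K_ker_E[of v] q0 by (simp add: lin) (metis inverse_nonzero_iff_nonzero scale_scale left_inverse scale_one)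

lemma E_F_ker_E: "v \<in> S \<Longrightarrow> E v = 0 \<Longrightarrow> E (F v) = v"
  using EF[of v] K_ker_E[of v] L_ker_E[of v] q_minus_inv by (simp add: lin flip: scale_left_diff_distrib)

lemma K_F_ker_E: "v \<in> S \<Longrightarrow> E v = 0 \<Longrightarrow> K (F v) = inverse q *s F v"
  using KF[of v] K_ker_E[of v] q0 by (simp add: lin power2_eq_square)

end


section \<open>Left modules, quotients and simple quotients\<close>

lemma module_homI:
  assumes "\<And>x. x \<in> carrier M \<Longrightarrow> f x \<in> carrier P"
    "\<And>x y. x \<in> carrier M \<Longrightarrow> y \<in> carrier M \<Longrightarrow> f (x \<oplus>\<^bsub>M\<^esub> y) = f x \<oplus>\<^bsub>P\<^esub> f y"
    "\<And>a x. a \<in> carrier R \<Longrightarrow> x \<in> carrier M \<Longrightarrow> f (a \<odot>\<^bsub>M\<^esub> x) = a \<odot>\<^bsub>P\<^esub> f x"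
  shows "f \<in> LinearCombinations.module_hom R M P"
  using assms unfolding LinearCombinations.module_hom_def by auto

context left_module
begin

lemma smult_0_right [simp]:
  assumes "a \<in> carrier R" shows "a \<odot>\<^bsub>M\<^esub> \<zero>\<^bsub>M\<^esub> = \<zero>\<^bsub>M\<^esub>"
proof -
  have z: "a \<odot>\<^bsub>M\<^esub> \<zero>\<^bsub>M\<^esub> \<in> carrier M" using assms by (simp add: smult_closed)
  have "a \<odot>\<^bsub>M\<^esub> \<zero>\<^bsub>M\<^esub> \<oplus>\<^bsub>M\<^esub> a \<odot>\<^bsub>M\<^esub> \<zero>\<^bsub>M\<^esub> = a \<odot>\<^bsub>M\<^esub> \<zero>\<^bsub>M\<^esub> \<oplus>\<^bsub>M\<^esub> \<zero>\<^bsub>M\<^esub>"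
    using assms smult_r_distr[of a "\<zero>\<^bsub>M\<^esub>" "\<zero>\<^bsub>M\<^esub>"] z by simp
  then show ?thesis using z by (metis M.a_comm M.add.right_cancel M.zero_closed)
qed

lemma smult_0_left [simp]:
  assumes "x \<in> carrier M" shows "\<zero>\<^bsub>R\<^esub> \<odot>\<^bsub>M\<^esub> x = \<zero>\<^bsub>M\<^esub>"
proof -
  have z: "\<zero>\<^bsub>R\<^esub> \<odot>\<^bsub>M\<^esub> x \<in> carrier M" using assms by (simp add: smult_closed)
  have "\<zero>\<^bsub>R\<^esub> \<odot>\<^bsub>M\<^esub> x \<oplus>\<^bsub>M\<^esub> \<zero>\<^bsub>R\<^esub> \<odot>\<^bsub>M\<^esub> x = \<zero>\<^bsub>R\<^esub> \<odot>\<^bsub>M\<^esub> x \<oplus>\<^bsub>M\<^esub> \<zero>\<^bsub>M\<^esub>"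
    using assms smult_l_distr[of "\<zero>\<^bsub>R\<^esub>" "\<zero>\<^bsub>R\<^esub>" x] z by simp
  then show ?thesis using z by (metis M.a_comm M.add.right_cancel M.zero_closed)
qed

lemma smult_minus_one:
  assumes "x \<in> carrier M" shows "(\<ominus>\<^bsub>R\<^esub> \<one>\<^bsub>R\<^esub>) \<odot>\<^bsub>M\<^esub> x = \<ominus>\<^bsub>M\<^esub> x"
proof -
  have "(\<ominus>\<^bsub>R\<^esub> \<one>\<^bsub>R\<^esub>) \<odot>\<^bsub>M\<^esub> x \<oplus>\<^bsub>M\<^esub> x = (\<ominus>\<^bsub>R\<^esub> \<one>\<^bsub>R\<^esub> \<oplus>\<^bsub>R\<^esub> \<one>\<^bsub>R\<^esub>) \<odot>\<^bsub>M\<^esub> x"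
    using assms by (simp add: smult_l_distr smult_one)
  also have "\<dots> = \<zero>\<^bsub>M\<^esub>" using assms by (simp add: R.l_neg)
  finally show ?thesis using assms by (metis M.minus_equality R.a_inv_closed R.one_closed smult_closed)
qed

lemma submoduleI:
  assumes "N \<subseteq> carrier M" "\<zero>\<^bsub>M\<^esub> \<in> N" "\<And>x y. x \<in> N \<Longrightarrow> y \<in> N \<Longrightarrow> x \<oplus>\<^bsub>M\<^esub> y \<in> N"
    and sm: "\<And>a x. a \<in> carrier R \<Longrightarrow> x \<in> N \<Longrightarrow> a \<odot>\<^bsub>M\<^esub> x \<in> N"
  shows "Module.submodule N R M"
proof -
  have "\<ominus>\<^bsub>M\<^esub> x \<in> N" if "x \<in> N" for x
    using sm[OF _ that, of "\<ominus>\<^bsub>R\<^esub> \<one>\<^bsub>R\<^esub>"] smult_minus_one[of x] that assms(1) by auto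
  then show ?thesis
    using assms unfolding Module.submodule_def submodule_axioms_def subgroup_def a_inv_def by auto
qed

lemma submoduleD:
  assumes "Module.submodule N R M"
  shows "N \<subseteq> carrier M" "\<zero>\<^bsub>M\<^esub> \<in> N" "\<And>x y. x \<in> N \<Longrightarrow> y \<in> N \<Longrightarrow> x \<oplus>\<^bsub>M\<^esub> y \<in> N"
    "\<And>a x. a \<in> carrier R \<Longrightarrow> x \<in> N \<Longrightarrow> a \<odot>\<^bsub>M\<^esub> x \<in> N"
proof -
  interpret N: Module.submodule N R M by fact
  show "N \<subseteq> carrier M" "\<zero>\<^bsub>M\<^esub> \<in> N" "\<And>x y. x \<in> N \<Longrightarrow> y \<in> N \<Longrightarrow> x \<oplus>\<^bsub>M\<^esub> y \<in> N"
    using N.subset N.one_closed N.m_closed by auto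
  show "\<And>a x. a \<in> carrier R \<Longrightarrow> x \<in> N \<Longrightarrow> a \<odot>\<^bsub>M\<^esub> x \<in> N" using N.smult_closed by blast
qed

lemma submodule_abelian_subgroup:
  assumes "Module.submodule N R M" shows "abelian_subgroup N M"
  by (rule abelian_subgroupI3)
     (use assms M.abelian_group_axioms in \<open>auto simp: additive_subgroup_def Module.submodule_def\<close>)

lemma carrier_submodule: "Module.submodule (carrier M) R M"
  by (rule submoduleI) (auto simp: smult_closed)

lemma hom_zero:
  assumes "f \<in> LinearCombinations.module_hom R M P" "left_module R P"
  shows "f \<zero>\<^bsub>M\<^esub> = \<zero>\<^bsub>P\<^esub>"
proof -
  interpret P: left_module R P by fact
  have c: "f \<zero>\<^bsub>M\<^esub> \<in> carrier P" using LinearCombinations.module_hom_closed[OF assms(1)] by auto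
  have "f \<zero>\<^bsub>M\<^esub> \<oplus>\<^bsub>P\<^esub> f \<zero>\<^bsub>M\<^esub> = f \<zero>\<^bsub>M\<^esub> \<oplus>\<^bsub>P\<^esub> \<zero>\<^bsub>P\<^esub>"
    using LinearCombinations.module_hom_add[OF assms(1), of "\<zero>\<^bsub>M\<^esub>" "\<zero>\<^bsub>M\<^esub>"] c by simp
  then show ?thesis using c by (metis P.a_comm P.add.right_cancel P.zero_closed)
qed

lemma hom_minus:
  assumes f: "f \<in> LinearCombinations.module_hom R M P" "left_module R P" and "x \<in> carrier M" "y \<in> carrier M"
  shows "f (x \<ominus>\<^bsub>M\<^esub> y) = f x \<ominus>\<^bsub>P\<^esub> f y"
proof -
  interpret P: left_module R P by fact
  have c: "f x \<in> carrier P" "f y \<in> carrier P" using LinearCombinations.module_hom_closed[OF f(1)] assms(3,4) by auto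
  have "f (\<ominus>\<^bsub>M\<^esub> y) = \<ominus>\<^bsub>P\<^esub> f y"
    using LinearCombinations.module_hom_smult[OF f(1), of "\<ominus>\<^bsub>R\<^esub> \<one>\<^bsub>R\<^esub>" y] assms(4) c
    by (simp add: smult_minus_one P.smult_minus_one)
  then show ?thesis using assms(3,4) LinearCombinations.module_hom_add[OF f(1)] by (simp add: a_minus_def)
qed

lemma kernel_submodule:
  assumes f: "f \<in> LinearCombinations.module_hom R M P" and P: "left_module R P"
  shows "Module.submodule {x \<in> carrier M. f x = \<zero>\<^bsub>P\<^esub>} R M"
proof -
  interpret P: left_module R P by fact
  show ?thesis
    by (rule submoduleI)
       (auto simp: hom_zero[OF f P] LinearCombinations.module_hom_add[OF f] LinearCombinations.module_hom_smult[OF f] smult_closed)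
qed

lemma image_submodule:
  assumes f: "f \<in> LinearCombinations.module_hom R M P" and P: "left_module R P" and N: "Module.submodule N R M"
  shows "Module.submodule (f ` N) R P"
proof -
  interpret P: left_module R P by fact
  note N' = submoduleD[OF N]
  show ?thesis
  proof (rule P.submoduleI)
    show "f ` N \<subseteq> carrier P" using LinearCombinations.module_hom_closed[OF f] N'(1) by auto
    show "\<zero>\<^bsub>P\<^esub> \<in> f ` N" using hom_zero[OF f P] N'(2) by force
    show "x \<oplus>\<^bsub>P\<^esub> y \<in> f ` N" if "x \<in> f ` N" "y \<in> f ` N" for x y
      using that N'(1,3) by (auto simp: LinearCombinations.module_hom_add[OF f, symmetric] subset_iff)
    show "a \<odot>\<^bsub>P\<^esub> x \<in> f ` N" if "a \<in> carrier R" "x \<in> f ` N" for a x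
      using that N'(1,4) by (auto simp: LinearCombinations.module_hom_smult[OF f, symmetric] subset_iff)
  qed
qed

end

lemma hom_comp:
  assumes "f \<in> LinearCombinations.module_hom R M P" "g \<in> LinearCombinations.module_hom R P Q"
  shows "g \<circ> f \<in> LinearCombinations.module_hom R M Q"
  using assms unfolding LinearCombinations.module_hom_def Pi_def by auto

lemma isomorphic_trans:
  assumes "isomorphic_modules R M P" "isomorphic_modules R P Q"
  shows "isomorphic_modules R M Q"
  using assms unfolding isomorphic_modules_def by (meson bij_betw_trans hom_comp)

lemma isomorphic_sym:
  assumes "isomorphic_modules R M P" and M: "left_module R M"
  shows "isomorphic_modules R P M"
proof -
  interpret left_module R M by fact
  obtain f where f: "f \<in> LinearCombinations.module_hom R M P" and bij: "bij_betw f (carrier M) (carrier P)"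
    using assms(1) unfolding isomorphic_modules_def by blast
  define g where "g = inv_into (carrier M) f"
  have g: "g y \<in> carrier M" "f (g y) = y" if "y \<in> carrier P" for y
    using that bij by (auto simp: g_def bij_betw_def inv_into_into f_inv_into_f)
  have gf: "g (f x) = x" if "x \<in> carrier M" for x
    using that bij by (simp add: g_def bij_betw_def)
  have "g \<in> LinearCombinations.module_hom R P M"
  proof (rule module_homI)
    fix x y assume xy: "x \<in> carrier P" "y \<in> carrier P"
    have "f (g x \<oplus>\<^bsub>M\<^esub> g y) = x \<oplus>\<^bsub>P\<^esub> y" using LinearCombinations.module_hom_add[OF f] g xy by simp
    then show "g (x \<oplus>\<^bsub>P\<^esub> y) = g x \<oplus>\<^bsub>M\<^esub> g y" using gf[of "g x \<oplus>\<^bsub>M\<^esub> g y"] g xy by simp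
  next
    fix a x assume ax: "a \<in> carrier R" "x \<in> carrier P"
    have "f (a \<odot>\<^bsub>M\<^esub> g x) = a \<odot>\<^bsub>P\<^esub> x" using LinearCombinations.module_hom_smult[OF f] g ax by simp
    then show "g (a \<odot>\<^bsub>P\<^esub> x) = a \<odot>\<^bsub>M\<^esub> g x" using gf[of "a \<odot>\<^bsub>M\<^esub> g x"] g ax by (simp add: smult_closed)
  qed (rule g)
  moreover have "bij_betw g (carrier P) (carrier M)"
    unfolding g_def using bij by (rule bij_betw_inv_into)
  ultimately show ?thesis unfolding isomorphic_modules_def by blast
qed

lemma injective_hom:
  assumes "left_module R M" "left_module R P" and f: "f \<in> LinearCombinations.module_hom R M P"
    and ker: "\<And>x. x \<in> carrier M \<Longrightarrow> f x = \<zero>\<^bsub>P\<^esub> \<Longrightarrow> x = \<zero>\<^bsub>M\<^esub>"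
  shows "inj_on f (carrier M)"
proof (rule inj_onI)
  interpret M: left_module R M by fact
  interpret P: left_module R P by fact
  fix x y assume xy: "x \<in> carrier M" "y \<in> carrier M" "f x = f y"
  have "f y \<in> carrier P" using LinearCombinations.module_hom_closed[OF f] xy by auto
  then have "f (x \<ominus>\<^bsub>M\<^esub> y) = \<zero>\<^bsub>P\<^esub>"
    using xy M.hom_minus[OF f assms(2)] by (simp add: P.r_neg a_minus_def)
  then have "x \<ominus>\<^bsub>M\<^esub> y = \<zero>\<^bsub>M\<^esub>" using ker xy by simp
  then show "x = y" using xy by simp
qed

lemma quotient_module_simps [simp]:
  "carrier (quotient_module M N) = a_rcosets\<^bsub>M\<^esub> N"
  "add (quotient_module M N) = set_add M" "zero (quotient_module M N) = N"
  "smult (quotient_module M N) a B = (\<Union>x\<in>B. N +>\<^bsub>M\<^esub> (a \<odot>\<^bsub>M\<^esub> x))"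
  by (simp_all add: quotient_module_def)

locale left_quotient = left_module R M for R (structure) and M (structure) and N +
  assumes sub: "Module.submodule N R M"
begin

sublocale N: abelian_subgroup N M
  using sub by (rule submodule_abelian_subgroup)

lemma quot_carrier: "a_rcosets\<^bsub>M\<^esub> N = (\<lambda>x. N +>\<^bsub>M\<^esub> x) ` carrier M"
  by (auto simp: A_RCOSETS_def' )

lemma coset_eq_iff:
  assumes "x \<in> carrier M" "y \<in> carrier M"
  shows "N +>\<^bsub>M\<^esub> x = N +>\<^bsub>M\<^esub> y \<longleftrightarrow> x \<ominus>\<^bsub>M\<^esub> y \<in> N"
proof
  assume "N +>\<^bsub>M\<^esub> x = N +>\<^bsub>M\<^esub> y"
  then have "x \<in> N +>\<^bsub>M\<^esub> y" using assms N.a_rcos_self by blast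
  then show "x \<ominus>\<^bsub>M\<^esub> y \<in> N" using N.a_rcos_module[OF assms(2,1)] by (simp add: a_minus_def)
next
  assume "x \<ominus>\<^bsub>M\<^esub> y \<in> N"
  then have "x \<in> N +>\<^bsub>M\<^esub> y" using N.a_rcos_module[OF assms(2,1)] by (simp add: a_minus_def)
  then show "N +>\<^bsub>M\<^esub> x = N +>\<^bsub>M\<^esub> y" using assms N.a_repr_independence' by metis
qed

text \<open>The union that defines the scalar multiplication runs over equal cosets.\<close>

lemma coset_smult:
  assumes a: "a \<in> carrier R" and x: "x \<in> carrier M"
  shows "a \<odot>\<^bsub>quotient_module M N\<^esub> (N +>\<^bsub>M\<^esub> x) = N +>\<^bsub>M\<^esub> (a \<odot>\<^bsub>M\<^esub> x)"
proof -
  have "N +>\<^bsub>M\<^esub> (a \<odot>\<^bsub>M\<^esub> y) = N +>\<^bsub>M\<^esub> (a \<odot>\<^bsub>M\<^esub> x)" if "y \<in> N +>\<^bsub>M\<^esub> x" for y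
  proof -
    have y: "y \<in> carrier M" using N.a_elemrcos_carrier[OF x that] .
    have "y \<ominus>\<^bsub>M\<^esub> x \<in> N" using that N.a_rcos_module[OF x y] by (simp add: a_minus_def)
    then have "a \<odot>\<^bsub>M\<^esub> (y \<ominus>\<^bsub>M\<^esub> x) \<in> N" using submoduleD(4)[OF sub a] by blast
    moreover have "a \<odot>\<^bsub>M\<^esub> (y \<ominus>\<^bsub>M\<^esub> x) = a \<odot>\<^bsub>M\<^esub> y \<ominus>\<^bsub>M\<^esub> a \<odot>\<^bsub>M\<^esub> x"
    proof -
      have "a \<odot>\<^bsub>M\<^esub> (y \<ominus>\<^bsub>M\<^esub> x) \<oplus>\<^bsub>M\<^esub> a \<odot>\<^bsub>M\<^esub> x = a \<odot>\<^bsub>M\<^esub> y"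
        using a x y by (simp add: smult_r_distr[symmetric] a_minus_def M.a_assoc M.l_neg)
      then show ?thesis using a x y smult_closed
        by (metis M.add.inv_solve_right M.minus_closed a_minus_def)
    qed
    ultimately show ?thesis using coset_eq_iff a x y smult_closed by simp
  qed
  then have eq: "\<forall>y\<in>N +>\<^bsub>M\<^esub> x. N +>\<^bsub>M\<^esub> (a \<odot>\<^bsub>M\<^esub> y) = N +>\<^bsub>M\<^esub> (a \<odot>\<^bsub>M\<^esub> x)" by blast
  have "x \<in> N +>\<^bsub>M\<^esub> x" using x by (rule N.a_rcos_self)
  then show ?thesis using eq unfolding quotient_module_simps by (rule UN_constant_eq)
qed

lemma coset_add:
  assumes "x \<in> carrier M" "y \<in> carrier M"
  shows "(N +>\<^bsub>M\<^esub> x) \<oplus>\<^bsub>quotient_module M N\<^esub> (N +>\<^bsub>M\<^esub> y) = N +>\<^bsub>M\<^esub> (x \<oplus>\<^bsub>M\<^esub> y)"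
  using N.a_rcos_sum[OF assms] by simp

lemma zero_coset: "N +>\<^bsub>M\<^esub> \<zero>\<^bsub>M\<^esub> = N"
  by (metis M.a_coset_add_zero N.a_subset)

lemma left_module_quotient: "left_module R (quotient_module M N)"
proof -
  have N_coset: "N = N +>\<^bsub>M\<^esub> \<zero>\<^bsub>M\<^esub>" by (rule zero_coset[symmetric])
  have ag: "abelian_group (quotient_module M N)"
  proof (rule abelian_groupI)
    fix B C assume "B \<in> carrier (quotient_module M N)" "C \<in> carrier (quotient_module M N)"
    then obtain x y where xy: "x \<in> carrier M" "B = N +>\<^bsub>M\<^esub> x" "y \<in> carrier M" "C = N +>\<^bsub>M\<^esub> y"
      by (auto simp: quot_carrier)
    show "B \<oplus>\<^bsub>quotient_module M N\<^esub> C \<in> carrier (quotient_module M N)"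
      unfolding xy(2,4) coset_add[OF xy(1,3)] using xy(1,3) by (auto simp: quot_carrier)
    show "B \<oplus>\<^bsub>quotient_module M N\<^esub> C = C \<oplus>\<^bsub>quotient_module M N\<^esub> B"
      unfolding xy(2,4) coset_add[OF xy(1,3)] coset_add[OF xy(3,1)] using xy(1,3) by (simp add: M.a_comm)
    fix D assume "D \<in> carrier (quotient_module M N)"
    then obtain z where z: "z \<in> carrier M" "D = N +>\<^bsub>M\<^esub> z" by (auto simp: quot_carrier)
    show "B \<oplus>\<^bsub>quotient_module M N\<^esub> C \<oplus>\<^bsub>quotient_module M N\<^esub> D =
      B \<oplus>\<^bsub>quotient_module M N\<^esub> (C \<oplus>\<^bsub>quotient_module M N\<^esub> D)"
      unfolding xy(2,4) z(2) using xy(1,3) z(1)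
      by (simp add: coset_add M.a_assoc del: quotient_module_simps(2))
  next
    show "\<zero>\<^bsub>quotient_module M N\<^esub> \<in> carrier (quotient_module M N)"
      using N_coset by (auto simp: quot_carrier)
    fix B assume "B \<in> carrier (quotient_module M N)"
    then obtain x where x: "x \<in> carrier M" "B = N +>\<^bsub>M\<^esub> x" by (auto simp: quot_carrier)
    have z: "\<zero>\<^bsub>quotient_module M N\<^esub> = N +>\<^bsub>M\<^esub> \<zero>\<^bsub>M\<^esub>" using N_coset by simp
    show "\<zero>\<^bsub>quotient_module M N\<^esub> \<oplus>\<^bsub>quotient_module M N\<^esub> B = B"
      unfolding z x(2) using x(1) by (simp add: coset_add del: quotient_module_simps(2))
    show "\<exists>C\<in>carrier (quotient_module M N). C \<oplus>\<^bsub>quotient_module M N\<^esub> B = \<zero>\<^bsub>quotient_module M N\<^esub>"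
      unfolding z x(2) using x(1)
      by (intro bexI[of _ "N +>\<^bsub>M\<^esub> (\<ominus>\<^bsub>M\<^esub> x)"])
         (auto simp: coset_add quot_carrier M.l_neg simp del: quotient_module_simps(2))
  qed
  show ?thesis
  proof (intro left_module.intro left_module_axioms.intro ag R.ring_axioms)
    fix a B assume "a \<in> carrier R" "B \<in> carrier (quotient_module M N)"
    then show "a \<odot>\<^bsub>quotient_module M N\<^esub> B \<in> carrier (quotient_module M N)"
      by (auto simp: quot_carrier coset_smult smult_closed simp del: quotient_module_simps(4))
  next
    fix a b B assume "a \<in> carrier R" "b \<in> carrier R" "B \<in> carrier (quotient_module M N)"
    then show "(a \<oplus> b) \<odot>\<^bsub>quotient_module M N\<^esub> B =
        a \<odot>\<^bsub>quotient_module M N\<^esub> B \<oplus>\<^bsub>quotient_module M N\<^esub> b \<odot>\<^bsub>quotient_module M N\<^esub> B"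
      by (auto simp: quot_carrier coset_smult coset_add smult_closed smult_l_distr simp del: quotient_module_simps(2,4))
  next
    fix a B C assume "a \<in> carrier R" "B \<in> carrier (quotient_module M N)" "C \<in> carrier (quotient_module M N)"
    then show "a \<odot>\<^bsub>quotient_module M N\<^esub> (B \<oplus>\<^bsub>quotient_module M N\<^esub> C) =
        a \<odot>\<^bsub>quotient_module M N\<^esub> B \<oplus>\<^bsub>quotient_module M N\<^esub> a \<odot>\<^bsub>quotient_module M N\<^esub> C"
      by (auto simp: quot_carrier coset_smult coset_add smult_closed smult_r_distr simp del: quotient_module_simps(2,4))
  next
    fix a b B assume "a \<in> carrier R" "b \<in> carrier R" "B \<in> carrier (quotient_module M N)"
    then show "(a \<otimes> b) \<odot>\<^bsub>quotient_module M N\<^esub> B =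
        a \<odot>\<^bsub>quotient_module M N\<^esub> (b \<odot>\<^bsub>quotient_module M N\<^esub> B)"
      by (auto simp: quot_carrier coset_smult smult_closed smult_assoc simp del: quotient_module_simps(4))
  next
    fix B assume "B \<in> carrier (quotient_module M N)"
    then show "\<one> \<odot>\<^bsub>quotient_module M N\<^esub> B = B"
      by (auto simp: quot_carrier coset_smult smult_one simp del: quotient_module_simps(4))
  qed
qed

lemma projection_hom: "(\<lambda>x. N +>\<^bsub>M\<^esub> x) \<in> LinearCombinations.module_hom R M (quotient_module M N)"
  by (rule module_homI)
     (auto simp: quot_carrier coset_smult coset_add simp del: quotient_module_simps(2,4))

lemma induced_hom:
  assumes g: "g \<in> LinearCombinations.module_hom R M P" and P: "left_module R P"
    and ker: "\<And>x. x \<in> N \<Longrightarrow> g x = \<zero>\<^bsub>P\<^esub>"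
  shows "\<exists>h \<in> LinearCombinations.module_hom R (quotient_module M N) P. \<forall>x\<in>carrier M. h (N +>\<^bsub>M\<^esub> x) = g x"
proof -
  interpret P: left_module R P by fact
  note gc = LinearCombinations.module_hom_closed[OF g]
  define h where "h B = g (SOME x. x \<in> carrier M \<and> B = N +>\<^bsub>M\<^esub> x)" for B
  have h: "h (N +>\<^bsub>M\<^esub> x) = g x" if x: "x \<in> carrier M" for x
  proof -
    define y where "y = (SOME y. y \<in> carrier M \<and> N +>\<^bsub>M\<^esub> x = N +>\<^bsub>M\<^esub> y)"
    have "y \<in> carrier M \<and> N +>\<^bsub>M\<^esub> x = N +>\<^bsub>M\<^esub> y"
      unfolding y_def by (rule someI[of _ x]) (simp add: x)
    then have y: "y \<in> carrier M" "N +>\<^bsub>M\<^esub> x = N +>\<^bsub>M\<^esub> y" by simp_all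
    then have "g (x \<ominus>\<^bsub>M\<^esub> y) = \<zero>\<^bsub>P\<^esub>" using coset_eq_iff[OF x y(1)] by (intro ker) simp
    then have "g x \<ominus>\<^bsub>P\<^esub> g y = \<zero>\<^bsub>P\<^esub>" by (simp only: hom_minus[OF g P x y(1)])
    then have "g x = g y" using funcset_mem[OF gc x] funcset_mem[OF gc y(1)] by simp
    then show ?thesis by (simp add: h_def y_def)
  qed
  have "h \<in> LinearCombinations.module_hom R (quotient_module M N) P"
    by (rule module_homI)
       (use gc in \<open>auto simp: quot_carrier coset_smult coset_add h LinearCombinations.module_hom_add[OF g] LinearCombinations.module_hom_smult[OF g]
          smult_closed Pi_def simp del: quotient_module_simps(2,4)\<close>)
  then show ?thesis using h by blast
qed

end

lemma left_quotientI: "left_module R M \<Longrightarrow> Module.submodule N R M \<Longrightarrow> left_quotient R M N"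
  by (simp add: left_quotient_def left_quotient_axioms_def)

lemma quotient_by_kernel:
  assumes M: "left_module R M" and P: "left_module R P"
    and f: "f \<in> LinearCombinations.module_hom R M P" and surj: "f ` carrier M = carrier P"
  shows "isomorphic_modules R (quotient_module M {x \<in> carrier M. f x = \<zero>\<^bsub>P\<^esub>}) P"
proof -
  interpret M: left_module R M by fact
  define N where "N = {x \<in> carrier M. f x = \<zero>\<^bsub>P\<^esub>}"
  have sub: "Module.submodule N R M" unfolding N_def by (rule M.kernel_submodule[OF f P])
  have N_iff: "x \<in> N \<longleftrightarrow> x \<in> carrier M \<and> f x = \<zero>\<^bsub>P\<^esub>" for x unfolding N_def by blast
  interpret Q: left_quotient R M N using M sub by (rule left_quotientI)
  have "\<exists>h \<in> LinearCombinations.module_hom R (quotient_module M N) P. \<forall>x\<in>carrier M. h (N +>\<^bsub>M\<^esub> x) = f x"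
    by (rule Q.induced_hom[OF f P]) (simp only: N_iff)
  then obtain h where h: "h \<in> LinearCombinations.module_hom R (quotient_module M N) P"
    and hf: "\<And>x. x \<in> carrier M \<Longrightarrow> h (N +>\<^bsub>M\<^esub> x) = f x"
    by blast
  have "inj_on h (carrier (quotient_module M N))"
  proof (rule injective_hom[OF Q.left_module_quotient P h])
    fix B assume "B \<in> carrier (quotient_module M N)" "h B = \<zero>\<^bsub>P\<^esub>"
    then obtain x where x: "x \<in> carrier M" "B = N +>\<^bsub>M\<^esub> x" by (auto simp: Q.quot_carrier)
    have "f x = h B" unfolding x(2) by (rule hf[OF x(1), symmetric])
    then have "f x = \<zero>\<^bsub>P\<^esub>" using \<open>h B = \<zero>\<^bsub>P\<^esub>\<close> by (rule trans)
    with x have "x \<in> N" by (simp only: N_iff)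
    moreover have "x \<ominus>\<^bsub>M\<^esub> \<zero>\<^bsub>M\<^esub> = x" using x by (simp add: a_minus_def)
    ultimately have "B = N +>\<^bsub>M\<^esub> \<zero>\<^bsub>M\<^esub>" using Q.coset_eq_iff[OF x(1) M.zero_closed] x(2) by simp
    then show "B = \<zero>\<^bsub>quotient_module M N\<^esub>" using Q.zero_coset by simp
  qed
  moreover have "h ` carrier (quotient_module M N) = carrier P"
    using hf surj by (auto simp: Q.quot_carrier image_image)
  ultimately show ?thesis unfolding isomorphic_modules_def bij_betw_def N_def[symmetric] using h by blast
qed

lemma simple_module_iso:
  assumes "isomorphic_modules R M P" and M: "left_module R M" and P: "simple_left_module R P"
  shows "simple_left_module R M"
proof -
  have P': "left_module R P" using P by (simp add: simple_left_module_def)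
  interpret M: left_module R M by fact
  interpret P: left_module R P by fact
  obtain f where f: "f \<in> LinearCombinations.module_hom R M P" and bij: "bij_betw f (carrier M) (carrier P)"
    using assms(1) unfolding isomorphic_modules_def by blast
  have f0: "f \<zero>\<^bsub>M\<^esub> = \<zero>\<^bsub>P\<^esub>" by (rule M.hom_zero[OF f P'])
  have "carrier M \<noteq> {\<zero>\<^bsub>M\<^esub>}"
  proof
    assume "carrier M = {\<zero>\<^bsub>M\<^esub>}"
    then have "carrier P = {\<zero>\<^bsub>P\<^esub>}" using bij f0 by (auto simp: bij_betw_def)
    then show False using P by (simp add: simple_left_module_def)
  qed
  moreover have "N = {\<zero>\<^bsub>M\<^esub>} \<or> N = carrier M" if N: "Module.submodule N R M" for N
  proof -
    note N' = M.submoduleD(1,2)[OF N]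
    have "f ` N = {\<zero>\<^bsub>P\<^esub>} \<or> f ` N = carrier P"
      using P M.image_submodule[OF f P' N] by (simp add: simple_left_module_def)
    moreover have inj: "inj_on f (carrier M)" using bij by (simp add: bij_betw_def)
    moreover have "f ` {\<zero>\<^bsub>M\<^esub>} = {\<zero>\<^bsub>P\<^esub>}" "f ` carrier M = carrier P" using bij f0 by (auto simp: bij_betw_def)
    ultimately show ?thesis using N' by (metis inj_on_image_eq_iff M.zero_closed empty_subsetI insert_subset order_refl)
  qed
  ultimately show ?thesis using M by (simp add: simple_left_module_def)
qed

lemma simple_surjection:
  assumes M: "simple_left_module R M" and P: "left_module R P" "carrier P \<noteq> {\<zero>\<^bsub>P\<^esub>}"
    and f: "f \<in> LinearCombinations.module_hom R M P" "f ` carrier M = carrier P"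
  shows "isomorphic_modules R M P"
proof -
  have M': "left_module R M" using M by (simp add: simple_left_module_def)
  interpret M: left_module R M by fact
  let ?N = "{x \<in> carrier M. f x = \<zero>\<^bsub>P\<^esub>}"
  have "?N = {\<zero>\<^bsub>M\<^esub>} \<or> ?N = carrier M"
    using M M.kernel_submodule[OF f(1) P(1)] by (simp add: simple_left_module_def)
  moreover have "?N \<noteq> carrier M"
  proof
    assume "?N = carrier M"
    then have "f ` carrier M \<subseteq> {\<zero>\<^bsub>P\<^esub>}" by blast
    then have "carrier P \<subseteq> {\<zero>\<^bsub>P\<^esub>}" unfolding f(2) .
    moreover have "\<zero>\<^bsub>P\<^esub> \<in> carrier P"
      using P(1) by (simp add: left_module_def abelian_group.axioms abelian_monoid.zero_closed)
    ultimately show False using P(2) by blast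
  qed
  ultimately have "?N = {\<zero>\<^bsub>M\<^esub>}" by blast
  then have "inj_on f (carrier M)" by (intro injective_hom[OF M' P(1) f(1)]) blast
  then show ?thesis using f unfolding isomorphic_modules_def bij_betw_def by blast
qed

text \<open>The image of \<open>N'\<close> in the simple quotient is zero or everything.\<close>

lemma simple_quotient_maximal:
  assumes Z: "left_module R Z" and N: "Module.submodule N R Z" "simple_left_module R (quotient_module Z N)"
    and N': "Module.submodule N' R Z" "N \<subseteq> N'" "N' \<noteq> carrier Z"
  shows "N' = N"
proof -
  interpret Q: left_quotient R Z N using Z N(1) by (rule left_quotientI)
  let ?\<pi> = "\<lambda>x. N +>\<^bsub>Z\<^esub> x"
  have "Module.submodule (?\<pi> ` N') R (quotient_module Z N)"
    using Q.image_submodule[OF Q.projection_hom Q.left_module_quotient N'(1)] .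
  then consider "?\<pi> ` N' = {N}" | "?\<pi> ` N' = ?\<pi> ` carrier Z"
    using N(2) by (auto simp: simple_left_module_def Q.quot_carrier)
  then show ?thesis
  proof cases
    case 1
    have "x \<in> N" if "x \<in> N'" for x
    proof -
      have "x \<in> carrier Z" using that Q.submoduleD(1)[OF N'(1)] by blast
      then have "x \<in> N +>\<^bsub>Z\<^esub> x" by (rule Q.N.a_rcos_self)
      then show ?thesis using 1 that by blast
    qed
    then show ?thesis using N'(2) by blast
  next
    case 2
    have "x \<in> N'" if x: "x \<in> carrier Z" for x
    proof -
      have "N +>\<^bsub>Z\<^esub> x \<in> ?\<pi> ` N'" unfolding 2 using x by (rule imageI)
      then obtain y where y: "y \<in> N'" "N +>\<^bsub>Z\<^esub> x = N +>\<^bsub>Z\<^esub> y" by blast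
      have yc: "y \<in> carrier Z" by (rule subsetD[OF Q.submoduleD(1)[OF N'(1)] y(1)])
      have "x \<ominus>\<^bsub>Z\<^esub> y \<in> N" using y(2) Q.coset_eq_iff[OF x yc] by simp
      then have "(x \<ominus>\<^bsub>Z\<^esub> y) \<oplus>\<^bsub>Z\<^esub> y \<in> N'"
        by (intro Q.submoduleD(3)[OF N'(1)] subsetD[OF N'(2)] y(1))
      then show ?thesis using x yc by (simp add: a_minus_def Q.a_assoc Q.l_neg)
    qed
    then show ?thesis using N'(3) Q.submoduleD(1)[OF N'(1)] by blast
  qed
qed

text \<open>The kernel of \<open>f\<close> is one submodule with simple quotient. Any other one is maximal and, by
\<open>max\<close>, contained in the proper submodule \<open>ker f\<close>, hence equal to it; so the definite description
picks the kernel.\<close>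

lemma unique_simple_quotient_iso:
  assumes Z: "left_module R Z" and P: "simple_left_module R P"
    and f: "f \<in> LinearCombinations.module_hom R Z P" "f ` carrier Z = carrier P"
    and max: "\<And>N. Module.submodule N R Z \<Longrightarrow> simple_left_module R (quotient_module Z N) \<Longrightarrow>
       N \<subseteq> {x \<in> carrier Z. f x = \<zero>\<^bsub>P\<^esub>}"
  shows "isomorphic_modules R (unique_simple_quotient R Z) P" "left_module R (unique_simple_quotient R Z)"
proof -
  interpret Z: left_module R Z by fact
  have P': "left_module R P" "carrier P \<noteq> {\<zero>\<^bsub>P\<^esub>}" using P by (simp_all add: simple_left_module_def)
  define N0 where "N0 = {x \<in> carrier Z. f x = \<zero>\<^bsub>P\<^esub>}"
  have N: "Module.submodule N0 R Z" unfolding N0_def by (rule Z.kernel_submodule[OF f(1) P'(1)])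
  interpret Q: left_quotient R Z N0 using Z N by (rule left_quotientI)
  have iso: "isomorphic_modules R (quotient_module Z N0) P" unfolding N0_def by (rule quotient_by_kernel[OF Z P'(1) f])
  have simple: "simple_left_module R (quotient_module Z N0)"
    by (rule simple_module_iso[OF iso Q.left_module_quotient P])
  have ne: "N0 \<noteq> carrier Z"
  proof
    assume "N0 = carrier Z"
    then have "f ` carrier Z \<subseteq> {\<zero>\<^bsub>P\<^esub>}" unfolding N0_def by blast
    then have "carrier P \<subseteq> {\<zero>\<^bsub>P\<^esub>}" unfolding f(2) .
    moreover have "\<zero>\<^bsub>P\<^esub> \<in> carrier P"
      using P'(1) by (simp add: left_module_def abelian_group.axioms abelian_monoid.zero_closed)
    ultimately show False using P'(2) by blast
  qed
  have "(THE N. Module.submodule N R Z \<and> simple_left_module R (quotient_module Z N)) = N0"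
  proof (rule the_equality)
    fix N assume "Module.submodule N R Z \<and> simple_left_module R (quotient_module Z N)"
    then have *: "Module.submodule N R Z" "simple_left_module R (quotient_module Z N)" by simp_all
    show "N = N0" by (rule simple_quotient_maximal[OF Z * N max[OF *, folded N0_def] ne, symmetric])
  qed (use N simple in blast)
  then have "unique_simple_quotient R Z = quotient_module Z N0" by (simp add: unique_simple_quotient_def)
  then show "isomorphic_modules R (unique_simple_quotient R Z) P" "left_module R (unique_simple_quotient R Z)"
    using iso Q.left_module_quotient by simp_all
qed


section \<open>Free algebras, presented algebras and their modules\<close>

lemma const_add: "const (a + b) = const a + const b"
  by (simp add: const_def single_add)

lemma const_mult: "const a * const b = const (a * b)"
  by (simp add: const_def mult_single plus_list_def)

lemma const_0 [simp]: "const 0 = 0" by (simp add: const_def)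

lemma const_1 [simp]: "const 1 = 1"
  by (simp add: const_def zero_list_def[symmetric])

lemma gen_single: "gen g * Poly_Mapping.single w c = Poly_Mapping.single (g # w) c"
  by (simp add: gen_def mult_single plus_list_def)

lemma const_single: "const a * Poly_Mapping.single w c = Poly_Mapping.single w (a * c)"
  "Poly_Mapping.single w c * const a = Poly_Mapping.single w (c * a)"
  by (simp_all add: const_def mult_single plus_list_def)

lemma single_add_induct [case_names single add]:
  fixes p :: "'x \<Rightarrow>\<^sub>0 'y::ab_group_add"
  assumes s: "\<And>w k. P (Poly_Mapping.single w k)" and a: "\<And>p r. P p \<Longrightarrow> P r \<Longrightarrow> P (p + r)"
  shows "P p"
proof (induction p rule: update_induct)
  case const
  show ?case using s[of undefined 0] by simp
next
  case (update f w k)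
  have "Poly_Mapping.update w k f = f + Poly_Mapping.single w k"
    using update(1) by (intro poly_mapping_eqI) (auto simp: lookup_update lookup_add lookup_single in_keys_iff)
  then show ?case using a[OF update(3) s] by simp
qed

text \<open>Words are built up on the left, as this is the side on which algebra elements act.\<close>

lemma free_algebra_induct [case_names const add gen]:
  fixes p :: "('g, 'k::field) free_algebra"
  assumes c: "\<And>a. P (const a)" and a: "\<And>p r. P p \<Longrightarrow> P r \<Longrightarrow> P (p + r)"
    and g: "\<And>x p. P p \<Longrightarrow> P (gen x * p)"
  shows "P p"
proof (induction p rule: single_add_induct)
  case (single w k)
  show ?case
  proof (induction w)
    case Nil
    show ?case using c[of k] by (simp add: const_def)
  next
    case (Cons x w)
    show ?case using g[OF Cons, of x] by (simp only: gen_single)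
  qed
qed (rule a)

lemma const_central: "const a * p = p * const a" for p :: "('g, 'k::field) free_algebra"
  by (induction p rule: single_add_induct)
     (simp_all add: const_single mult.commute distrib_left distrib_right)

context operator_space
begin

text \<open>For linear operators \<open>T g\<close> this is the algebra homomorphism from the free algebra to operators
that sends the generator \<open>g\<close> to \<open>T g\<close>.\<close>

definition word_eval :: "('g \<Rightarrow> 'b \<Rightarrow> 'b) \<Rightarrow> ('g, 'a) free_algebra \<Rightarrow> 'b \<Rightarrow> 'b" where
  "word_eval T p v = (\<Sum>w\<in>Poly_Mapping.keys p. Poly_Mapping.lookup p w *s foldr T w v)"

lemma word_eval_superset:
  assumes "finite W" "Poly_Mapping.keys p \<subseteq> W"
  shows "word_eval T p v = (\<Sum>w\<in>W. Poly_Mapping.lookup p w *s foldr T w v)"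
  unfolding word_eval_def using assms by (intro sum.mono_neutral_left) (auto simp: in_keys_iff)

lemma word_eval_add: "word_eval T (p + r) v = word_eval T p v + word_eval T r v"
proof -
  let ?W = "Poly_Mapping.keys p \<union> Poly_Mapping.keys r"
  have "word_eval T (p + r) v = (\<Sum>w\<in>?W. Poly_Mapping.lookup (p + r) w *s foldr T w v)"
    by (rule word_eval_superset) (use Poly_Mapping.keys_add[of p r] in auto)
  then show ?thesis
    by (simp add: word_eval_superset[of ?W] lookup_add scale_left_distrib sum.distrib)
qed

lemma word_eval_single: "word_eval T (Poly_Mapping.single w c) v = c *s foldr T w v"
  by (simp add: word_eval_def)

lemma word_eval_const [simp]: "word_eval T (const c) v = c *s v"
  by (simp add: const_def word_eval_single)

lemma word_eval_0 [simp]: "word_eval T 0 v = 0"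
  by (simp add: word_eval_def)

lemma word_eval_1 [simp]: "word_eval T 1 v = v"
  using word_eval_const[of T 1 v] by simp

lemma word_eval_gen [simp]: "word_eval T (gen g) v = T g v"
  by (simp add: gen_def word_eval_single)

lemma word_eval_uminus: "word_eval T (- p) v = - word_eval T p v"
proof -
  have "word_eval T (- p) v + word_eval T p v = 0" using word_eval_add[of T "- p" p v] by simp
  then show ?thesis by (simp add: eq_neg_iff_add_eq_0)
qed

lemma word_eval_diff: "word_eval T (p - r) v = word_eval T p v - word_eval T r v"
  using word_eval_add[of T p "- r" v] by (simp add: word_eval_uminus)

lemma word_eval_linear:
  assumes "\<And>g. endo (T g)" shows "endo (word_eval T p)"
proof (induction p rule: single_add_induct)
  case (single w k)
  have "endo (foldr T w)"
  proof (induction w)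
    case Nil
    show ?case by (rule endoI) simp_all
  next
    case (Cons g w)
    show ?case by (rule endoI) (simp_all add: endo_simps[OF assms] endo_simps[OF Cons])
  qed
  then show ?case
    by (intro endoI) (simp_all add: word_eval_single endo_simps scale_right_distrib mult.commute)
next
  case (add p r)
  then show ?case by (intro endoI) (simp_all add: word_eval_add endo_simps scale_right_distrib)
qed

lemma word_eval_mult:
  assumes T: "\<And>g. endo (T g)" shows "word_eval T (p * r) v = word_eval T p (word_eval T r v)"
proof -
  have g: "word_eval T (gen x * p) v = T x (word_eval T p v)" for x p
    by (induction p rule: single_add_induct)
       (simp_all add: gen_single word_eval_single word_eval_add distrib_left endo_simps[OF T])
  have c: "word_eval T (const a * p) v = a *s word_eval T p v" for a p
    by (induction p rule: single_add_induct)
       (simp_all add: const_single word_eval_single word_eval_add distrib_left scale_right_distrib)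
  show ?thesis
  proof (induction p rule: free_algebra_induct)
    case (const a)
    show ?case by (simp add: c)
  next
    case (add p s)
    then show ?case by (simp add: distrib_right word_eval_add)
  next
    case (gen x p)
    have "word_eval T (gen x * s) u = T x (word_eval T s u)" for s u
      by (induction s rule: single_add_induct)
         (simp_all add: gen_single word_eval_single word_eval_add distrib_left endo_simps[OF T])
    then show ?case using gen by (simp add: mult.assoc)
  qed
qed

end

text \<open>Replaces the record operations of \<open>class_ring\<close> by those of the type, in which computations in
the free algebra take place.\<close>

lemma class_ring_ideal:
  fixes I :: "'r::ring_1 set"
  shows "ideal I class_ring \<longleftrightarrow> 0 \<in> I \<and> (\<forall>x\<in>I. \<forall>y\<in>I. x + y \<in> I) \<and> (\<forall>x\<in>I. \<forall>r. r * x \<in> I \<and> x * r \<in> I)"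
proof
  assume "ideal I class_ring"
  then interpret I: ideal I class_ring .
  show "0 \<in> I \<and> (\<forall>x\<in>I. \<forall>y\<in>I. x + y \<in> I) \<and> (\<forall>x\<in>I. \<forall>r. r * x \<in> I \<and> x * r \<in> I)"
    using I.zero_closed I.a_closed I.I_l_closed I.I_r_closed by (simp add: class_ring_simps)
next
  assume I: "0 \<in> I \<and> (\<forall>x\<in>I. \<forall>y\<in>I. x + y \<in> I) \<and> (\<forall>x\<in>I. \<forall>r. r * x \<in> I \<and> x * r \<in> I)"
  have "- x \<in> I" if "x \<in> I" for x using I that by (metis mult_minus1)
  moreover have "inv\<^bsub>add_monoid (class_ring :: 'r ring)\<^esub> x = - x" for x
    unfolding a_inv_def[symmetric] by (simp only: class_ring_simps)
  ultimately show "ideal I class_ring"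
    using I class_ring.ring_axioms by (intro idealI subgroup.intro) auto
qed

context
  fixes S :: "('g, 'k::field) free_algebra set"
begin

abbreviation "relations_ideal \<equiv> Idl\<^bsub>class_ring\<^esub> S"

lemma relations_ideal_ideal: "ideal relations_ideal class_ring"
  by (rule ring.genideal_ideal[OF class_ring.ring_axioms]) simp

lemma relations_ideal_0: "0 \<in> relations_ideal" and relations_ideal_add: "x \<in> relations_ideal \<Longrightarrow> y \<in> relations_ideal \<Longrightarrow> x + y \<in> relations_ideal"
  and relations_ideal_mult: "x \<in> relations_ideal \<Longrightarrow> p * x \<in> relations_ideal" "x \<in> relations_ideal \<Longrightarrow> x * p \<in> relations_ideal"
  using relations_ideal_ideal unfolding class_ring_ideal by blast+

lemma relations_ideal_uminus: "x \<in> relations_ideal \<Longrightarrow> - x \<in> relations_ideal"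
  using relations_ideal_mult(1)[of x "- 1"] by simp

lemma relations_ideal_diff: "x \<in> relations_ideal \<Longrightarrow> y \<in> relations_ideal \<Longrightarrow> x - y \<in> relations_ideal"
  using relations_ideal_add[of x "- y"] relations_ideal_uminus[of y] by simp

lemma relations_ideal_self: "p \<in> S \<Longrightarrow> p \<in> relations_ideal"
  using ring.genideal_self[OF class_ring.ring_axioms, of S] by auto

lemma relations_ideal_least:
  assumes "S \<subseteq> J" "ideal J class_ring" shows "relations_ideal \<subseteq> J"
  using ring.genideal_minimal[OF class_ring.ring_axioms assms(2,1)] .

abbreviation "cls \<equiv> presented_class S"
abbreviation "Alg \<equiv> presented_algebra S"

lemma in_cls: "r \<in> cls p \<longleftrightarrow> r - p \<in> relations_ideal"
proof -
  have "r \<in> cls p \<longleftrightarrow> (\<exists>i\<in>relations_ideal. r = i + p)"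
    by (auto simp: presented_class_def a_r_coset_def')
  then show ?thesis by (metis diff_add_cancel add_diff_cancel_right')
qed

lemma cls_self: "p \<in> cls p"
  by (simp add: in_cls relations_ideal_0)

lemma cls_eq_iff: "cls p = cls r \<longleftrightarrow> p - r \<in> relations_ideal"
proof
  assume "cls p = cls r"
  then show "p - r \<in> relations_ideal" using cls_self[of p] in_cls by blast
next
  assume d: "p - r \<in> relations_ideal"
  have "x - p \<in> relations_ideal \<longleftrightarrow> x - r \<in> relations_ideal" for x
    using relations_ideal_add[OF _ d, of "x - p"] relations_ideal_diff[OF _ d, of "x - r"] by auto
  then show "cls p = cls r" by (auto simp: in_cls)
qed

lemma alg_ring: "ring Alg"
  unfolding presented_algebra_def by (rule ideal.quotient_is_ring[OF relations_ideal_ideal])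

lemma alg_carrier: "carrier Alg = range cls"
  by (auto simp: presented_algebra_def presented_class_def FactRing_def A_RCOSETS_def')

lemma alg_add: "cls p \<oplus>\<^bsub>Alg\<^esub> cls r = cls (p + r)"
proof -
  interpret I: ideal relations_ideal class_ring by (rule relations_ideal_ideal)
  show ?thesis using I.a_rcos_sum[of p r]
    by (simp add: presented_algebra_def presented_class_def FactRing_def)
qed

lemma alg_mult: "cls p \<otimes>\<^bsub>Alg\<^esub> cls r = cls (p * r)"
  using ideal.rcoset_mult_add[OF relations_ideal_ideal, of p r]
  by (simp add: presented_algebra_def presented_class_def FactRing_def)

lemma alg_one: "\<one>\<^bsub>Alg\<^esub> = cls 1"
  by (simp add: presented_algebra_def presented_class_def FactRing_def)

lemma alg_zero: "\<zero>\<^bsub>Alg\<^esub> = cls 0"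
proof -
  interpret I: ideal relations_ideal class_ring by (rule relations_ideal_ideal)
  have "r \<in> relations_ideal \<longleftrightarrow> r \<in> cls 0" for r by (simp add: in_cls)
  then show ?thesis by (auto simp: presented_algebra_def FactRing_def)
qed

lemma cls_carrier [simp]: "cls p \<in> carrier Alg"
  by (simp add: alg_carrier)

end


locale presented_module = left_module "presented_algebra S" M
  for S :: "('g, 'k::field) free_algebra set" and M :: "(('g, 'k) free_algebra set, 'm, 'z) module_scheme"
begin

abbreviation act where "act p x \<equiv> presented_class S p \<odot>\<^bsub>M\<^esub> x"

lemma act_closed [simp]: "x \<in> carrier M \<Longrightarrow> act p x \<in> carrier M"
  by (simp add: smult_closed)

lemma act_add: "x \<in> carrier M \<Longrightarrow> act (p + r) x = act p x \<oplus>\<^bsub>M\<^esub> act r x"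
  using smult_l_distr[of "presented_class S p" "presented_class S r" x] by (simp add: alg_add)

lemma act_mult: "x \<in> carrier M \<Longrightarrow> act (p * r) x = act p (act r x)"
  using smult_assoc[of "presented_class S p" "presented_class S r" x] by (simp add: alg_mult)

lemma act_1 [simp]: "x \<in> carrier M \<Longrightarrow> act 1 x = x"
  using smult_one[of x] by (simp add: alg_one)

lemma act_0 [simp]: "x \<in> carrier M \<Longrightarrow> act 0 x = \<zero>\<^bsub>M\<^esub>"
  using smult_0_left[of x] by (simp add: alg_zero)

lemma act_radd: "x \<in> carrier M \<Longrightarrow> y \<in> carrier M \<Longrightarrow> act p (x \<oplus>\<^bsub>M\<^esub> y) = act p x \<oplus>\<^bsub>M\<^esub> act p y"
  by (simp add: smult_r_distr)

lemma act_zero [simp]: "act p \<zero>\<^bsub>M\<^esub> = \<zero>\<^bsub>M\<^esub>"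
  by simp

lemma act_cong: "p - r \<in> Idl\<^bsub>class_ring\<^esub> S \<Longrightarrow> act p x = act r x"
  using cls_eq_iff[of S p r] by simp

lemma act_rel:
  assumes "x \<in> carrier M" "p \<in> S" shows "act p x = \<zero>\<^bsub>M\<^esub>"
  using act_cong[of p 0 x] relations_ideal_self[OF assms(2)] act_0[OF assms(1)] by simp

lemma act_eq_of_rel:
  assumes "x \<in> carrier M" "p - r \<in> S" shows "act p x = act r x"
  by (rule act_cong) (rule relations_ideal_self[OF assms(2)])

lemma act_const_const: "x \<in> carrier M \<Longrightarrow> act (const a) (act (const b) x) = act (const (a * b)) x"
  by (simp add: act_mult[symmetric] const_mult)

lemma act_const_commute: "x \<in> carrier M \<Longrightarrow> act p (act (const a) x) = act (const a) (act p x)"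
  by (simp add: act_mult[symmetric] const_central)

lemma act_const_nonzero:
  assumes "x \<in> carrier M" "act (const c) x = \<zero>\<^bsub>M\<^esub>" "c \<noteq> 0" shows "x = \<zero>\<^bsub>M\<^esub>"
proof -
  have "act (const (inverse c)) (act (const c) x) = x"
    using assms(1,3) by (simp add: act_const_const)
  then show ?thesis unfolding assms(2) by simp
qed

lemma act_const_inj:
  assumes "x \<in> carrier M" "x \<noteq> \<zero>\<^bsub>M\<^esub>" "act (const c) x = act (const d) x" shows "c = d"
proof (rule ccontr)
  assume "c \<noteq> d"
  have "act (const (c - d)) x \<oplus>\<^bsub>M\<^esub> act (const d) x = \<zero>\<^bsub>M\<^esub> \<oplus>\<^bsub>M\<^esub> act (const d) x"
    using assms by (simp flip: act_add const_add)
  then have "act (const (c - d)) x = \<zero>\<^bsub>M\<^esub>"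
    using assms(1) by (metis M.add.right_cancel act_closed M.zero_closed)
  then show False using act_const_nonzero assms(1,2) \<open>c \<noteq> d\<close> by (metis right_minus_eq)
qed

text \<open>The presented algebra is generated by scalars and generators, so stability under these suffices.\<close>

lemma act_submoduleI:
  assumes N: "N \<subseteq> carrier M" "\<zero>\<^bsub>M\<^esub> \<in> N" "\<And>x y. x \<in> N \<Longrightarrow> y \<in> N \<Longrightarrow> x \<oplus>\<^bsub>M\<^esub> y \<in> N"
    and c: "\<And>c x. x \<in> N \<Longrightarrow> act (const c) x \<in> N" and g: "\<And>g x. x \<in> N \<Longrightarrow> act (gen g) x \<in> N"
  shows "Module.submodule N (presented_algebra S) M"
proof (rule submoduleI[OF N])
  fix a x assume a: "a \<in> carrier (presented_algebra S)" and x: "x \<in> N"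
  then obtain p where p: "a = presented_class S p" by (auto simp: alg_carrier)
  have xc: "x \<in> carrier M" using x N(1) by blast
  have "act p x \<in> N"
  proof (induction p rule: free_algebra_induct)
    case (const a)
    show ?case by (rule c[OF x])
  next
    case (add p r)
    then show ?case using N(3) by (simp add: act_add[OF xc])
  next
    case (gen g p)
    show ?case unfolding act_mult[OF xc] by (rule g[OF gen])
  qed
  then show "a \<odot>\<^bsub>M\<^esub> x \<in> N" by (simp add: p)
qed

end

lemma act_homI:
  assumes "left_module (presented_algebra S) M" "left_module (presented_algebra S) P"
    and cl: "\<And>x. x \<in> carrier M \<Longrightarrow> f x \<in> carrier P"
    and add: "\<And>x y. x \<in> carrier M \<Longrightarrow> y \<in> carrier M \<Longrightarrow> f (x \<oplus>\<^bsub>M\<^esub> y) = f x \<oplus>\<^bsub>P\<^esub> f y"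
    and c: "\<And>c x. x \<in> carrier M \<Longrightarrow> f (presented_class S (const c) \<odot>\<^bsub>M\<^esub> x) = presented_class S (const c) \<odot>\<^bsub>P\<^esub> f x"
    and g: "\<And>g x. x \<in> carrier M \<Longrightarrow> f (presented_class S (gen g) \<odot>\<^bsub>M\<^esub> x) = presented_class S (gen g) \<odot>\<^bsub>P\<^esub> f x"
  shows "f \<in> LinearCombinations.module_hom (presented_algebra S) M P"
proof (rule module_homI[OF cl add])
  interpret M: presented_module S M using assms(1) by (simp add: presented_module_def)
  interpret P: presented_module S P using assms(2) by (simp add: presented_module_def)
  fix a x assume a: "a \<in> carrier (presented_algebra S)" and x: "x \<in> carrier M"
  then obtain p where p: "a = presented_class S p" by (auto simp: alg_carrier)
  have "f (M.act p x) = P.act p (f x)"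
  proof (induction p rule: free_algebra_induct)
    case (const a)
    show ?case by (rule c[OF x])
  next
    case (add p r)
    then show ?case by (simp add: M.act_add P.act_add x cl assms(4))
  next
    case (gen y p)
    have "f (M.act (gen y * p) x) = f (M.act (gen y) (M.act p x))" by (simp only: M.act_mult[OF x])
    also have "\<dots> = P.act (gen y) (f (M.act p x))" by (rule g) (simp add: x)
    also have "\<dots> = P.act (gen y * p) (f x)" by (simp only: gen P.act_mult[OF cl[OF x]])
    finally show ?case .
  qed
  then show "f (a \<odot>\<^bsub>M\<^esub> x) = a \<odot>\<^bsub>P\<^esub> f x" by (simp add: p)
qed

context operator_space
begin

text \<open>A coset acts through a chosen representative; when the relations act as zero, all
representatives act in the same way.\<close>

definition rep_module :: "('g \<Rightarrow> 'b \<Rightarrow> 'b) \<Rightarrow> (('g, 'a) free_algebra set, 'b) module" where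
  "rep_module T = \<lparr>carrier = UNIV, mult = (\<lambda>_ _. 0), one = 0, zero = 0, add = (+),
     smult = (\<lambda>A. word_eval T (SOME p. p \<in> A))\<rparr>"

lemma rep_module_simps [simp]:
  "carrier (rep_module T) = UNIV" "zero (rep_module T) = 0" "add (rep_module T) = (+)"
  by (simp_all add: rep_module_def)

lemma word_eval_annihilator_ideal:
  assumes T: "\<And>g. endo (T g)"
  shows "ideal {p. \<forall>v. word_eval T p v = 0} class_ring"
  unfolding class_ring_ideal
  by (auto simp: word_eval_add word_eval_mult[OF T] endo_simps(3)[OF word_eval_linear[OF T]])

lemma rep_module_smult:
  assumes T: "\<And>g. endo (T g)" and S: "\<And>p v. p \<in> S \<Longrightarrow> word_eval T p v = 0"
  shows "presented_class S p \<odot>\<^bsub>rep_module T\<^esub> v = word_eval T p v"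
proof -
  have I: "Idl\<^bsub>class_ring\<^esub> S \<subseteq> {p. \<forall>v. word_eval T p v = 0}"
    by (rule relations_ideal_least[OF _ word_eval_annihilator_ideal[OF T]]) (use S in blast)
  define r where "r = (SOME r. r \<in> presented_class S p)"
  have "r \<in> presented_class S p" unfolding r_def by (rule someI[of _ p]) (rule cls_self)
  then have "word_eval T (r - p) v = 0" using I by (auto simp: in_cls)
  then show ?thesis by (simp add: rep_module_def r_def word_eval_diff)
qed

lemma rep_left_module:
  assumes T: "\<And>g. endo (T g)" and S: "\<And>p v. p \<in> S \<Longrightarrow> word_eval T p v = 0"
  shows "left_module (presented_algebra S) (rep_module T)"
proof -
  have ag: "abelian_group (rep_module T)"
    by (rule abelian_groupI) (auto simp: add.assoc add.commute intro: exI[of _ "- _"] left_minus)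
  note sm = rep_module_smult[of T S, OF T S]
  show ?thesis
    by (intro left_module.intro left_module_axioms.intro alg_ring ag)
       (auto simp: alg_carrier sm alg_add alg_mult alg_one word_eval_add word_eval_mult[OF T] endo_simps(1)[OF word_eval_linear[OF T]])
qed

end

lemma regular_left_module:
  assumes "ring R" shows "left_module R (regular_module R)"
proof -
  interpret ring R by fact
  have "abelian_group (regular_module R)"
    by (rule abelian_groupI)
       (auto simp: regular_module_def a_ac intro!: bexI[of _ "\<ominus>\<^bsub>R\<^esub> _"] l_neg)
  then show ?thesis
    by (intro left_module.intro left_module_axioms.intro ring_axioms)
       (auto simp: regular_module_def l_distr r_distr m_assoc)
qed

text \<open>Let \<open>Z\<close> be the cyclic module with generator \<open>v\<close> and annihilator \<open>J\<close>, and map \<open>v\<close> to \<open>v0\<close>. A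
submodule that is not in the kernel contains some \<open>n\<close> with the same image as \<open>v\<close>. By \<open>wt\<close> an algebra
element carries \<open>n\<close> to \<open>c v\<close> and \<open>v\<close> to \<open>d v\<close>; comparing images gives \<open>c = d\<close>, so the submodule contains \<open>v\<close>
and is everything. Hence the kernel is the only submodule with simple quotient.\<close>

lemma cyclic_simple_quotient:
  fixes S :: "('g, 'k::field) free_algebra set"
  defines "A \<equiv> presented_algebra S"
  defines "v \<equiv> \<lambda>J. a_r_coset (regular_module A) J \<one>\<^bsub>A\<^esub>"
  assumes J: "Module.submodule J A (regular_module A)"
    and P: "simple_left_module A P" and v0: "v0 \<in> carrier P" "v0 \<noteq> \<zero>\<^bsub>P\<^esub>"
    and Jv0: "\<And>a. a \<in> J \<Longrightarrow> a \<odot>\<^bsub>P\<^esub> v0 = \<zero>\<^bsub>P\<^esub>"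
    and wt: "\<And>z. z \<in> carrier (quotient_module (regular_module A) J) \<Longrightarrow>
       \<exists>p c d. d \<noteq> 0
         \<and> presented_class S p \<odot>\<^bsub>quotient_module (regular_module A) J\<^esub> z
            = presented_class S (const c) \<odot>\<^bsub>quotient_module (regular_module A) J\<^esub> (v J)
         \<and> presented_class S p \<odot>\<^bsub>quotient_module (regular_module A) J\<^esub> (v J)
            = presented_class S (const d) \<odot>\<^bsub>quotient_module (regular_module A) J\<^esub> (v J)"
  shows "isomorphic_modules A (unique_simple_quotient A (quotient_module (regular_module A) J)) P"
    and "left_module A (unique_simple_quotient A (quotient_module (regular_module A) J))"
proof -
  have R: "ring A" unfolding A_def by (rule alg_ring)
  interpret A: ring A by fact
  have reg: "left_module A (regular_module A)" using R by (rule regular_left_module)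
  interpret Q: left_quotient A "regular_module A" J using reg J by (rule left_quotientI)
  define Z where "Z = quotient_module (regular_module A) J"
  define z0 where "z0 = v J"
  have Zm: "left_module A Z" unfolding Z_def by (rule Q.left_module_quotient)
  interpret Z: presented_module S Z using Zm by (simp add: presented_module_def A_def)
  have P': "left_module A P" using P by (simp add: simple_left_module_def)
  interpret P: presented_module S P using P' by (simp add: presented_module_def A_def)
  have rc: "carrier (regular_module A) = carrier A" by (simp add: regular_module_def)
  have z0: "z0 \<in> carrier Z" unfolding z0_def v_def Z_def by (simp add: Q.quot_carrier rc)
  have gen: "J +>\<^bsub>regular_module A\<^esub> a = a \<odot>\<^bsub>Z\<^esub> z0" if "a \<in> carrier A" for a
  proof -
    have "a \<odot>\<^bsub>Z\<^esub> z0 = J +>\<^bsub>regular_module A\<^esub> (a \<odot>\<^bsub>regular_module A\<^esub> \<one>\<^bsub>A\<^esub>)"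
      unfolding z0_def v_def Z_def by (rule Q.coset_smult) (simp_all add: that rc)
    then show ?thesis using that by (simp add: regular_module_def)
  qed
  have cyc: "\<exists>a\<in>carrier A. z = a \<odot>\<^bsub>Z\<^esub> z0" if "z \<in> carrier Z" for z
  proof -
    from that obtain a where "a \<in> carrier A" "z = J +>\<^bsub>regular_module A\<^esub> a"
      unfolding Z_def by (auto simp: Q.quot_carrier rc)
    then show ?thesis using gen by blast
  qed
  have ev0: "(\<lambda>a. a \<odot>\<^bsub>P\<^esub> v0) \<in> LinearCombinations.module_hom A (regular_module A) P"
    by (rule module_homI)
       (auto simp: regular_module_def A_def[symmetric] v0 P.smult_closed[folded A_def]
         P.smult_l_distr[folded A_def] P.smult_assoc[folded A_def])
  obtain f where f: "f \<in> LinearCombinations.module_hom A Z P"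
    and fa: "\<forall>a\<in>carrier (regular_module A). f (J +>\<^bsub>regular_module A\<^esub> a) = a \<odot>\<^bsub>P\<^esub> v0"
    unfolding Z_def using Q.induced_hom[OF ev0 P' Jv0] by blast
  have "f z0 = \<one>\<^bsub>A\<^esub> \<odot>\<^bsub>P\<^esub> v0" unfolding z0_def v_def by (rule bspec[OF fa]) (simp add: rc)
  then have fz0: "f z0 = v0" using P.smult_one[folded A_def] v0(1) by simp
  have im: "f ` N = {\<zero>\<^bsub>P\<^esub>} \<or> f ` N = carrier P" if "Module.submodule N A Z" for N
    using P Z.image_submodule[folded A_def, OF f P' that] by (simp add: simple_left_module_def)
  have surj: "f ` carrier Z = carrier P"
    using im[OF Z.carrier_submodule[folded A_def]] z0 fz0 v0(2) by (metis imageI singletonD)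
  have max: "N \<subseteq> {x \<in> carrier Z. f x = \<zero>\<^bsub>P\<^esub>}"
    if N: "Module.submodule N A Z" and sN: "simple_left_module A (quotient_module Z N)" for N
  proof (rule ccontr)
    note N' = Z.submoduleD[folded A_def, OF N]
    assume "\<not> N \<subseteq> {x \<in> carrier Z. f x = \<zero>\<^bsub>P\<^esub>}"
    then have "f ` N \<noteq> {\<zero>\<^bsub>P\<^esub>}" using N'(1) by blast
    then have "f ` N = carrier P" using im[OF N] by blast
    then obtain n where n: "n \<in> N" "f n = v0" using v0(1) by (metis imageE)
    have nZ: "n \<in> carrier Z" using n N'(1) by blast
    obtain p c d where pcd: "d \<noteq> 0" "Z.act p n = Z.act (const c) z0" "Z.act p z0 = Z.act (const d) z0"
      using wt[folded Z_def z0_def, OF nZ] by blast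
    have fact: "f (Z.act r x) = P.act r (f x)" if "x \<in> carrier Z" for r x
      using LinearCombinations.module_hom_smult[OF f _ that, of "presented_class S r"] by (simp add: A_def)
    have "P.act (const c) v0 = P.act (const d) v0"
      using fact[OF z0, of "const c"] fact[OF z0, of "const d"] fact[OF nZ, of p] fact[OF z0, of p] pcd n fz0 by simp
    then have "c = d" by (rule P.act_const_inj[OF v0])
    then have "Z.act (const d) z0 \<in> N"
      using N'(4)[OF _ n(1), of "presented_class S p"] pcd(2) by (simp add: A_def)
    then have "Z.act (const (inverse d)) (Z.act (const d) z0) \<in> N"
      by (rule N'(4)[rotated]) (simp add: A_def)
    moreover have "Z.act (const (inverse d)) (Z.act (const d) z0) = z0"
      using pcd(1) by (simp add: Z.act_const_const z0)
    ultimately have z0N: "z0 \<in> N" by (simp only:)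
    have "N = carrier Z"
    proof
      show "carrier Z \<subseteq> N" using cyc N'(4)[OF _ z0N] by blast
    qed (rule N'(1))
    interpret QN: left_quotient A Z N using Zm N by (rule left_quotientI)
    have "N +>\<^bsub>Z\<^esub> x = N" if "x \<in> carrier Z" for x
      using QN.coset_eq_iff[OF that, of "\<zero>\<^bsub>Z\<^esub>"] \<open>N = carrier Z\<close> that QN.zero_coset by simp
    then have "carrier (quotient_module Z N) = {\<zero>\<^bsub>quotient_module Z N\<^esub>}"
      using Z.zero_closed by (auto simp: QN.quot_carrier)
    then show False using sN by (simp add: simple_left_module_def)
  qed
  show "isomorphic_modules A (unique_simple_quotient A (quotient_module (regular_module A) J)) P"
    and "left_module A (unique_simple_quotient A (quotient_module (regular_module A) J))"
    using unique_simple_quotient_iso[OF Zm P f surj max] unfolding Z_def by blast+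
qed


section \<open>Highest weight vectors\<close>

lemma const_uminus: "const (- b) = - const b"
  using const_add[of "- b" b] by (simp add: eq_neg_iff_add_eq_0)

context presented_module
begin

text \<open>The span of the words in the generators \<open>Low\<close> applied to \<open>v\<close>. For a Verma module these are the
lowering generators, and the span is the whole module.\<close>

inductive_set lspan :: "'g set \<Rightarrow> 'm \<Rightarrow> 'm set" for Low v where
  word: "set w \<subseteq> Low \<Longrightarrow> act (Poly_Mapping.single w c) v \<in> lspan Low v"
| add: "x \<in> lspan Low v \<Longrightarrow> y \<in> lspan Low v \<Longrightarrow> x \<oplus>\<^bsub>M\<^esub> y \<in> lspan Low v"

end

locale lowering_span = presented_module S M
  for S :: "('g, 'k::field) free_algebra set" and M :: "(('g, 'k) free_algebra set, 'm, 'z) module_scheme" +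
  fixes Low :: "'g set" and v :: 'm
  assumes v: "v \<in> carrier M"
begin

lemma lspan_carrier: "x \<in> lspan Low v \<Longrightarrow> x \<in> carrier M"
  by (induction rule: lspan.induct) (simp_all add: v)

lemma lspan_hom:
  assumes w: "\<And>w c. set w \<subseteq> Low \<Longrightarrow> act p (act (Poly_Mapping.single w c) v) \<in> lspan Low v"
    and x: "x \<in> lspan Low v"
  shows "act p x \<in> lspan Low v"
  using x
proof (induction rule: lspan.induct)
  case (word w c)
  then show ?case by (rule w)
next
  case (add x y)
  then show ?case by (simp add: act_radd lspan_carrier lspan.add)
qed

lemma lspan_const: "x \<in> lspan Low v \<Longrightarrow> act (const a) x \<in> lspan Low v"
proof (rule lspan_hom)
  fix w :: "'g list" and c assume "set w \<subseteq> Low"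
  then show "act (const a) (act (Poly_Mapping.single w c) v) \<in> lspan Low v"
    using lspan.word[of w Low "a * c" v] v by (simp add: const_single flip: act_mult)
qed

lemma lspan_low: "g \<in> Low \<Longrightarrow> x \<in> lspan Low v \<Longrightarrow> act (gen g) x \<in> lspan Low v"
proof (rule lspan_hom)
  fix w :: "'g list" and c assume "g \<in> Low" "set w \<subseteq> Low"
  then show "act (gen g) (act (Poly_Mapping.single w c) v) \<in> lspan Low v"
    using lspan.word[of "g # w" Low c v] v by (simp add: gen_single flip: act_mult)
qed

lemma lspan_self: "v \<in> lspan Low v"
proof -
  have "Poly_Mapping.single ([] :: 'g list) (1 :: 'k) = 1" using const_1 unfolding const_def .
  then show ?thesis using lspan.word[of "[]" Low 1 v] v by simp
qed

lemma lspan_all: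
  assumes g: "\<And>g x. x \<in> lspan Low v \<Longrightarrow> act (gen g) x \<in> lspan Low v"
  shows "act p v \<in> lspan Low v"
proof (induction p rule: free_algebra_induct)
  case (const a)
  show ?case by (rule lspan_const[OF lspan_self])
next
  case (add p r)
  then show ?case by (simp add: act_add[OF v] lspan.add)
next
  case (gen y p)
  show ?case unfolding act_mult[OF v] by (rule g[OF gen])
qed

end

text \<open>The vector \<open>v\<close> has weight \<open>q\<close>, and every generator \<open>g\<close> in \<open>Low\<close> lowers the weight by the factor
\<open>q ^ d g\<close>.\<close>

locale weight_generator = lowering_span S M Low v
  for S :: "('g, 'k::field) free_algebra set" and M :: "(('g, 'k) free_algebra set, 'm, 'z) module_scheme"
    and Low v +
  fixes k :: 'g and q :: 'k and d :: "'g \<Rightarrow> nat"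
  assumes q0: "q \<noteq> 0" and q_pow: "\<And>n. n > 0 \<Longrightarrow> q ^ n \<noteq> 1"
    and kv: "act (gen k) v = act (const q) v"
    and d: "\<And>g. g \<in> Low \<Longrightarrow> d g > 0"
    and low: "\<And>g x. g \<in> Low \<Longrightarrow> x \<in> carrier M \<Longrightarrow>
       act (gen k) (act (gen g) x) = act (const (inverse q ^ d g)) (act (gen g) (act (gen k) x))"
begin

lemma word_weight:
  assumes "set w \<subseteq> Low"
  shows "act (gen k) (act (Poly_Mapping.single w c) v)
    = act (const (q * inverse q ^ sum_list (map d w))) (act (Poly_Mapping.single w c) v)"
  using assms
proof (induction w)
  case Nil
  have "Poly_Mapping.single ([] :: 'g list) c = const c" by (simp add: const_def)
  then show ?case
    by (simp add: act_const_commute[OF v, of "gen k"] kv act_const_const[OF v] mult.commute)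
next
  case (Cons g w)
  let ?x = "act (Poly_Mapping.single w c) v"
  have x: "?x \<in> carrier M" by (simp add: v)
  have gx: "act (Poly_Mapping.single (g # w) c) v = act (gen g) ?x"
    by (simp only: gen_single[symmetric] act_mult[OF v])
  have "act (gen k) (act (gen g) ?x) = act (const (inverse q ^ d g)) (act (gen g) (act (gen k) ?x))"
    using Cons.prems by (intro low x) simp
  also have "act (gen k) ?x = act (const (q * inverse q ^ sum_list (map d w))) ?x"
    using Cons by simp
  finally show ?case unfolding gx act_const_commute[OF x, of "gen g"]
    by (simp add: act_const_const x power_add mult_ac)
qed

text \<open>This polynomial in \<open>k\<close> kills the weights \<open>q / q ^ i\<close> with \<open>0 < i \<le> n\<close>, but not the weight \<open>q\<close>.\<close>

primrec wt_poly :: "nat \<Rightarrow> ('g, 'k) free_algebra" where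
  "wt_poly 0 = 1"
| "wt_poly (Suc n) = (gen k - const (q * inverse q ^ Suc n)) * wt_poly n"

lemma act_minus_const:
  assumes "x \<in> carrier M" "act (gen k) x = act (const a) x"
  shows "act (gen k - const b) x = act (const (a - b)) x"
proof -
  have "act (gen k - const b) x = act (gen k) x \<oplus>\<^bsub>M\<^esub> act (const (- b)) x"
    by (simp only: diff_conv_add_uminus const_uminus[symmetric] act_add[OF assms(1)])
  also have "\<dots> = act (const (a - b)) x"
    by (simp only: diff_conv_add_uminus const_add act_add[OF assms(1)] assms(2))
  finally show ?thesis .
qed

lemma wt_poly_weight:
  assumes x: "x \<in> carrier M" "act (gen k) x = act (const a) x"
  shows "act (wt_poly n) x = act (const (\<Prod>i<n. a - q * inverse q ^ Suc i)) x"
proof (induction n)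
  case (Suc n)
  let ?b = "\<Prod>i<n. a - q * inverse q ^ Suc i"
  have "act (wt_poly (Suc n)) x = act (gen k - const (q * inverse q ^ Suc n)) (act (const ?b) x)"
    by (simp only: wt_poly.simps act_mult[OF x(1)] Suc)
  also have "\<dots> = act (const ?b) (act (const (a - q * inverse q ^ Suc n)) x)"
    by (simp only: act_const_commute[OF x(1), of "gen k - const (q * inverse q ^ Suc n)"] act_minus_const[OF x])
  finally show ?case by (simp add: act_const_const x(1) mult.commute)
qed (simp add: x(1))

text \<open>Asking for all large \<open>n\<close> lets one \<open>n\<close> serve both summands of a sum.\<close>

lemma lspan_weights:
  assumes "x \<in> lspan Low v"
  shows "\<exists>n0. \<forall>n\<ge>n0. \<exists>c. act (wt_poly n) x = act (const c) v"
  using assms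
proof (induction rule: lspan.induct)
  case (word w c)
  show ?case
  proof (cases "w = []")
    case True
    have "Poly_Mapping.single ([] :: 'g list) c = const c" by (simp add: const_def)
    then have "\<exists>e. act (wt_poly n) (act (Poly_Mapping.single w c) v) = act (const e) v" for n
      using wt_poly_weight[OF v kv, of n] act_const_commute[OF v, of "wt_poly n" c]
      by (auto simp: True act_const_const v)
    then show ?thesis by blast
  next
    case False
    let ?x = "act (Poly_Mapping.single w c) v" and ?N = "sum_list (map d w)"
    have x: "?x \<in> carrier M" by (simp add: v)
    obtain g w' where gw: "w = g # w'" using False by (cases w) auto
    then have N: "?N > 0" using d[of g] word by simp
    have "act (wt_poly n) ?x = act (const 0) v" if n: "n \<ge> ?N" for n
    proof -
      obtain m where m: "?N = Suc m" using N gr0_implies_Suc by blast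
      have "m \<in> {..<n}" using n m by simp
      moreover have "q * inverse q ^ ?N - q * inverse q ^ Suc m = 0" unfolding m by (rule diff_self)
      ultimately have "\<exists>i\<in>{..<n}. q * inverse q ^ ?N - q * inverse q ^ Suc i = 0" by blast
      then have z: "(\<Prod>i<n. q * inverse q ^ ?N - q * inverse q ^ Suc i) = 0"
        by (intro prod_zero) simp_all
      have "act (wt_poly n) ?x = act (const 0) ?x"
        using wt_poly_weight[OF x word_weight[OF word], of n] unfolding z .
      then show ?thesis using x v by simp
    qed
    then show ?thesis by blast
  qed
next
  case (add x y)
  then obtain n1 n2 where n: "\<forall>n\<ge>n1. \<exists>c. act (wt_poly n) x = act (const c) v"
    "\<forall>n\<ge>n2. \<exists>c. act (wt_poly n) y = act (const c) v" by blast
  have "\<exists>c. act (wt_poly n) (x \<oplus>\<^bsub>M\<^esub> y) = act (const c) v" if "n \<ge> max n1 n2" for n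
  proof -
    obtain c1 c2 where "act (wt_poly n) x = act (const c1) v" "act (wt_poly n) y = act (const c2) v"
      using n \<open>n \<ge> max n1 n2\<close> by (meson max.boundedE)
    then have "act (wt_poly n) (x \<oplus>\<^bsub>M\<^esub> y) = act (const (c1 + c2)) v"
      using add(1,2) by (simp add: act_radd lspan_carrier const_add act_add[OF v])
    then show ?thesis by blast
  qed
  then show ?case by blast
qed

lemma lspan_projection:
  assumes "x \<in> lspan Low v"
  shows "\<exists>p c e. e \<noteq> 0 \<and> act p x = act (const c) v \<and> act p v = act (const e) v"
proof -
  obtain n c where nc: "act (wt_poly n) x = act (const c) v" using lspan_weights[OF assms] by blast
  have "q - q * inverse q ^ Suc i \<noteq> 0" for i
  proof
    assume "q - q * inverse q ^ Suc i = 0"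
    then have "inverse (q ^ Suc i) = 1" using q0 by (simp add: power_inverse)
    then have "q ^ Suc i = 1" by (metis inverse_1 inverse_inverse_eq)
    then show False using q_pow[of "Suc i"] by simp
  qed
  then have "(\<Prod>i<n. q - q * inverse q ^ Suc i) \<noteq> 0" by (simp add: prod_zero_iff)
  then show ?thesis using nc wt_poly_weight[OF v kv, of n] by blast
qed

end


section \<open>The two-dimensional module\<close>

lemma free_map_superset:
  assumes "finite W" "Poly_Mapping.keys p \<subseteq> W"
  shows "free_map f p = (\<Sum>w\<in>W. Poly_Mapping.single (map f w) (Poly_Mapping.lookup p w))"
  unfolding free_map_def using assms by (intro sum.mono_neutral_left) (auto simp: in_keys_iff)

lemma free_map_add: "free_map f (p + r) = free_map f p + free_map f r"
proof -
  let ?W = "Poly_Mapping.keys p \<union> Poly_Mapping.keys r"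
  have "free_map f (p + r) = (\<Sum>w\<in>?W. Poly_Mapping.single (map f w) (Poly_Mapping.lookup (p + r) w))"
    by (rule free_map_superset) (use Poly_Mapping.keys_add[of p r] in auto)
  then show ?thesis
    by (simp add: free_map_superset[of ?W] lookup_add single_add sum.distrib)
qed

lemma free_map_single: "free_map f (Poly_Mapping.single w c) = Poly_Mapping.single (map f w) c"
  by (simp add: free_map_def)

lemma free_map_const [simp]: "free_map f (const c) = const c"
  by (simp add: const_def free_map_single)

lemma free_map_gen [simp]: "free_map f (gen g) = gen (f g)"
  by (simp add: gen_def free_map_single)

lemma free_map_0 [simp]: "free_map f 0 = 0" and free_map_1 [simp]: "free_map f 1 = 1"
  using free_map_const[of f 0] free_map_const[of f 1] by simp_all

lemma free_map_diff: "free_map f (p - r) = free_map f p - free_map f r"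
  using free_map_add[of f "p - r" r] by (simp add: eq_diff_eq)

lemma free_map_mult: "free_map f (p * r) = free_map f p * free_map f r"
proof (induction p rule: single_add_induct)
  case (single w c)
  show ?case
    by (induction r rule: single_add_induct)
       (simp_all add: free_map_single mult_single plus_list_def distrib_left free_map_add)
qed (simp add: distrib_right free_map_add)

lemma (in operator_space) word_eval_free_map: "word_eval T (free_map f p) v = word_eval (\<lambda>g. T (f g)) p v"
proof (induction p rule: single_add_induct)
  case (single w c)
  have "foldr T (map f w) v = foldr (\<lambda>g. T (f g)) w v" by (induction w) simp_all
  then show ?case by (simp add: free_map_single word_eval_single)
qed (simp add: free_map_add word_eval_add)

definition scale2 :: "'k::field \<Rightarrow> 'k \<times> 'k \<Rightarrow> 'k \<times> 'k" where
  "scale2 c v = (c * fst v, c * snd v)"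

interpretation plane: operator_space scale2
  by unfold_locales (auto simp: scale2_def algebra_simps)

fun uq_plane :: "'k::field \<Rightarrow> uq_gen \<Rightarrow> 'k \<times> 'k \<Rightarrow> 'k \<times> 'k" where
  "uq_plane q gE v = (snd v, 0)"
| "uq_plane q gF v = (0, fst v)"
| "uq_plane q gK v = (q * fst v, inverse q * snd v)"
| "uq_plane q gKinv v = (inverse q * fst v, q * snd v)"

text \<open>That \<open>X\<close> and \<open>Y\<close> may act as zero is due to the vanishing of \<open>C0\<close>, shown in \<open>uq_plane_C0\<close>.\<close>

fun osc_plane :: "'k::field \<Rightarrow> osc_gen \<Rightarrow> 'k \<times> 'k \<Rightarrow> 'k \<times> 'k" where
  "osc_plane q (Uq g) v = uq_plane q g v"
| "osc_plane q gX v = 0"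
| "osc_plane q gY v = 0"

lemma uq_plane_endo: "plane.endo (uq_plane q g)"
  by (cases g; rule plane.endoI) (auto simp: scale2_def algebra_simps)

lemma osc_plane_endo: "plane.endo (osc_plane q g)"
proof (cases g)
  case (Uq h)
  then show ?thesis using plane.endo_simps[OF uq_plane_endo[of q h]] by (intro plane.endoI) simp_all
qed (auto intro!: plane.endoI simp: scale2_def zero_prod_def)

lemma osc_plane_Uq: "plane.word_eval (osc_plane q) (free_map Uq p) v = plane.word_eval (uq_plane q) p v"
proof -
  have "(\<lambda>g. osc_plane q (Uq g)) = uq_plane q" by (intro ext) simp
  then show ?thesis unfolding plane.word_eval_free_map by simp
qed

definition osc_C0 :: "'k::field \<Rightarrow> (uq_gen, 'k) free_algebra" where
  "osc_C0 q = const ((q - inverse q) ^ 3) * casimir q - const ((q - inverse q) * (inverse q ^ 2 + q ^ 2))"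

lemmas plane_eval = plane.word_eval_add plane.word_eval_diff plane.word_eval_mult[OF uq_plane_endo] plane.word_eval_mult[OF osc_plane_endo]

lemma uq_plane_relations:
  assumes q: "q \<noteq> 0" "q - inverse q \<noteq> 0" and p: "p \<in> uq_relations q"
  shows "plane.word_eval (uq_plane q) p v = 0"
proof -
  obtain a b where v: "v = (a, b)" by (cases v)
  have "1 / (q - inverse q) * (q * a - inverse q * a) = a"
    "1 / (q - inverse q) * (inverse q * b - q * b) = - b"
    using q by (simp_all add: field_simps)
  then show ?thesis using p q(1) unfolding uq_relations_def Let_def v
    by (auto simp: plane_eval scale2_def zero_prod_def power2_eq_square)
qed

text \<open>The Casimir element acts as the scalar \<open>(q\<^sup>2 + 1/q\<^sup>2) / (q - 1/q)\<^sup>2\<close>: on \<open>(1, 0)\<close> only the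
terms in \<open>K\<close> contribute, and on \<open>(0, 1)\<close> the term \<open>F E\<close> supplies the difference to \<open>2 / (q - 1/q)\<^sup>2\<close>.\<close>

lemma uq_plane_C0:
  assumes q: "q \<noteq> 0" "q - inverse q \<noteq> 0"
  shows "plane.word_eval (uq_plane q) (osc_C0 q) v = 0"
proof -
  obtain a b where v: "v = (a, b)" by (cases v)
  define \<delta> where "\<delta> = q - inverse q"
  have \<delta>: "\<delta> \<noteq> 0" "\<delta> ^ 3 * (1 / \<delta> ^ 2) = \<delta>" using q by (simp_all add: \<delta>_def power3_eq_cube power2_eq_square)
  have sq: "\<delta> ^ 2 + 2 = inverse q ^ 2 + q ^ 2" using q by (simp add: \<delta>_def power2_eq_square algebra_simps)
  have 1: "\<delta> ^ 3 * (1 / \<delta> ^ 2 * (q * (q * a) + inverse q * (inverse q * a))) = \<delta> * (inverse q ^ 2 + q ^ 2) * a"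
    unfolding mult.assoc[symmetric, of "\<delta> ^ 3"] \<delta>(2) by (simp add: power2_eq_square algebra_simps)
  have 2: "\<delta> ^ 3 * (b + 1 / \<delta> ^ 2 * (q * (inverse q * b) + inverse q * (q * b))) = \<delta> * (inverse q ^ 2 + q ^ 2) * b"
  proof -
    have "\<delta> ^ 3 * (b + 1 / \<delta> ^ 2 * (q * (inverse q * b) + inverse q * (q * b)))
      = \<delta> ^ 3 * b + \<delta> ^ 3 * (1 / \<delta> ^ 2) * (2 * b)"
      using q(1) by (simp add: distrib_left mult.assoc)
    also have "\<dots> = \<delta> * (\<delta> ^ 2 + 2) * b" unfolding \<delta>(2) by (simp add: power3_eq_cube power2_eq_square algebra_simps)
    finally show ?thesis unfolding sq .
  qed
  show ?thesis using 1 2 unfolding osc_C0_def casimir_def v \<delta>_def[symmetric]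
    by (simp add: plane_eval scale2_def zero_prod_def)
qed

lemma osc_plane_relations:
  assumes q: "q \<noteq> 0" "q - inverse q \<noteq> 0" and p: "p \<in> osc_relations q (uq_class q (osc_C0 q))"
  shows "plane.word_eval (osc_plane q) p v = 0"
proof -
  note S = plane.endo_simps(3)[OF osc_plane_endo]
  have C: "plane.word_eval (uq_plane q) c v = 0" if "c \<in> uq_class q (osc_C0 q)" for c
  proof -
    have "Idl\<^bsub>class_ring\<^esub> (uq_relations q) \<subseteq> {p. \<forall>v. plane.word_eval (uq_plane q) p v = 0}"
      by (rule relations_ideal_least[OF _ plane.word_eval_annihilator_ideal[OF uq_plane_endo]]) (use uq_plane_relations[OF q] in blast)
    then have "plane.word_eval (uq_plane q) (c - osc_C0 q) v = 0" using that unfolding uq_class_def in_cls by blast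
    then show ?thesis by (simp add: plane.word_eval_diff uq_plane_C0[OF q])
  qed
  from p consider r where "r \<in> uq_relations q" "p = free_map Uq r"
    | "p \<in> {gen (Uq gE) * gen gX - const q * gen gX * gen (Uq gE),
       gen (Uq gE) * gen gY - (gen gX + const (inverse q) * gen gY * gen (Uq gE)),
       gen (Uq gF) * gen gX - (gen gY * gen (Uq gKinv) + gen gX * gen (Uq gF)),
       gen (Uq gF) * gen gY - gen gY * gen (Uq gF),
       gen (Uq gK) * gen gX * gen (Uq gKinv) - const q * gen gX,
       gen (Uq gK) * gen gY * gen (Uq gKinv) - const (inverse q) * gen gY}"
    | c where "c \<in> uq_class q (osc_C0 q)" "p = const q * gen gY * gen gX - gen gX * gen gY - free_map Uq c"
    unfolding osc_relations_def Let_def by blast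
  then show ?thesis
  proof cases
    case 1
    then show ?thesis by (simp add: osc_plane_Uq uq_plane_relations[OF q])
  next
    case 2
    then show ?thesis by (auto simp: plane_eval scale2_def zero_prod_def)
  next
    case 3
    then show ?thesis by (simp add: plane_eval osc_plane_Uq C scale2_def zero_prod_def)
  qed
qed

lemma plane_simple:
  fixes T :: "'g \<Rightarrow> 'k::field \<times> 'k \<Rightarrow> 'k \<times> 'k"
  assumes T: "\<And>g. plane.endo (T g)" and S: "\<And>p v. p \<in> S \<Longrightarrow> plane.word_eval T p v = 0"
    and e: "\<And>v. T e v = (snd v, 0)" and f: "\<And>v. T f v = (0, fst v)"
  shows "simple_left_module (presented_algebra S) (plane.rep_module T)"
proof -
  have L: "left_module (presented_algebra S) (plane.rep_module T)" by (rule plane.rep_left_module[OF T S])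
  interpret L: presented_module S "plane.rep_module T" using L by (simp add: presented_module_def)
  note sm = plane.rep_module_smult[of T S, OF T S]
  have "N = {\<zero>\<^bsub>plane.rep_module T\<^esub>} \<or> N = carrier (plane.rep_module T)"
    if N: "Module.submodule N (presented_algebra S) (plane.rep_module T)" for N
  proof (cases "N = {0}")
    case False
    note N' = L.submoduleD[OF N]
    have word_eval: "plane.word_eval T p x \<in> N" if "x \<in> N" for p x
      using N'(4)[OF _ that, of "presented_class S p"] by (simp add: sm)
    have "0 \<in> N" using N'(2) by simp
    with False obtain a b where ab: "(a, b) \<in> N" "(a, b) \<noteq> 0" by (metis insertI1 surj_pair subsetI subset_singletonD insert_absorb singletonI subset_antisym empty_iff insert_subset)
    have "\<exists>a. a \<noteq> 0 \<and> (a, 0) \<in> N"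
    proof (cases "b = 0")
      case True
      then show ?thesis using ab by (auto simp: zero_prod_def)
    next
      case False
      then show ?thesis using word_eval[OF ab(1), of "gen e"] by (auto simp: e)
    qed
    then obtain a where a: "a \<noteq> 0" "(a, 0) \<in> N" by blast
    have "(x, y) \<in> N" for x y
    proof -
      have "(x, 0) \<in> N" using word_eval[OF a(2), of "const (x / a)"] a(1) by (simp add: scale2_def)
      moreover have "(0, a) \<in> N" using word_eval[OF a(2), of "gen f"] by (simp add: f)
      then have "(0, y) \<in> N" using word_eval[of "(0, a)" "const (y / a)"] a(1) by (simp add: scale2_def)
      ultimately show ?thesis using N'(3)[of "(x, 0)" "(0, y)"] by simp
    qed
    then show ?thesis by auto
  qed simp
  moreover have "carrier (plane.rep_module T) \<noteq> {\<zero>\<^bsub>plane.rep_module T\<^esub>}"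
  proof -
    have "(1, 0) \<noteq> (0 :: 'k \<times> 'k)" by (simp add: zero_prod_def)
    then show ?thesis by auto
  qed
  ultimately show ?thesis using L by (simp add: simple_left_module_def)
qed


section \<open>Verma modules and their simple quotients\<close>

text \<open>Names for the generators of quantum sl(2) inside an arbitrary presented algebra, so that modules
over \<open>uq_algebra\<close> and over \<open>osc_algebra\<close> are covered together.\<close>

locale sl2_module = presented_module S M
  for S :: "('g, 'k::field) free_algebra set" and M :: "(('g, 'k) free_algebra set, 'm, 'z) module_scheme" +
  fixes q :: 'k and e f k ki :: 'g
  assumes q0: "q \<noteq> 0" and q_pow: "\<And>n. n > 0 \<Longrightarrow> q ^ n \<noteq> 1"
    and rels: "x \<in> carrier M \<Longrightarrow> act (gen k * gen ki - 1) x = \<zero>\<^bsub>M\<^esub>"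
      "x \<in> carrier M \<Longrightarrow> act (gen ki * gen k - 1) x = \<zero>\<^bsub>M\<^esub>"
      "x \<in> carrier M \<Longrightarrow> act (gen k * gen e * gen ki - const (q ^ 2) * gen e) x = \<zero>\<^bsub>M\<^esub>"
      "x \<in> carrier M \<Longrightarrow> act (gen k * gen f * gen ki - const (inverse q ^ 2) * gen f) x = \<zero>\<^bsub>M\<^esub>"
      "x \<in> carrier M \<Longrightarrow> act (gen e * gen f - gen f * gen e - const (1 / (q - inverse q)) * (gen k - gen ki)) x = \<zero>\<^bsub>M\<^esub>"
begin

lemma act_diff_0:
  assumes "x \<in> carrier M" "act (p - r) x = \<zero>\<^bsub>M\<^esub>" shows "act p x = act r x"
proof -
  have "act p x = act (p - r) x \<oplus>\<^bsub>M\<^esub> act r x" using act_add[OF assms(1), of "p - r" r] by simp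
  then show ?thesis using assms by simp
qed

lemma K_Ki: "x \<in> carrier M \<Longrightarrow> act (gen k) (act (gen ki) x) = x"
  using act_diff_0[OF _ rels(1), of x] by (simp add: act_mult)

lemma Ki_K: "x \<in> carrier M \<Longrightarrow> act (gen ki) (act (gen k) x) = x"
  using act_diff_0[OF _ rels(2), of x] by (simp add: act_mult)

lemma K_conj:
  assumes x: "x \<in> carrier M"
    and r: "\<And>x. x \<in> carrier M \<Longrightarrow> act (gen k * gen g * gen ki - const c * gen g) x = \<zero>\<^bsub>M\<^esub>"
  shows "act (gen k) (act (gen g) x) = act (const c) (act (gen g) (act (gen k) x))"
proof -
  have y: "act (gen k) x \<in> carrier M" using x by simp
  have "act (gen k * gen g * gen ki) (act (gen k) x) = act (const c * gen g) (act (gen k) x)"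
    by (rule act_diff_0[OF y r[OF y]])
  then show ?thesis by (simp add: act_mult y Ki_K x)
qed

lemma K_E: "x \<in> carrier M \<Longrightarrow> act (gen k) (act (gen e) x) = act (const (q ^ 2)) (act (gen e) (act (gen k) x))"
  by (rule K_conj) (auto intro: rels)

lemma K_F: "x \<in> carrier M \<Longrightarrow> act (gen k) (act (gen f) x) = act (const (inverse q ^ 2)) (act (gen f) (act (gen k) x))"
  by (rule K_conj) (auto intro: rels)

lemma E_F:
  assumes x: "x \<in> carrier M"
  shows "act (gen e) (act (gen f) x) = act (gen f) (act (gen e) x)
    \<oplus>\<^bsub>M\<^esub> act (const (1 / (q - inverse q))) (act (gen k) x \<oplus>\<^bsub>M\<^esub> act (const (-1)) (act (gen ki) x))"
proof -
  have eq: "gen k - gen ki = gen k + const (- 1) * gen ki" by (simp add: const_uminus)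
  have "act (const (1 / (q - inverse q)) * (gen k - gen ki)) x
    = act (const (1 / (q - inverse q))) (act (gen k) x \<oplus>\<^bsub>M\<^esub> act (const (-1)) (act (gen ki) x))"
    unfolding eq using x by (simp add: act_mult act_add)
  moreover have "act (gen e * gen f) x = act (gen f * gen e + const (1 / (q - inverse q)) * (gen k - gen ki)) x"
    by (rule act_diff_0[OF x]) (use rels(5)[OF x] in \<open>simp add: diff_diff_eq\<close>)
  ultimately show ?thesis using act_add[OF x] act_mult[OF x] by metis
qed

lemma Ki_weight:
  assumes x: "x \<in> carrier M" "act (gen k) x = act (const a) x" and a: "a \<noteq> 0"
  shows "act (gen ki) x = act (const (inverse a)) x"
proof -
  have "act (const a) (act (gen ki) x) = x"
    using x Ki_K[OF x(1)] by (simp add: act_const_commute[OF x(1), of "gen ki"])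
  then have "act (const (inverse a)) x = act (const (inverse a)) (act (const a) (act (gen ki) x))" by simp
  then show ?thesis using x(1) a by (simp add: act_const_const)
qed

end

lemma left_ideal3:
  fixes R (structure)
  assumes "ring R" "x \<in> carrier R" "y \<in> carrier R" "z \<in> carrier R"
  shows "Module.submodule {a \<otimes>\<^bsub>R\<^esub> x \<oplus>\<^bsub>R\<^esub> b \<otimes>\<^bsub>R\<^esub> y \<oplus>\<^bsub>R\<^esub> c \<otimes>\<^bsub>R\<^esub> z | a b c.
    a \<in> carrier R \<and> b \<in> carrier R \<and> c \<in> carrier R} R (regular_module R)" (is "Module.submodule ?J R _")
proof -
  interpret ring R by fact
  interpret L: left_module R "regular_module R" by (rule regular_left_module[OF assms(1)])
  show ?thesis
  proof (rule L.submoduleI)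
    show "?J \<subseteq> carrier (regular_module R)"
      using assms(2-4) by (auto simp: regular_module_def)
    have "\<zero> = \<zero> \<otimes> x \<oplus> \<zero> \<otimes> y \<oplus> \<zero> \<otimes> z" using assms(2-4) by simp
    then show "\<zero>\<^bsub>regular_module R\<^esub> \<in> ?J"
      by (force simp: regular_module_def)
  next
    fix u w assume "u \<in> ?J" "w \<in> ?J"
    then obtain a b c a' b' c' where ab: "a \<in> carrier R" "b \<in> carrier R" "c \<in> carrier R" "u = a \<otimes> x \<oplus> b \<otimes> y \<oplus> c \<otimes> z"
      "a' \<in> carrier R" "b' \<in> carrier R" "c' \<in> carrier R" "w = a' \<otimes> x \<oplus> b' \<otimes> y \<oplus> c' \<otimes> z" by blast
    then have "u \<oplus> w = (a \<oplus> a') \<otimes> x \<oplus> (b \<oplus> b') \<otimes> y \<oplus> (c \<oplus> c') \<otimes> z"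
      using assms(2-4) by (simp add: l_distr a_ac)
    moreover have "a \<oplus> a' \<in> carrier R" "b \<oplus> b' \<in> carrier R" "c \<oplus> c' \<in> carrier R" using ab by simp_all
    ultimately show "u \<oplus>\<^bsub>regular_module R\<^esub> w \<in> ?J"
      unfolding regular_module_def by auto
  next
    fix d u assume "d \<in> carrier R" "u \<in> ?J"
    then obtain a b c where ab: "d \<in> carrier R" "a \<in> carrier R" "b \<in> carrier R" "c \<in> carrier R"
      "u = a \<otimes> x \<oplus> b \<otimes> y \<oplus> c \<otimes> z" by blast
    then have "d \<otimes> u = (d \<otimes> a) \<otimes> x \<oplus> (d \<otimes> b) \<otimes> y \<oplus> (d \<otimes> c) \<otimes> z"
      using assms(2-4) by (simp add: r_distr m_assoc)
    moreover have "d \<otimes> a \<in> carrier R" "d \<otimes> b \<in> carrier R" "d \<otimes> c \<in> carrier R" using ab by simp_all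
    ultimately show "d \<odot>\<^bsub>regular_module R\<^esub> u \<in> ?J"
      unfolding regular_module_def by auto
  qed
qed

lemma left_ideal2:
  assumes "ring R" "x \<in> carrier R" "y \<in> carrier R"
  shows "Module.submodule {a \<otimes>\<^bsub>R\<^esub> x \<oplus>\<^bsub>R\<^esub> b \<otimes>\<^bsub>R\<^esub> y | a b. a \<in> carrier R \<and> b \<in> carrier R} R (regular_module R)"
proof -
  interpret R: ring R by fact
  have "a \<otimes>\<^bsub>R\<^esub> x \<oplus>\<^bsub>R\<^esub> b \<otimes>\<^bsub>R\<^esub> y \<oplus>\<^bsub>R\<^esub> c \<otimes>\<^bsub>R\<^esub> \<zero>\<^bsub>R\<^esub> = a \<otimes>\<^bsub>R\<^esub> x \<oplus>\<^bsub>R\<^esub> b \<otimes>\<^bsub>R\<^esub> y"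
    if "a \<in> carrier R" "b \<in> carrier R" "c \<in> carrier R" for a b c
    using that assms by simp
  then have "{a \<otimes>\<^bsub>R\<^esub> x \<oplus>\<^bsub>R\<^esub> b \<otimes>\<^bsub>R\<^esub> y \<oplus>\<^bsub>R\<^esub> c \<otimes>\<^bsub>R\<^esub> \<zero>\<^bsub>R\<^esub> | a b c.
      a \<in> carrier R \<and> b \<in> carrier R \<and> c \<in> carrier R}
    = {a \<otimes>\<^bsub>R\<^esub> x \<oplus>\<^bsub>R\<^esub> b \<otimes>\<^bsub>R\<^esub> y | a b. a \<in> carrier R \<and> b \<in> carrier R}"
    using R.zero_closed by (intro Collect_cong) metis
  then show ?thesis using left_ideal3[OF assms R.zero_closed] by (simp only:)
qed

lemma uq_relations_mem:
  "gen gK * gen gKinv - 1 \<in> uq_relations q" "gen gKinv * gen gK - 1 \<in> uq_relations q"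
  "gen gK * gen gE * gen gKinv - const (q ^ 2) * gen gE \<in> uq_relations q"
  "gen gK * gen gF * gen gKinv - const (inverse q ^ 2) * gen gF \<in> uq_relations q"
  "gen gE * gen gF - gen gF * gen gE - const (1 / (q - inverse q)) * (gen gK - gen gKinv) \<in> uq_relations q"
  unfolding uq_relations_def Let_def by blast+

lemma uq_sl2_module:
  assumes "left_module (uq_algebra q) M" "q \<noteq> 0" "\<And>n. n > 0 \<Longrightarrow> q ^ n \<noteq> 1"
  shows "sl2_module (uq_relations q) M q gE gF gK gKinv"
proof -
  interpret presented_module "uq_relations q" M
    using assms(1) by (simp add: presented_module_def uq_algebra_def)
  show ?thesis
    by unfold_locales (rule assms(2) assms(3) act_rel[OF _ uq_relations_mem(1)] act_rel[OF _ uq_relations_mem(2)]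
        act_rel[OF _ uq_relations_mem(3)] act_rel[OF _ uq_relations_mem(4)] act_rel[OF _ uq_relations_mem(5)]; assumption)+
qed

lemma osc_sl2_module:
  assumes "left_module (osc_algebra q C0) M" "q \<noteq> 0" "\<And>n. n > 0 \<Longrightarrow> q ^ n \<noteq> 1"
  shows "sl2_module (osc_relations q C0) M q (Uq gE) (Uq gF) (Uq gK) (Uq gKinv)"
proof -
  interpret presented_module "osc_relations q C0" M
    using assms(1) by (simp add: presented_module_def osc_algebra_def)
  have "free_map Uq ` uq_relations q \<subseteq> osc_relations q C0" by (auto simp: osc_relations_def Let_def)
  then have r: "act (free_map Uq p) x = \<zero>\<^bsub>M\<^esub>" if "p \<in> uq_relations q" "x \<in> carrier M" for p x
    using act_rel[OF that(2)] that(1) by blast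
  note fm = free_map_diff free_map_mult free_map_gen free_map_const free_map_1
  show ?thesis
    by unfold_locales (rule assms(2) assms(3) r[OF uq_relations_mem(1), unfolded fm]
        r[OF uq_relations_mem(2), unfolded fm] r[OF uq_relations_mem(3), unfolded fm]
        r[OF uq_relations_mem(4), unfolded fm] r[OF uq_relations_mem(5), unfolded fm]; assumption)+
qed


lemma (in presented_module) act_diff':
  assumes "x \<in> carrier M" shows "act (p - r) x = act p x \<oplus>\<^bsub>M\<^esub> act (const (-1)) (act r x)"
proof -
  have "p - r = p + const (- 1) * r" by (simp add: const_uminus)
  then show ?thesis using assms by (simp only: act_add act_mult)
qed

lemma (in left_module) mult_kills:
  assumes "a \<in> carrier R" "x \<in> carrier R" "m \<in> carrier M" "x \<odot>\<^bsub>M\<^esub> m = \<zero>\<^bsub>M\<^esub>"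
  shows "(a \<otimes>\<^bsub>R\<^esub> x) \<odot>\<^bsub>M\<^esub> m = \<zero>\<^bsub>M\<^esub>"
  using assms by (simp add: smult_assoc)

lemma (in left_module) add_kills:
  assumes "x \<in> carrier R" "y \<in> carrier R" "m \<in> carrier M" "x \<odot>\<^bsub>M\<^esub> m = \<zero>\<^bsub>M\<^esub>" "y \<odot>\<^bsub>M\<^esub> m = \<zero>\<^bsub>M\<^esub>"
  shows "(x \<oplus>\<^bsub>R\<^esub> y) \<odot>\<^bsub>M\<^esub> m = \<zero>\<^bsub>M\<^esub>"
  using assms by (simp add: smult_l_distr)

text \<open>The generator is the coset of \<open>\<one>\<close>, on which \<open>a\<close> acts by sending it to the coset of \<open>a\<close>.\<close>

lemma cyclic_generator:
  fixes S :: "('g, 'k::field) free_algebra set" and J :: "('g, 'k) free_algebra set set"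
  defines "A \<equiv> presented_algebra S"
  defines "Z \<equiv> quotient_module (regular_module A) J"
  defines "v \<equiv> a_r_coset (regular_module A) J \<one>\<^bsub>A\<^esub>"
  assumes J: "Module.submodule J A (regular_module A)"
  shows "left_module A Z" "v \<in> carrier Z"
    "\<And>z. z \<in> carrier Z \<Longrightarrow> \<exists>p. z = presented_class S p \<odot>\<^bsub>Z\<^esub> v"
    "\<And>p. presented_class S p \<in> J \<Longrightarrow> presented_class S p \<odot>\<^bsub>Z\<^esub> v = \<zero>\<^bsub>Z\<^esub>"
proof -
  have R: "ring A" unfolding A_def by (rule alg_ring)
  interpret A: ring A by fact
  interpret Q: left_quotient A "regular_module A" J using regular_left_module[OF R] J by (rule left_quotientI)
  have rc: "carrier (regular_module A) = carrier A" by (simp add: regular_module_def)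
  show "left_module A Z" unfolding Z_def by (rule Q.left_module_quotient)
  show "v \<in> carrier Z" unfolding v_def Z_def by (simp add: Q.quot_carrier rc)
  have gen: "J +>\<^bsub>regular_module A\<^esub> a = a \<odot>\<^bsub>Z\<^esub> v" if "a \<in> carrier A" for a
  proof -
    have "a \<odot>\<^bsub>Z\<^esub> v = J +>\<^bsub>regular_module A\<^esub> (a \<odot>\<^bsub>regular_module A\<^esub> \<one>\<^bsub>A\<^esub>)"
      unfolding v_def Z_def by (rule Q.coset_smult) (simp_all add: that rc)
    then show ?thesis using that by (simp add: regular_module_def)
  qed
  show "\<exists>p. z = presented_class S p \<odot>\<^bsub>Z\<^esub> v" if "z \<in> carrier Z" for z
  proof -
    from that obtain a where a: "a \<in> carrier A" "z = J +>\<^bsub>regular_module A\<^esub> a"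
      unfolding Z_def by (auto simp: Q.quot_carrier rc)
    then obtain p where "a = presented_class S p" unfolding A_def by (auto simp: alg_carrier)
    then show ?thesis using gen[OF a(1)] a(2) by blast
  qed
  show "presented_class S p \<odot>\<^bsub>Z\<^esub> v = \<zero>\<^bsub>Z\<^esub>" if p: "presented_class S p \<in> J" for p
  proof -
    have pc: "presented_class S p \<in> carrier A" by (simp add: A_def)
    have "J +>\<^bsub>regular_module A\<^esub> presented_class S p = J"
      using Q.N.a_rcos_const[OF p] .
    then show ?thesis using gen[OF pc] by (simp add: Z_def)
  qed
qed

locale sl2_highest = sl2_module S M q e f k ki + weight_generator S M Low v k q d
  for S :: "('g, 'k::field) free_algebra set" and M :: "(('g, 'k) free_algebra set, 'm, 'z) module_scheme"
    and q e f k ki Low v d +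
  assumes f_Low: "f \<in> Low" and word_eval: "act (gen e) v = \<zero>\<^bsub>M\<^esub>"
begin

lemma lspan_zero: "\<zero>\<^bsub>M\<^esub> \<in> lspan Low v"
  using lspan_const[OF lspan_self, of 0] v by simp

lemma lspan_k: "x \<in> lspan Low v \<Longrightarrow> act (gen k) x \<in> lspan Low v"
proof (erule lspan_hom[rotated])
  fix w c assume w: "set w \<subseteq> Low"
  show "act (gen k) (act (Poly_Mapping.single w c) v) \<in> lspan Low v"
    unfolding word_weight[OF w] by (intro lspan_const lspan.word w)
qed

lemma lspan_ki: "x \<in> lspan Low v \<Longrightarrow> act (gen ki) x \<in> lspan Low v"
proof (erule lspan_hom[rotated])
  fix w c assume w: "set w \<subseteq> Low"
  have "act (gen ki) (act (Poly_Mapping.single w c) v)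
    = act (const (inverse (q * inverse q ^ sum_list (map d w)))) (act (Poly_Mapping.single w c) v)"
    by (rule Ki_weight[OF _ word_weight[OF w]]) (use v q0 in simp_all)
  then show "act (gen ki) (act (Poly_Mapping.single w c) v) \<in> lspan Low v"
    by (simp only: lspan_const lspan.word w)
qed

text \<open>\<open>E F x = F E x + (K x - Ki x) / (q - 1/q)\<close>, so \<open>E\<close> passes \<open>F\<close> at the cost of terms in \<open>K\<close>.\<close>

lemma lspan_e_f:
  assumes "x \<in> lspan Low v" "act (gen e) x \<in> lspan Low v"
  shows "act (gen e) (act (gen f) x) \<in> lspan Low v"
  unfolding E_F[OF lspan_carrier[OF assms(1)]]
  by (intro lspan.add lspan_const lspan_k lspan_ki lspan_low f_Low assms)

lemma lspan_nil:
  assumes "act (gen g) v = \<zero>\<^bsub>M\<^esub>"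
  shows "act (gen g) (act (Poly_Mapping.single [] c) v) \<in> lspan Low v"
proof -
  have "Poly_Mapping.single ([] :: 'g list) c = const c" by (simp add: const_def)
  then show ?thesis using act_const_commute[OF v, of "gen g" c] assms lspan_zero by simp
qed

lemma word_Cons: "act (Poly_Mapping.single (g # w) c) v = act (gen g) (act (Poly_Mapping.single w c) v)"
  by (simp only: gen_single[symmetric] act_mult[OF v])

end

lemma (in sl2_module) sl2_highestI:
  assumes "v \<in> carrier M" "act (gen e) v = \<zero>\<^bsub>M\<^esub>" "act (gen k) v = act (const q) v" "f \<in> Low"
    and "\<And>g. g \<in> Low \<Longrightarrow> d g > 0"
    and "\<And>g x. g \<in> Low \<Longrightarrow> x \<in> carrier M \<Longrightarrow>
       act (gen k) (act (gen g) x) = act (const (inverse q ^ d g)) (act (gen g) (act (gen k) x))"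
  shows "sl2_highest S M q e f k ki Low v d"
  by unfold_locales (rule assms q0 q_pow; assumption)+

text \<open>The span of the vectors \<open>F ^ n v\<close> is stable under \<open>E\<close>, hence it is the whole Verma module, and
\<open>cyclic_simple_quotient\<close> applies to the plane with \<open>v0 = (1, 0)\<close>.\<close>

lemma uq_simple_plane:
  fixes q :: "'k::field"
  assumes q0: "q \<noteq> 0" and q_pow: "\<And>n. n > 0 \<Longrightarrow> q ^ n \<noteq> 1"
  shows "isomorphic_modules (uq_algebra q) (uq_simple q q) (plane.rep_module (uq_plane q))"
    and "left_module (uq_algebra q) (uq_simple q q)"
proof -
  have qi: "q - inverse q \<noteq> 0"
    using q_pow[of 2] q0 by (auto simp: power2_eq_square field_simps)
  define S where "S = uq_relations q"
  define A where "A = presented_algebra S"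
  have UA: "uq_algebra q = A" by (simp add: uq_algebra_def A_def S_def)
  define E Kr where "E = presented_class S (gen gE)" and "Kr = presented_class S (gen gK - const q)"
  define J where "J = {a \<otimes>\<^bsub>A\<^esub> E \<oplus>\<^bsub>A\<^esub> b \<otimes>\<^bsub>A\<^esub> Kr | a b. a \<in> carrier A \<and> b \<in> carrier A}"
  define Z where "Z = quotient_module (regular_module A) J"
  have ver: "uq_verma q q = Z"
    by (simp add: uq_verma_def Let_def Z_def J_def UA E_def Kr_def uq_class_def S_def)
  define v where "v = a_r_coset (regular_module A) J \<one>\<^bsub>A\<^esub>"
  have R: "ring A" unfolding A_def by (rule alg_ring)
  interpret A: ring A by fact
  have EKr: "E \<in> carrier A" "Kr \<in> carrier A" by (simp_all add: E_def Kr_def A_def)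
  have J: "Module.submodule J A (regular_module A)" unfolding J_def by (rule left_ideal2[OF R EKr])
  have EJ: "E \<in> J" unfolding J_def using EKr
    by (intro CollectI exI[of _ "\<one>\<^bsub>A\<^esub>"] exI[of _ "\<zero>\<^bsub>A\<^esub>"]) simp
  have KrJ: "Kr \<in> J" unfolding J_def using EKr
    by (intro CollectI exI[of _ "\<zero>\<^bsub>A\<^esub>"] exI[of _ "\<one>\<^bsub>A\<^esub>"]) simp
  note cyc = cyclic_generator[OF J[unfolded A_def], folded A_def, folded Z_def v_def]
  interpret Z: sl2_module S Z q gE gF gK gKinv
    unfolding S_def by (rule uq_sl2_module[OF _ q0 q_pow]) (simp_all add: UA cyc(1))
  have Ev: "Z.act (gen gE) v = \<zero>\<^bsub>Z\<^esub>" by (rule cyc(4)) (use EJ in \<open>simp add: E_def\<close>)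
  have Kv: "Z.act (gen gK) v = Z.act (const q) v"
    by (rule Z.act_diff_0[OF cyc(2) cyc(4)]) (use KrJ in \<open>simp add: Kr_def\<close>)
  interpret Z: sl2_highest S Z q gE gF gK gKinv "{gF}" v "\<lambda>_. 2"
  proof (rule Z.sl2_highestI[OF cyc(2) Ev Kv])
    fix g x assume "g \<in> {gF}" and x: "x \<in> carrier Z"
    then have g: "g = gF" by simp
    show "Z.act (gen gK) (Z.act (gen g) x) = Z.act (const (inverse q ^ 2)) (Z.act (gen g) (Z.act (gen gK) x))"
      unfolding g by (rule Z.K_F[OF x])
  qed simp_all
  have e: "Z.act (gen gE) x \<in> Z.lspan {gF} v" if "x \<in> Z.lspan {gF} v" for x
  proof (rule Z.lspan_hom[OF _ that])
    fix w c assume "set w \<subseteq> {gF}"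
    then show "Z.act (gen gE) (Z.act (Poly_Mapping.single w c) v) \<in> Z.lspan {gF} v"
    proof (induction w)
      case Nil
      show ?case by (rule Z.lspan_nil[OF Ev])
    next
      case (Cons g w)
      then show ?case unfolding Z.word_Cons by (auto intro!: Z.lspan_e_f Z.lspan.word)
    qed
  qed
  have all: "Z.act (gen g) x \<in> Z.lspan {gF} v" if "x \<in> Z.lspan {gF} v" for g x
    by (cases g) (simp_all add: e Z.lspan_k Z.lspan_ki Z.lspan_low that)
  have wt: "\<exists>p c d. d \<noteq> 0 \<and> Z.act p z = Z.act (const c) v \<and> Z.act p v = Z.act (const d) v"
    if z: "z \<in> carrier Z" for z
  proof -
    obtain r where r: "z = Z.act r v" using cyc(3)[OF z] by blast
    have "z \<in> Z.lspan {gF} v" unfolding r by (rule Z.lspan_all[OF all])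
    then show ?thesis by (rule Z.lspan_projection)
  qed
  note rel = uq_plane_relations[OF q0 qi, folded S_def]
  let ?P = "plane.rep_module (uq_plane q)"
  have P: "simple_left_module A ?P" unfolding A_def
    by (rule plane_simple[OF uq_plane_endo rel, where e = gE and f = gF]) simp_all
  then interpret P: left_module A ?P by (simp add: simple_left_module_def)
  note sm = plane.rep_module_smult[of "uq_plane q" S, OF uq_plane_endo rel]
  have v0: "(1, 0) \<in> carrier ?P" "(1, 0) \<noteq> \<zero>\<^bsub>?P\<^esub>" by (simp_all add: zero_prod_def)
  have Jv0: "a \<odot>\<^bsub>?P\<^esub> (1, 0) = \<zero>\<^bsub>?P\<^esub>" if aJ: "a \<in> J" for a
  proof -
    have "E \<odot>\<^bsub>?P\<^esub> (1, 0) = \<zero>\<^bsub>?P\<^esub>" "Kr \<odot>\<^bsub>?P\<^esub> (1, 0) = \<zero>\<^bsub>?P\<^esub>"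
      by (simp_all add: E_def Kr_def sm plane_eval scale2_def zero_prod_def)
    moreover obtain x y where "a = x \<otimes>\<^bsub>A\<^esub> E \<oplus>\<^bsub>A\<^esub> y \<otimes>\<^bsub>A\<^esub> Kr" "x \<in> carrier A" "y \<in> carrier A"
      using aJ unfolding J_def by blast
    ultimately show ?thesis
      using P.add_kills[OF _ _ v0(1)] P.mult_kills[OF _ _ v0(1)] EKr by (metis A.m_closed)
  qed
  note CSQ = cyclic_simple_quotient[of J S ?P "(1, 0)", folded A_def, OF J P v0]
  have "isomorphic_modules A (unique_simple_quotient A Z) ?P"
    unfolding Z_def by (rule CSQ(1)) (rule Jv0 wt[unfolded Z_def v_def], assumption)+
  then show "isomorphic_modules (uq_algebra q) (uq_simple q q) ?P"
    unfolding uq_simple_def UA ver .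
  have "left_module A (unique_simple_quotient A Z)"
    unfolding Z_def by (rule CSQ(2)) (rule Jv0 wt[unfolded Z_def v_def], assumption)+
  then show "left_module (uq_algebra q) (uq_simple q q)"
    unfolding uq_simple_def UA ver .
qed

text \<open>Here the words in \<open>F\<close> and \<open>Y\<close> span the Verma module. Stability under \<open>E\<close> and under \<open>X\<close> has to be
shown simultaneously by induction on words: moving \<open>E\<close> past \<open>Y\<close> produces \<open>X\<close>, and moving \<open>X\<close> past \<open>Y\<close>
produces \<open>C0\<close>, which contains \<open>F E\<close>.\<close>

lemma osc_simple_plane:
  fixes q :: "'k::field"
  assumes q0: "q \<noteq> 0" and q_pow: "\<And>n. n > 0 \<Longrightarrow> q ^ n \<noteq> 1"
  defines "C0 \<equiv> uq_class q (osc_C0 q)"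
  shows "isomorphic_modules (osc_algebra q C0) (osc_simple q C0 q) (plane.rep_module (osc_plane q))"
    and "left_module (osc_algebra q C0) (osc_simple q C0 q)"
proof -
  have qi: "q - inverse q \<noteq> 0"
    using q_pow[of 2] q0 by (auto simp: power2_eq_square field_simps)
  define S where "S = osc_relations q C0"
  define A where "A = presented_algebra S"
  have UA: "osc_algebra q C0 = A" by (simp add: osc_algebra_def A_def S_def)
  define E X Kr where "E = presented_class S (gen (Uq gE))" and "X = presented_class S (gen gX)"
    and "Kr = presented_class S (gen (Uq gK) - const q)"
  define J where "J = {a \<otimes>\<^bsub>A\<^esub> E \<oplus>\<^bsub>A\<^esub> b \<otimes>\<^bsub>A\<^esub> X \<oplus>\<^bsub>A\<^esub> c \<otimes>\<^bsub>A\<^esub> Kr | a b c.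
    a \<in> carrier A \<and> b \<in> carrier A \<and> c \<in> carrier A}"
  define Z where "Z = quotient_module (regular_module A) J"
  have ver: "osc_verma q C0 q = Z"
    by (simp add: osc_verma_def Let_def Z_def J_def UA E_def X_def Kr_def osc_class_def S_def)
  define v where "v = a_r_coset (regular_module A) J \<one>\<^bsub>A\<^esub>"
  have R: "ring A" unfolding A_def by (rule alg_ring)
  interpret A: ring A by fact
  have EKr: "E \<in> carrier A" "X \<in> carrier A" "Kr \<in> carrier A" by (simp_all add: E_def X_def Kr_def A_def)
  have J: "Module.submodule J A (regular_module A)" unfolding J_def by (rule left_ideal3[OF R EKr])
  have EJ: "E \<in> J" unfolding J_def using EKr
    by (intro CollectI exI[of _ "\<one>\<^bsub>A\<^esub>"] exI[of _ "\<zero>\<^bsub>A\<^esub>"]) simp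
  have XJ: "X \<in> J" unfolding J_def using EKr
    by (intro CollectI exI[of _ "\<zero>\<^bsub>A\<^esub>"] exI[of _ "\<one>\<^bsub>A\<^esub>"]) simp
  have KrJ: "Kr \<in> J" unfolding J_def using EKr
    by (intro CollectI exI[of _ "\<zero>\<^bsub>A\<^esub>"] exI[of _ "\<one>\<^bsub>A\<^esub>"]) simp
  note cyc = cyclic_generator[OF J[unfolded A_def], folded A_def, folded Z_def v_def]
  interpret Z: sl2_module S Z q "Uq gE" "Uq gF" "Uq gK" "Uq gKinv"
    unfolding S_def by (rule osc_sl2_module[OF _ q0 q_pow]) (simp_all add: UA cyc(1))
  have Ev: "Z.act (gen (Uq gE)) v = \<zero>\<^bsub>Z\<^esub>" by (rule cyc(4)) (use EJ in \<open>simp add: E_def\<close>)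
  have Xv: "Z.act (gen gX) v = \<zero>\<^bsub>Z\<^esub>" by (rule cyc(4)) (use XJ in \<open>simp add: X_def\<close>)
  have Kv: "Z.act (gen (Uq gK)) v = Z.act (const q) v"
    by (rule Z.act_diff_0[OF cyc(2) cyc(4)]) (use KrJ in \<open>simp add: Kr_def\<close>)
  have mem: "gen (Uq gE) * gen gY - (gen gX + const (inverse q) * gen gY * gen (Uq gE)) \<in> S"
    "gen (Uq gF) * gen gX - (gen gY * gen (Uq gKinv) + gen gX * gen (Uq gF)) \<in> S"
    "gen (Uq gK) * gen gY * gen (Uq gKinv) - const (inverse q) * gen gY \<in> S"
    unfolding S_def osc_relations_def Let_def by blast+
  have c0: "osc_C0 q \<in> C0" unfolding C0_def uq_class_def by (rule cls_self)
  have mem4: "const q * gen gY * gen gX - gen gX * gen gY - free_map Uq (osc_C0 q) \<in> S"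
    unfolding S_def osc_relations_def Let_def using c0 by blast
  have K_Y: "Z.act (gen (Uq gK)) (Z.act (gen gY) x) = Z.act (const (inverse q)) (Z.act (gen gY) (Z.act (gen (Uq gK)) x))"
    if "x \<in> carrier Z" for x
    by (rule Z.K_conj[OF that Z.act_rel[OF _ mem(3)]])
  define Low :: "osc_gen set" where "Low = {Uq gF, gY}"
  define d :: "osc_gen \<Rightarrow> nat" where "d g = (if g = gY then 1 else 2)" for g
  interpret Z: sl2_highest S Z q "Uq gE" "Uq gF" "Uq gK" "Uq gKinv" Low v d
  proof (rule Z.sl2_highestI[OF cyc(2) Ev Kv])
    fix g x assume "g \<in> Low" and x: "x \<in> carrier Z"
    then have "g = Uq gF \<or> g = gY" by (simp add: Low_def)
    then show "Z.act (gen (Uq gK)) (Z.act (gen g) x)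
      = Z.act (const (inverse q ^ d g)) (Z.act (gen g) (Z.act (gen (Uq gK)) x))"
    proof
      assume g: "g = Uq gF"
      have "d g = 2" by (simp add: d_def g)
      then show ?thesis using Z.K_F[OF x] by (simp only: g)
    next
      assume g: "g = gY"
      have "inverse q ^ d g = inverse q" by (simp add: d_def g)
      then show ?thesis using K_Y[OF x] by (simp only: g)
    qed
  qed (simp_all add: Low_def d_def)
  have low: "Uq gF \<in> Low" "gY \<in> Low" by (simp_all add: Low_def)
  note L = Z.lspan.add Z.lspan_const Z.lspan_k Z.lspan_ki Z.lspan_low[OF low(1)] Z.lspan_low[OF low(2)]
  have E_Y: "Z.act (gen (Uq gE)) (Z.act (gen gY) x) = Z.act (gen gX) x \<oplus>\<^bsub>Z\<^esub>
      Z.act (const (inverse q)) (Z.act (gen gY) (Z.act (gen (Uq gE)) x))" if x: "x \<in> carrier Z" for x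
    using Z.act_eq_of_rel[OF x mem(1)] x by (simp add: Z.act_mult Z.act_add)
  have X_F: "Z.act (gen gX) (Z.act (gen (Uq gF)) x) = Z.act (gen (Uq gF)) (Z.act (gen gX) x) \<oplus>\<^bsub>Z\<^esub>
      Z.act (const (-1)) (Z.act (gen gY) (Z.act (gen (Uq gKinv)) x))" if x: "x \<in> carrier Z" for x
  proof -
    have "gen (Uq gF) * gen gX - gen gY * gen (Uq gKinv) - gen gX * gen (Uq gF) \<in> S"
      using mem(2) by (simp add: diff_diff_eq)
    then show ?thesis
      using Z.act_eq_of_rel[OF x] Z.act_diff'[OF x] x by (metis Z.act_mult)
  qed
  have X_Y: "Z.act (gen gX) (Z.act (gen gY) x) = Z.act (const q) (Z.act (gen gY) (Z.act (gen gX) x)) \<oplus>\<^bsub>Z\<^esub>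
      Z.act (const (-1)) (Z.act (free_map Uq (osc_C0 q)) x)" if x: "x \<in> carrier Z" for x
  proof -
    have "const q * gen gY * gen gX - free_map Uq (osc_C0 q) - gen gX * gen gY \<in> S"
      using mem4 by (simp add: diff_diff_eq add.commute)
    then have "Z.act (gen gX * gen gY) x = Z.act (const q * gen gY * gen gX - free_map Uq (osc_C0 q)) x"
      using Z.act_eq_of_rel[OF x] by metis
    then show ?thesis using Z.act_diff'[OF x] x by (simp add: Z.act_mult)
  qed
  have C0: "Z.act (free_map Uq (osc_C0 q)) x \<in> Z.lspan Low v"
    if "x \<in> Z.lspan Low v" "Z.act (gen (Uq gE)) x \<in> Z.lspan Low v" for x
  proof -
    have x: "x \<in> carrier Z" using that(1) by (rule Z.lspan_carrier)
    show ?thesis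
      unfolding osc_C0_def casimir_def free_map_diff free_map_mult free_map_add free_map_gen free_map_const
      using x by (simp only: Z.act_diff' Z.act_mult Z.act_add Z.act_closed) (intro L that)
  qed
  have ex: "Z.act (gen (Uq gE)) (Z.act (Poly_Mapping.single w c) v) \<in> Z.lspan Low v
      \<and> Z.act (gen gX) (Z.act (Poly_Mapping.single w c) v) \<in> Z.lspan Low v" if "set w \<subseteq> Low" for w c
    using that
  proof (induction w)
    case Nil
    show ?case using Z.lspan_nil[OF Ev] Z.lspan_nil[OF Xv] by blast
  next
    case (Cons g w)
    define x where "x = Z.act (Poly_Mapping.single w c) v"
    have w: "set w \<subseteq> Low" using Cons.prems by simp
    have x: "x \<in> Z.lspan Low v" unfolding x_def by (rule Z.lspan.word[OF w])
    have xc: "x \<in> carrier Z" by (rule Z.lspan_carrier[OF x])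
    have IH: "Z.act (gen (Uq gE)) x \<in> Z.lspan Low v" "Z.act (gen gX) x \<in> Z.lspan Low v"
      using Cons.IH[OF w] by (simp_all add: x_def)
    have "g = Uq gF \<or> g = gY" using Cons.prems by (auto simp: Low_def)
    then show ?case unfolding Z.word_Cons x_def[symmetric]
    proof
      assume g: "g = Uq gF"
      show "Z.act (gen (Uq gE)) (Z.act (gen g) x) \<in> Z.lspan Low v \<and> Z.act (gen gX) (Z.act (gen g) x) \<in> Z.lspan Low v"
        unfolding g X_F[OF xc] by (intro conjI Z.lspan_e_f L x IH)
    next
      assume g: "g = gY"
      show "Z.act (gen (Uq gE)) (Z.act (gen g) x) \<in> Z.lspan Low v \<and> Z.act (gen gX) (Z.act (gen g) x) \<in> Z.lspan Low v"
        unfolding g X_Y[OF xc] E_Y[OF xc] by (intro conjI L x IH C0)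
    qed
  qed
  have e: "Z.act (gen (Uq gE)) x \<in> Z.lspan Low v" if "x \<in> Z.lspan Low v" for x
    by (rule Z.lspan_hom[OF _ that]) (use ex in blast)
  have X: "Z.act (gen gX) x \<in> Z.lspan Low v" if "x \<in> Z.lspan Low v" for x
    by (rule Z.lspan_hom[OF _ that]) (use ex in blast)
  have all: "Z.act (gen g) x \<in> Z.lspan Low v" if "x \<in> Z.lspan Low v" for g x
  proof (cases g)
    case (Uq h)
    then show ?thesis by (cases h) (simp_all add: e Z.lspan_k Z.lspan_ki Z.lspan_low low that)
  qed (simp_all add: X Z.lspan_low low that)
  have wt: "\<exists>p c d. d \<noteq> 0 \<and> Z.act p z = Z.act (const c) v \<and> Z.act p v = Z.act (const d) v"
    if z: "z \<in> carrier Z" for z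
  proof -
    obtain r where r: "z = Z.act r v" using cyc(3)[OF z] by blast
    have "z \<in> Z.lspan Low v" unfolding r by (rule Z.lspan_all[OF all])
    then show ?thesis by (rule Z.lspan_projection)
  qed
  note rel = osc_plane_relations[OF q0 qi, folded C0_def, folded S_def]
  let ?P = "plane.rep_module (osc_plane q)"
  have P: "simple_left_module A ?P" unfolding A_def
    by (rule plane_simple[OF osc_plane_endo rel, where e = "Uq gE" and f = "Uq gF"]) simp_all
  then interpret P: left_module A ?P by (simp add: simple_left_module_def)
  note sm = plane.rep_module_smult[of "osc_plane q" S, OF osc_plane_endo rel]
  have v0: "(1, 0) \<in> carrier ?P" "(1, 0) \<noteq> \<zero>\<^bsub>?P\<^esub>" by (simp_all add: zero_prod_def)
  have Jv0: "a \<odot>\<^bsub>?P\<^esub> (1, 0) = \<zero>\<^bsub>?P\<^esub>" if aJ: "a \<in> J" for a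
  proof -
    have "E \<odot>\<^bsub>?P\<^esub> (1, 0) = \<zero>\<^bsub>?P\<^esub>" "X \<odot>\<^bsub>?P\<^esub> (1, 0) = \<zero>\<^bsub>?P\<^esub>" "Kr \<odot>\<^bsub>?P\<^esub> (1, 0) = \<zero>\<^bsub>?P\<^esub>"
      by (simp_all add: E_def X_def Kr_def sm plane_eval scale2_def zero_prod_def)
    moreover obtain x y z where "a = x \<otimes>\<^bsub>A\<^esub> E \<oplus>\<^bsub>A\<^esub> y \<otimes>\<^bsub>A\<^esub> X \<oplus>\<^bsub>A\<^esub> z \<otimes>\<^bsub>A\<^esub> Kr"
      "x \<in> carrier A" "y \<in> carrier A" "z \<in> carrier A"
      using aJ unfolding J_def by blast
    ultimately show ?thesis
      using P.add_kills[OF _ _ v0(1)] P.mult_kills[OF _ _ v0(1)] EKr by (metis A.m_closed A.add.m_closed)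
  qed
  note CSQ = cyclic_simple_quotient[of J S ?P "(1, 0)", folded A_def, OF J P v0]
  have "isomorphic_modules A (unique_simple_quotient A Z) ?P"
    unfolding Z_def by (rule CSQ(1)) (rule Jv0 wt[unfolded Z_def v_def], assumption)+
  then show "isomorphic_modules (osc_algebra q C0) (osc_simple q C0 q) ?P"
    unfolding osc_simple_def UA ver .
  have "left_module A (unique_simple_quotient A Z)"
    unfolding Z_def by (rule CSQ(2)) (rule Jv0 wt[unfolded Z_def v_def], assumption)+
  then show "left_module (osc_algebra q C0) (osc_simple q C0 q)"
    unfolding osc_simple_def UA ver .
qed


text \<open>The map of generators carries relations to relations, so the cosets in the union coincide.\<close>

lemma uq_to_osc_class:
  "uq_to_osc q C0 (uq_class q p) = osc_class q C0 (free_map Uq p)"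
proof -
  let ?I = "Idl\<^bsub>class_ring\<^esub> (osc_relations q C0)"
  let ?J = "{p. free_map Uq p \<in> ?I}"
  have "ideal ?J class_ring"
    unfolding class_ring_ideal
    by (auto simp: free_map_add free_map_mult relations_ideal_0 relations_ideal_add relations_ideal_mult)
  moreover have "uq_relations q \<subseteq> ?J"
    using relations_ideal_self[of _ "osc_relations q C0"] by (auto simp: osc_relations_def Let_def)
  ultimately have J: "Idl\<^bsub>class_ring\<^esub> (uq_relations q) \<subseteq> ?J" by (rule relations_ideal_least[rotated])
  have "osc_class q C0 (free_map Uq r) = osc_class q C0 (free_map Uq p)" if "r \<in> uq_class q p" for r
  proof -
    have "r - p \<in> ?J" using that J unfolding uq_class_def in_cls by blast
    then show ?thesis by (simp add: osc_class_def cls_eq_iff free_map_diff)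
  qed
  then have "\<forall>r\<in>uq_class q p. osc_class q C0 (free_map Uq r) = osc_class q C0 (free_map Uq p)" by blast
  moreover have "p \<in> uq_class q p" unfolding uq_class_def by (rule cls_self)
  ultimately show ?thesis unfolding uq_to_osc_def by (metis (no_types, lifting) UN_constant_eq)
qed

lemma restrict_scalars_simps [simp]:
  "carrier (restrict_scalars h M) = carrier M" "zero (restrict_scalars h M) = zero M"
  "add (restrict_scalars h M) = add M" "smult (restrict_scalars h M) s = smult M (h s)"
  by (simp_all add: restrict_scalars_def)

lemma osc_simple_restricts:
  fixes q :: "'k::field"
  assumes q0: "q \<noteq> 0" and q_pow: "\<And>n. n > 0 \<Longrightarrow> q ^ n \<noteq> 1"
  defines "C0 \<equiv> uq_class q (osc_C0 q)"
  shows "isomorphic_modules (uq_algebra q) (restrict_scalars (uq_to_osc q C0) (osc_simple q C0 q)) (uq_simple q q)"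
proof -
  have qi: "q - inverse q \<noteq> 0"
    using q_pow[of 2] q0 by (auto simp: power2_eq_square field_simps)
  let ?V = "osc_simple q C0 q"
  let ?P = "plane.rep_module (osc_plane q)" and ?Q = "plane.rep_module (uq_plane q)"
  have V: "isomorphic_modules (osc_algebra q C0) ?V ?P"
    unfolding C0_def by (rule osc_simple_plane(1)[OF q0 q_pow])
  then obtain f where f: "f \<in> LinearCombinations.module_hom (osc_algebra q C0) ?V ?P"
    and bij: "bij_betw f (carrier ?V) (carrier ?P)"
    unfolding isomorphic_modules_def by blast
  have "f \<in> LinearCombinations.module_hom (uq_algebra q) (restrict_scalars (uq_to_osc q C0) ?V) ?Q"
  proof (rule module_homI)
    fix x y assume "x \<in> carrier (restrict_scalars (uq_to_osc q C0) ?V)" "y \<in> carrier (restrict_scalars (uq_to_osc q C0) ?V)"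
    then have "f (x \<oplus>\<^bsub>?V\<^esub> y) = f x \<oplus>\<^bsub>?P\<^esub> f y"
      using LinearCombinations.module_hom_add[OF f] by simp
    then show "f (x \<oplus>\<^bsub>restrict_scalars (uq_to_osc q C0) ?V\<^esub> y) = f x \<oplus>\<^bsub>?Q\<^esub> f y" by simp
  next
    fix u x assume u: "u \<in> carrier (uq_algebra q)" and "x \<in> carrier (restrict_scalars (uq_to_osc q C0) ?V)"
    then have x: "x \<in> carrier ?V" by simp
    obtain p where p: "u = uq_class q p"
      using u unfolding uq_algebra_def uq_class_def by (auto simp: alg_carrier)
    have c: "osc_class q C0 (free_map Uq p) \<in> carrier (osc_algebra q C0)"
      by (simp add: osc_algebra_def osc_class_def)
    have "f (osc_class q C0 (free_map Uq p) \<odot>\<^bsub>?V\<^esub> x) = osc_class q C0 (free_map Uq p) \<odot>\<^bsub>?P\<^esub> f x"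
      by (rule LinearCombinations.module_hom_smult[OF f c x])
    also have "\<dots> = plane.word_eval (osc_plane q) (free_map Uq p) (f x)"
      unfolding osc_class_def C0_def
      by (rule plane.rep_module_smult[OF osc_plane_endo osc_plane_relations[OF q0 qi]])
    also have "\<dots> = plane.word_eval (uq_plane q) p (f x)" by (rule osc_plane_Uq)
    also have "\<dots> = u \<odot>\<^bsub>?Q\<^esub> f x"
      unfolding p uq_class_def
      by (rule plane.rep_module_smult[OF uq_plane_endo uq_plane_relations[OF q0 qi], symmetric])
    finally show "f (u \<odot>\<^bsub>restrict_scalars (uq_to_osc q C0) ?V\<^esub> x) = u \<odot>\<^bsub>?Q\<^esub> f x"
      by (simp add: p uq_to_osc_class)
  qed simp
  moreover have "bij_betw f (carrier (restrict_scalars (uq_to_osc q C0) ?V)) (carrier ?Q)" using bij by simp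
  ultimately have "isomorphic_modules (uq_algebra q) (restrict_scalars (uq_to_osc q C0) ?V) ?Q"
    unfolding isomorphic_modules_def by blast
  moreover have "isomorphic_modules (uq_algebra q) ?Q (uq_simple q q)"
    by (rule isomorphic_sym[OF uq_simple_plane[OF q0 q_pow]])
  ultimately show ?thesis by (rule isomorphic_trans)
qed

lemma osc_vectorspace:
  assumes "left_module (osc_algebra q C0) M"
  shows "vectorspace class_ring (osc_vector_space q C0 M)"
proof -
  interpret presented_module "osc_relations q C0" M
    using assms by (simp add: presented_module_def osc_algebra_def)
  have ag: "abelian_group (osc_vector_space q C0 M)"
    using M.abelian_group_axioms unfolding osc_vector_space_def
    by (intro abelian_groupI)
       (auto simp: M.a_ac intro!: bexI[of _ "\<ominus>\<^bsub>M\<^esub> _"] M.l_neg)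
  have "Module.module class_ring (osc_vector_space q C0 M)"
    by (intro Module.module.intro Module.module_axioms.intro ag class_cring.is_cring)
       (auto simp: osc_vector_space_def osc_class_def const_add act_add act_radd const_mult[symmetric] act_mult)
  then show ?thesis using class_field by (simp add: vectorspace_def)
qed

lemma osc_simple_dim:
  fixes q :: "'k::field"
  assumes q0: "q \<noteq> 0" and q_pow: "\<And>n. n > 0 \<Longrightarrow> q ^ n \<noteq> 1"
  defines "C0 \<equiv> uq_class q (osc_C0 q)"
  shows "vectorspace.fin_dim class_ring (osc_vector_space q C0 (osc_simple q C0 q))"
    and "vectorspace.dim class_ring (osc_vector_space q C0 (osc_simple q C0 q)) = 2"
proof -
  have qi: "q - inverse q \<noteq> 0"
    using q_pow[of 2] q0 by (auto simp: power2_eq_square field_simps)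
  define V where "V = osc_simple q C0 q"
  define W where "W = osc_vector_space q C0 V"
  let ?P = "plane.rep_module (osc_plane q)"
  have LV: "left_module (osc_algebra q C0) V"
    unfolding V_def C0_def by (rule osc_simple_plane(2)[OF q0 q_pow])
  interpret V: presented_module "osc_relations q C0" V
    using LV by (simp add: presented_module_def osc_algebra_def)
  interpret W: vectorspace class_ring W unfolding W_def by (rule osc_vectorspace[OF LV])
  have "isomorphic_modules (osc_algebra q C0) V ?P"
    unfolding V_def C0_def by (rule osc_simple_plane(1)[OF q0 q_pow])
  then obtain f where f: "f \<in> LinearCombinations.module_hom (osc_algebra q C0) V ?P"
    and bij: "bij_betw f (carrier V) (carrier ?P)"
    unfolding isomorphic_modules_def by blast
  have WV: "carrier W = carrier V" "add W = add V" "zero W = zero V"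
    "c \<odot>\<^bsub>W\<^esub> x = V.act (const c) x" for c x
    by (simp_all add: W_def osc_vector_space_def osc_class_def)
  have f_add: "f (x \<oplus>\<^bsub>V\<^esub> y) = f x + f y" if "x \<in> carrier V" "y \<in> carrier V" for x y
    using LinearCombinations.module_hom_add[OF f that] by simp
  have f_const: "f (V.act (const c) x) = scale2 c (f x)" if "x \<in> carrier V" for c x
  proof -
    have "f (V.act (const c) x) = presented_class (osc_relations q C0) (const c) \<odot>\<^bsub>?P\<^esub> f x"
      by (rule LinearCombinations.module_hom_smult[OF f _ that]) (simp add: osc_algebra_def)
    also have "\<dots> = plane.word_eval (osc_plane q) (const c) (f x)" unfolding C0_def
      by (rule plane.rep_module_smult[OF osc_plane_endo osc_plane_relations[OF q0 qi]])
    finally show ?thesis by simp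
  qed
  have inj: "inj_on f (carrier V)" and surj: "f ` carrier V = UNIV" using bij by (simp_all add: bij_betw_def)
  obtain e1 where e1: "e1 \<in> carrier V" "f e1 = (1, 0)" using surj by (metis UNIV_I imageE)
  obtain e2 where e2: "e2 \<in> carrier V" "f e2 = (0, 1)" using surj by (metis UNIV_I imageE)
  have ne: "e1 \<noteq> e2" using e1(2) e2(2) by auto
  have lc: "W.lincomb a {e1, e2} = V.act (const (a e1)) e1 \<oplus>\<^bsub>V\<^esub> V.act (const (a e2)) e2" for a
  proof -
    have "W.lincomb a {e1, e2} = a e1 \<odot>\<^bsub>W\<^esub> e1 \<oplus>\<^bsub>W\<^esub> (a e2 \<odot>\<^bsub>W\<^esub> e2 \<oplus>\<^bsub>W\<^esub> \<zero>\<^bsub>W\<^esub>)"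
      unfolding W.lincomb_def using ne e1(1) e2(1)
      by (subst W.finsum_insert, (simp_all add: WV)[4], subst W.finsum_insert) (simp_all add: WV)
    then show ?thesis using e1(1) e2(1) by (simp add: WV)
  qed
  have flc: "f (W.lincomb a {e1, e2}) = (a e1, a e2)" for a
    unfolding lc using e1 e2 by (simp add: f_add f_const scale2_def)
  have "W.basis {e1, e2}"
  proof (subst W.basis_criterion)
    show "{e1, e2} \<subseteq> carrier W" using e1 e2 by (simp add: WV)
    show "\<forall>v. v \<in> carrier W \<longrightarrow> (\<exists>!a. a \<in> {e1, e2} \<rightarrow>\<^sub>E carrier class_ring \<and> W.lincomb a {e1, e2} = v)"
    proof (intro allI impI)
      fix v assume "v \<in> carrier W"
      then have v: "v \<in> carrier V" by (simp add: WV)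
      define a where "a = (\<lambda>x\<in>{e1, e2}. if x = e1 then fst (f v) else snd (f v))"
      have lcV: "W.lincomb b {e1, e2} \<in> carrier V" for b unfolding lc using e1 e2 by simp
      have "f (W.lincomb a {e1, e2}) = f v" unfolding flc using ne by (simp add: a_def)
      then have av: "W.lincomb a {e1, e2} = v" using inj lcV v by (auto dest: inj_onD)
      show "\<exists>!a. a \<in> {e1, e2} \<rightarrow>\<^sub>E carrier class_ring \<and> W.lincomb a {e1, e2} = v"
      proof (rule ex1I[of _ a])
        show "a \<in> {e1, e2} \<rightarrow>\<^sub>E carrier class_ring \<and> W.lincomb a {e1, e2} = v"
          using av by (auto simp: a_def)
        fix b assume b: "b \<in> {e1, e2} \<rightarrow>\<^sub>E carrier class_ring \<and> W.lincomb b {e1, e2} = v"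
        then have "(b e1, b e2) = (a e1, a e2)" using flc[of a] flc[of b] av by simp
        then show "b = a" using b by (auto simp: a_def PiE_def extensional_def fun_eq_iff)
      qed
    qed
  qed simp
  then have "W.basis {e1, e2}" .
  then show "vectorspace.dim class_ring (osc_vector_space q C0 (osc_simple q C0 q)) = 2"
    using W.dim_basis[of "{e1, e2}"] ne unfolding W_def V_def by simp
  show "vectorspace.fin_dim class_ring (osc_vector_space q C0 (osc_simple q C0 q))"
    using \<open>W.basis {e1, e2}\<close> unfolding W_def[symmetric] V_def[symmetric] W.fin_dim_def W.basis_def
    by (intro exI[of _ "{e1, e2}"]) simp
qed


section \<open>Decomposition along the kernel of E\<close>

context osc_operators
begin

text \<open>The component of \<open>v\<close> in the kernel of \<open>E\<close>, the other one being \<open>F (E v)\<close>.\<close>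

definition top_part :: "'b \<Rightarrow> 'b" where "top_part v = v - F (E v)"

definition ker_E :: "'b set" where "ker_E = {v \<in> S. E v = 0}"

lemma ker_E_subspace: "subspace ker_E"
  using S(1) unfolding ker_E_def subspace_def by (auto simp: lin)

lemma E_in_ker: "v \<in> S \<Longrightarrow> E v \<in> ker_E"
  unfolding ker_E_def using E_S E_E by blast

lemma E_F_E: "v \<in> S \<Longrightarrow> E (F (E v)) = E v"
  using E_F_ker_E[OF E_S E_E] .

lemma top_part_in_ker: "v \<in> S \<Longrightarrow> top_part v \<in> ker_E"
  unfolding ker_E_def top_part_def
  using S(1) E_F_E[of v] by (simp add: lin subspace_diff F_S E_S)

lemma endo_top: "endo top_part"
  by (rule endoI) (simp_all add: top_part_def lin scale_right_diff_distrib)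

lemma top_part_plus: "v = top_part v + F (E v)"
  by (simp add: top_part_def)

lemma ker_E_D: "v \<in> ker_E \<Longrightarrow> v \<in> S" "v \<in> ker_E \<Longrightarrow> E v = 0"
  by (simp_all add: ker_E_def)

lemma top_part_ker: "v \<in> ker_E \<Longrightarrow> top_part v = v"
  by (simp add: top_part_def ker_E_D lin)

lemma E_F:
  assumes "v \<in> S" shows "E (F v) = top_part v"
proof -
  have "F v = F (top_part v)" using F_F[OF E_S[OF assms]] by (simp add: top_part_def lin)
  then show ?thesis using E_F_ker_E ker_E_D[OF top_part_in_ker[OF assms]] by simp
qed

lemma top_part_F:
  assumes "v \<in> S" shows "top_part (F v) = 0"
proof -
  have "top_part (F v) = F v - F (top_part v)" unfolding top_part_def[of "F v"] E_F[OF assms] ..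
  also have "\<dots> = F (F (E v))" by (simp add: top_part_def lin)
  finally show ?thesis using F_F[OF E_S[OF assms]] by simp
qed

lemma top_part_E: "v \<in> S \<Longrightarrow> top_part (E v) = E v"
  by (rule top_part_ker[OF E_in_ker])

lemma K_decomposition:
  assumes v: "v \<in> S"
  shows "K v = q *s top_part v + inverse q *s F (E v)" "L v = inverse q *s top_part v + q *s F (E v)"
proof -
  note t = ker_E_D[OF top_part_in_ker[OF v]] and e = ker_E_D[OF E_in_ker[OF v]]
  have "K v = K (top_part v) + K (F (E v))" unfolding top_part_def by (simp add: lin)
  then show K: "K v = q *s top_part v + inverse q *s F (E v)"
    using K_ker_E[OF t] K_F_ker_E[OF e] by simp
  have tS: "top_part v \<in> S" "F (E v) \<in> S" using t e F_S by blast+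
  have "L (F (E v)) = q *s F (E v)"
  proof -
    have "L (K (F (E v))) = inverse q *s L (F (E v))" using K_F_ker_E[OF e] by (simp add: lin)
    then have "F (E v) = inverse q *s L (F (E v))" using LK[OF tS(2)] by simp
    then have "q *s F (E v) = q *s (inverse q *s L (F (E v)))" by (rule arg_cong)
    then show ?thesis using q0 by simp
  qed
  moreover have "L v = L (top_part v) + L (F (E v))" unfolding top_part_def by (simp add: lin)
  ultimately show "L v = inverse q *s top_part v + q *s F (E v)" using L_ker_E[OF t] by simp
qed

lemma top_part_K: "v \<in> S \<Longrightarrow> top_part (K v) = q *s top_part v"
  and E_K: "v \<in> S \<Longrightarrow> E (K v) = inverse q *s E v"
  and top_part_L: "v \<in> S \<Longrightarrow> top_part (L v) = inverse q *s top_part v"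
  and E_L: "v \<in> S \<Longrightarrow> E (L v) = q *s E v"
  using top_part_F[OF E_S] top_part_ker[OF top_part_in_ker] ker_E_D(2)[OF top_part_in_ker] E_F_E
  by (simp_all add: K_decomposition lin endo_simps[OF endo_top])

lemma decomposition_unique:
  assumes "a \<in> ker_E" "b \<in> ker_E"
  shows "top_part (a + F b) = a" "E (a + F b) = b" "a + F b \<in> S"
proof -
  note a = ker_E_D[OF assms(1)] and b = ker_E_D[OF assms(2)]
  show "top_part (a + F b) = a"
    by (simp add: endo_simps[OF endo_top] top_part_ker[OF assms(1)] top_part_F[OF b(1)])
  show "E (a + F b) = b" by (simp add: lin a(2) E_F_ker_E[OF b])
  show "a + F b \<in> S" using S(1) a(1) b(1) by (intro subspace_add F_S)
qed

lemma finite_independent: "B \<subseteq> S \<Longrightarrow> independent B \<Longrightarrow> finite B"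
  using independent_span_bound[OF S(3), of B] S(2) by blast

text \<open>A basis of the kernel of \<open>E\<close>, in the form of its coordinate functionals \<open>\<psi> i\<close> with \<open>i < n\<close>.\<close>

lemma ker_E_coordinates:
  "\<exists>(n::nat) \<psi>. (\<forall>i. \<forall>u\<in>ker_E. \<forall>v\<in>ker_E. \<psi> i (u + v) = \<psi> i u + (\<psi> i v :: 'a))
    \<and> (\<forall>i c. \<forall>u\<in>ker_E. \<psi> i (c *s u) = c * \<psi> i u)
    \<and> (\<forall>u\<in>ker_E. (\<forall>i<n. \<psi> i u = 0) \<longrightarrow> u = 0)
    \<and> (\<forall>t. \<exists>u\<in>ker_E. \<forall>i<n. \<psi> i u = t i)"
proof -
  obtain B where B: "B \<subseteq> ker_E" "independent B" "ker_E \<subseteq> span B"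
    using maximal_independent_subset[of ker_E] by blast
  have span: "span B = ker_E" using B(1,3) span_minimal[OF B(1) ker_E_subspace] by blast
  have fin: "finite B" using finite_independent[OF _ B(2)] B(1) by (auto simp: ker_E_def)
  obtain b where b: "bij_betw b {..<card B} B"
    using ex_bij_betw_nat_finite[OF fin] by (auto simp: atLeast0LessThan)
  define \<psi> where "\<psi> i u = representation B u (b i)" for i u
  have "\<psi> i (u + v) = \<psi> i u + \<psi> i v" if "u \<in> ker_E" "v \<in> ker_E" for i u v
    unfolding \<psi>_def using that span by (simp add: representation_add[OF B(2)])
  moreover have "\<psi> i (c *s u) = c * \<psi> i u" if "u \<in> ker_E" for i c u
    unfolding \<psi>_def using that span by (simp add: representation_scale[OF B(2)])
  moreover have "u = 0" if u: "u \<in> ker_E" and z: "\<forall>i<card B. \<psi> i u = 0" for u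
  proof -
    have "representation B u c = 0" if "c \<in> B" for c
    proof -
      obtain i where "i < card B" "c = b i" using b \<open>c \<in> B\<close> by (auto simp: bij_betw_def image_iff)
      then show ?thesis using z by (simp add: \<psi>_def)
    qed
    then have "(\<Sum>c\<in>B. representation B u c *s c) = 0" by simp
    then show ?thesis using sum_representation_eq[OF B(2) _ fin order_refl, of u] u span by simp
  qed
  moreover have "\<exists>u\<in>ker_E. \<forall>i<card B. \<psi> i u = t i" for t
  proof (intro bexI[of _ "\<Sum>i<card B. t i *s b i"] allI impI)
    have bB: "b i \<in> B" if "i < card B" for i using b that by (auto simp: bij_betw_def)
    have inj: "b i = b j \<longleftrightarrow> i = j" if "i < card B" "j < card B" for i j
      using b that by (auto simp: bij_betw_def inj_on_def)
    show "(\<Sum>i<card B. t i *s b i) \<in> ker_E"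
      using bB span by (intro subspace_sum[OF ker_E_subspace] subspace_scale[OF ker_E_subspace]) (metis lessThan_iff span_base)
    fix j assume j: "j < card B"
    have "representation B (\<Sum>i<card B. t i *s b i) = (\<lambda>c. \<Sum>i<card B. representation B (t i *s b i) c)"
      by (rule representation_sum[OF B(2)]) (simp add: bB span_scale span_base)
    then have "\<psi> j (\<Sum>i<card B. t i *s b i) = (\<Sum>i<card B. representation B (t i *s b i) (b j))"
      by (simp add: \<psi>_def)
    also have "\<dots> = (\<Sum>i<card B. t i * representation B (b i) (b j))"
      by (rule sum.cong) (simp_all add: representation_scale[OF B(2)] bB span_base)
    also have "\<dots> = (\<Sum>i<card B. if i = j then t i else 0)"
      using bB inj j by (intro sum.cong) (auto simp: representation_basis[OF B(2)])
    also have "\<dots> = t j" using j by simp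
    finally show "\<psi> j (\<Sum>i<card B. t i *s b i) = t j" .
  qed
  ultimately show ?thesis by (intro exI[of _ "card B"] exI[of _ \<psi>]) blast
qed

text \<open>A submodule \<open>N\<close> contains both components of each of its elements, so it is determined by
\<open>N \<inter> ker_E\<close>. If \<open>W\<close> is a linear complement of this intersection in \<open>ker_E\<close>, then \<open>W + F W\<close> is an
invariant complement of \<open>N\<close>; it consists of the \<open>v\<close> for which \<open>top_part v\<close> and \<open>E v\<close> lie in \<open>W\<close>.\<close>

lemma invariant_complement:
  assumes N: "subspace N" "N \<subseteq> S" and NE: "\<And>v. v \<in> N \<Longrightarrow> E v \<in> N" and NF: "\<And>v. v \<in> N \<Longrightarrow> F v \<in> N"
  shows "\<exists>N'. subspace N' \<and> N' \<subseteq> S \<and> (\<forall>v\<in>N'. E v \<in> N' \<and> F v \<in> N' \<and> K v \<in> N' \<and> L v \<in> N')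
    \<and> N \<inter> N' = {0} \<and> (\<forall>v\<in>S. \<exists>a\<in>N. \<exists>b\<in>N'. v = a + b)"
proof -
  define P1 where "P1 = N \<inter> ker_E"
  have P1: "subspace P1" unfolding P1_def using N(1) ker_E_subspace by (rule subspace_inter)
  obtain B1 where B1: "B1 \<subseteq> P1" "independent B1" "P1 \<subseteq> span B1"
    using maximal_independent_subset[of P1] by blast
  have sp1: "span B1 = P1" using B1(3) span_minimal[OF B1(1) P1] by blast
  have "B1 \<subseteq> ker_E" using B1(1) by (auto simp: P1_def)
  then obtain B2 where B2: "B1 \<subseteq> B2" "B2 \<subseteq> ker_E" "independent B2" "ker_E \<subseteq> span B2"
    using maximal_independent_subset_extend[OF _ B1(2), of ker_E] by blast
  have sp2: "span B2 = ker_E" using B2(4) span_minimal[OF B2(2) ker_E_subspace] by blast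
  define W where "W = span (B2 - B1)"
  have W: "subspace W" unfolding W_def by (rule subspace_span)
  have WP: "W \<subseteq> ker_E" unfolding W_def sp2[symmetric] by (rule span_mono) blast
  have disj: "u = 0" if "u \<in> P1" "u \<in> W" for u
  proof -
    have i: "independent (B2 - B1)" using B2(3) by (rule independent_mono) blast
    have "u \<in> span B1" "u \<in> span (B2 - B1)" using that sp1 W_def by auto
    then have "representation B2 u = representation B1 u" "representation B2 u = representation (B2 - B1) u"
      using representation_extend[OF B2(3) _ B2(1)] representation_extend[OF B2(3), of u "B2 - B1"] by blast+
    then have eq: "representation B1 u c = representation (B2 - B1) u c" for c by metis
    have "representation B1 u c = 0" for c
    proof (rule ccontr)
      assume ne: "representation B1 u c \<noteq> 0"
      then have "c \<in> B1" by (rule representation_ne_zero)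
      moreover have "c \<in> B2 - B1" using ne unfolding eq by (rule representation_ne_zero)
      ultimately show False by blast
    qed
    then show ?thesis using sum_nonzero_representation_eq[OF B1(2) \<open>u \<in> span B1\<close>] by simp
  qed
  have split: "\<exists>x\<in>P1. \<exists>y\<in>W. u = x + y" if "u \<in> ker_E" for u
  proof -
    have "B2 = B1 \<union> (B2 - B1)" using B2(1) by blast
    then have "u \<in> span (B1 \<union> (B2 - B1))" using that sp2 by metis
    then show ?thesis unfolding span_Un using sp1 W_def by blast
  qed
  define N' where "N' = {v \<in> S. top_part v \<in> W \<and> E v \<in> W}"
  note T = endo_simps[OF endo_top]
  have N': "subspace N'"
    using S(1) W unfolding N'_def subspace_def by (auto simp: T lin)
  moreover have "N' \<subseteq> S" by (auto simp: N'_def)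
  moreover have "E v \<in> N' \<and> F v \<in> N' \<and> K v \<in> N' \<and> L v \<in> N'" if v: "v \<in> N'" for v
  proof -
    have vS: "v \<in> S" and w: "top_part v \<in> W" "E v \<in> W" "0 \<in> W" using v W by (auto simp: N'_def subspace_0)
    show ?thesis unfolding N'_def mem_Collect_eq
      using vS w subspace_scale[OF W]
      by (simp add: E_S F_S K_S L_S top_part_E E_E top_part_F E_F top_part_K E_K top_part_L E_L)
  qed
  moreover have "N \<inter> N' = {0}"
  proof -
    have "v = 0" if "v \<in> N" "v \<in> N'" for v
    proof -
      have vS: "v \<in> S" and w: "top_part v \<in> W" "E v \<in> W" using that(2) by (auto simp: N'_def)
      have "top_part v \<in> N" unfolding top_part_def using that(1) by (intro subspace_diff[OF N(1)] NE NF)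
      then have "top_part v = 0" using disj w(1) top_part_in_ker[OF vS] by (simp add: P1_def)
      moreover have "E v = 0" using disj[of "E v"] w(2) NE[OF that(1)] E_in_ker[OF vS] by (simp add: P1_def)
      ultimately show ?thesis using top_part_plus[of v] by (simp add: lin)
    qed
    then show ?thesis using subspace_0[OF N(1)] subspace_0[OF N'] by blast
  qed
  moreover have "\<exists>a\<in>N. \<exists>b\<in>N'. v = a + b" if v: "v \<in> S" for v
  proof -
    obtain x y where xy: "x \<in> P1" "y \<in> W" "top_part v = x + y" using split[OF top_part_in_ker[OF v]] by blast
    obtain x' y' where xy': "x' \<in> P1" "y' \<in> W" "E v = x' + y'" using split[OF E_in_ker[OF v]] by blast
    have "x + F x' \<in> N" using xy(1) xy'(1) unfolding P1_def by (intro subspace_add[OF N(1)] NF) auto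
    moreover have yk: "y \<in> ker_E" "y' \<in> ker_E" using xy(2) xy'(2) WP by auto
    have "y + F y' \<in> N'" unfolding N'_def using decomposition_unique[OF yk] xy(2) xy'(2) by simp
    moreover have "v = (x + F x') + (y + F y')"
      using top_part_plus[of v] unfolding xy(3) xy'(3) by (simp add: lin algebra_simps)
    ultimately show ?thesis by blast
  qed
  ultimately show ?thesis by (intro exI[of _ N']) blast
qed

end


section \<open>From modules on a carrier set to operators\<close>

text \<open>A basis of a module with elements of type \<open>'m\<close> is a set \<open>\<beta>\<close> of such elements, so coordinate vectors
are functions on \<open>'m\<close> that vanish outside \<open>\<beta>\<close>.\<close>

definition fscale :: "'k::field \<Rightarrow> ('m \<Rightarrow> 'k) \<Rightarrow> 'm \<Rightarrow> 'k" where
  "fscale c f = (\<lambda>x. c * f x)"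

interpretation fs: operator_space fscale
  by unfold_locales (auto simp: fscale_def fun_eq_iff algebra_simps)

text \<open>Linear combinations of a basis, inverted.\<close>

lemma osc_coordinates:
  fixes M :: "((osc_gen, 'k::field) free_algebra set, 'm, 'z) module_scheme"
  assumes M: "left_module (osc_algebra q C0) M"
    and fd: "vectorspace.fin_dim class_ring (osc_vector_space q C0 M)"
  shows "\<exists>\<beta> crd. finite \<beta> \<and> bij_betw crd (carrier M) {f :: 'm \<Rightarrow> 'k. \<forall>b. b \<notin> \<beta> \<longrightarrow> f b = 0}
    \<and> (\<forall>x\<in>carrier M. \<forall>y\<in>carrier M. crd (x \<oplus>\<^bsub>M\<^esub> y) = crd x + crd y)
    \<and> (\<forall>c. \<forall>x\<in>carrier M. crd (presented_class (osc_relations q C0) (const c) \<odot>\<^bsub>M\<^esub> x) = fscale c (crd x))"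
proof -
  define W where "W = osc_vector_space q C0 M"
  interpret M: presented_module "osc_relations q C0" M
    using M by (simp add: presented_module_def osc_algebra_def)
  interpret W: vectorspace class_ring W unfolding W_def by (rule osc_vectorspace[OF M])
  have WM: "carrier W = carrier M" "add W = add M" "zero W = zero M"
    "c \<odot>\<^bsub>W\<^esub> x = M.act (const c) x" for c x
    by (simp_all add: W_def osc_vector_space_def osc_class_def)
  obtain \<beta> where \<beta>: "finite \<beta>" "W.basis \<beta>" using W.finite_basis_exists fd unfolding W_def by blast
  have \<beta>M: "\<beta> \<subseteq> carrier W" using \<beta>(2) by (simp add: W.basis_def)
  define S where "S = {f :: 'm \<Rightarrow> 'k. \<forall>b. b \<notin> \<beta> \<longrightarrow> f b = 0}"
  define \<phi> where "\<phi> f = W.lincomb f \<beta>" for f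
  have crit: "\<forall>v. v \<in> carrier W \<longrightarrow> (\<exists>!a. a \<in> \<beta> \<rightarrow>\<^sub>E carrier class_ring \<and> W.lincomb a \<beta> = v)"
    using W.basis_criterion[OF \<beta>(1) \<beta>M] \<beta>(2) by simp
  have \<phi>_restrict: "\<phi> (restrict f \<beta>) = \<phi> f" for f
    unfolding \<phi>_def by (rule W.lincomb_cong) (use \<beta>M in auto)
  have \<phi>_M: "\<phi> f \<in> carrier M" for f
    unfolding \<phi>_def WM(1)[symmetric] by (rule W.lincomb_closed) (use \<beta>(1) \<beta>M in auto)
  have add: "\<phi> (f + g) = \<phi> f \<oplus>\<^bsub>M\<^esub> \<phi> g" for f g
    using W.lincomb_sum[OF \<beta>(1) \<beta>M, of f g] by (simp add: \<phi>_def WM plus_fun_def)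
  have scl: "\<phi> (fscale c f) = M.act (const c) (\<phi> f)" for c f
    using W.lincomb_smult[OF \<beta>M, of f c] by (simp add: \<phi>_def WM fscale_def)
  have inj: "f = g" if "f \<in> S" "g \<in> S" "\<phi> f = \<phi> g" for f g
  proof -
    have "restrict f \<beta> = restrict g \<beta>"
    proof -
      have "\<exists>!a. a \<in> \<beta> \<rightarrow>\<^sub>E carrier class_ring \<and> W.lincomb a \<beta> = \<phi> f" using crit \<phi>_M WM by simp
      moreover have "restrict f \<beta> \<in> \<beta> \<rightarrow>\<^sub>E carrier class_ring \<and> W.lincomb (restrict f \<beta>) \<beta> = \<phi> f"
        "restrict g \<beta> \<in> \<beta> \<rightarrow>\<^sub>E carrier class_ring \<and> W.lincomb (restrict g \<beta>) \<beta> = \<phi> f"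
        using \<phi>_restrict[of f] \<phi>_restrict[of g] that(3) by (auto simp: \<phi>_def)
      ultimately show ?thesis by blast
    qed
    then have "f b = g b" if "b \<in> \<beta>" for b using that by (metis restrict_apply')
    moreover have "f b = g b" if "b \<notin> \<beta>" for b using that \<open>f \<in> S\<close> \<open>g \<in> S\<close> by (simp add: S_def)
    ultimately show ?thesis by blast
  qed
  have surj: "\<exists>f\<in>S. \<phi> f = x" if x: "x \<in> carrier M" for x
  proof -
    obtain a where a: "W.lincomb a \<beta> = x" using crit x WM by metis
    define f where "f b = (if b \<in> \<beta> then a b else 0)" for b
    have "\<phi> f = \<phi> a" by (metis \<phi>_restrict f_def restrict_ext)
    then show ?thesis using a by (intro bexI[of _ f]) (auto simp: \<phi>_def S_def f_def)
  qed
  have "\<phi> ` S = carrier M" using surj \<phi>_M by blast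
  moreover have "inj_on \<phi> S" by (rule inj_onI) (rule inj)
  ultimately have bij: "bij_betw \<phi> S (carrier M)" by (simp add: bij_betw_def)
  define crd where "crd = inv_into S \<phi>"
  have crd: "bij_betw crd (carrier M) S" unfolding crd_def by (rule bij_betw_inv_into[OF bij])
  have cS: "crd x \<in> S" "\<phi> (crd x) = x" if "x \<in> carrier M" for x
    using that bij crd by (auto simp: crd_def bij_betw_def f_inv_into_f)
  have Sadd: "f + g \<in> S" "fscale c f \<in> S" if "f \<in> S" "g \<in> S" for f g c
    using that by (auto simp: S_def fscale_def)
  have "crd (x \<oplus>\<^bsub>M\<^esub> y) = crd x + crd y" if "x \<in> carrier M" "y \<in> carrier M" for x y
    by (rule inj) (use that in \<open>simp_all add: cS Sadd add\<close>)
  moreover have "crd (M.act (const c) x) = fscale c (crd x)" if "x \<in> carrier M" for c x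
    by (rule inj) (use that in \<open>simp_all add: cS Sadd[OF cS(1)[OF that] cS(1)[OF that]] scl\<close>)
  ultimately show ?thesis using \<beta>(1) crd unfolding S_def
    by (intro exI[of _ \<beta>] exI[of _ crd]) blast
qed

section \<open>Classification of finite dimensional modules\<close>

lemma direct_sum_simps [simp]:
  "carrier (direct_sum_copies n M) = {..<n} \<rightarrow>\<^sub>E carrier M"
  "zero (direct_sum_copies n M) = (\<lambda>i\<in>{..<n}. zero M)"
  "add (direct_sum_copies n M) f g = (\<lambda>i\<in>{..<n}. add M (f i) (g i))"
  "smult (direct_sum_copies n M) a f = (\<lambda>i\<in>{..<n}. smult M a (f i))"
  by (simp_all add: direct_sum_copies_def)

lemma left_module_direct_sum:
  assumes "left_module R M" shows "left_module R (direct_sum_copies n M)"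
proof -
  interpret left_module R M by fact
  let ?D = "direct_sum_copies n M"
  have mem: "x i \<in> carrier M" if "x \<in> carrier ?D" "i < n" for x i
    using PiE_mem[of x "{..<n}" "\<lambda>_. carrier M" i] that by simp
  have mk: "(\<lambda>i\<in>{..<n}. f i) \<in> carrier ?D" if "\<And>i. i < n \<Longrightarrow> f i \<in> carrier M" for f
    unfolding direct_sum_simps restrict_PiE_iff by (intro ballI that) simp
  have ext: "(\<lambda>i\<in>{..<n}. f i) = x" if "x \<in> carrier ?D" "\<And>i. i < n \<Longrightarrow> f i = x i" for f x
    using PiE_restrict[of x "{..<n}" "\<lambda>_. carrier M"] that(1) restrict_ext[of "{..<n}" f x] that(2) by simp
  have eq: "(\<lambda>i\<in>{..<n}. f i) = (\<lambda>i\<in>{..<n}. g i)" if "\<And>i. i < n \<Longrightarrow> f i = g i" for f g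
    by (rule restrict_ext) (simp add: that)
  have ag: "abelian_group ?D"
  proof (rule abelian_groupI)
    fix x y assume x: "x \<in> carrier ?D" and y: "y \<in> carrier ?D"
    show "x \<oplus>\<^bsub>?D\<^esub> y \<in> carrier ?D"
      unfolding direct_sum_simps(3) by (rule mk) (simp add: mem[OF x] mem[OF y])
    show "x \<oplus>\<^bsub>?D\<^esub> y = y \<oplus>\<^bsub>?D\<^esub> x"
      unfolding direct_sum_simps(3) by (rule eq) (simp add: mem[OF x] mem[OF y] M.a_comm)
    fix z assume z: "z \<in> carrier ?D"
    show "x \<oplus>\<^bsub>?D\<^esub> y \<oplus>\<^bsub>?D\<^esub> z = x \<oplus>\<^bsub>?D\<^esub> (y \<oplus>\<^bsub>?D\<^esub> z)"
      unfolding direct_sum_simps(3) by (rule eq) (simp add: mem[OF x] mem[OF y] mem[OF z] M.a_assoc)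
  next
    show "\<zero>\<^bsub>?D\<^esub> \<in> carrier ?D" unfolding direct_sum_simps(2) by (rule mk) simp
    fix x assume x: "x \<in> carrier ?D"
    show "\<zero>\<^bsub>?D\<^esub> \<oplus>\<^bsub>?D\<^esub> x = x"
      unfolding direct_sum_simps(2,3) by (rule ext[OF x]) (simp add: mem[OF x])
    show "\<exists>y\<in>carrier ?D. y \<oplus>\<^bsub>?D\<^esub> x = \<zero>\<^bsub>?D\<^esub>"
    proof (rule bexI)
      show "(\<lambda>i\<in>{..<n}. \<ominus>\<^bsub>M\<^esub> x i) \<in> carrier ?D" by (rule mk) (simp add: mem[OF x])
      show "(\<lambda>i\<in>{..<n}. \<ominus>\<^bsub>M\<^esub> x i) \<oplus>\<^bsub>?D\<^esub> x = \<zero>\<^bsub>?D\<^esub>"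
        unfolding direct_sum_simps(2,3) by (rule eq) (simp add: mem[OF x] M.l_neg)
    qed
  qed
  show ?thesis
  proof (intro left_module.intro left_module_axioms.intro ag R.ring_axioms)
    fix x assume x: "x \<in> carrier ?D"
    show "\<one>\<^bsub>R\<^esub> \<odot>\<^bsub>?D\<^esub> x = x"
      unfolding direct_sum_simps(4) by (rule ext[OF x]) (simp add: mem[OF x] smult_one)
    fix a assume a: "a \<in> carrier R"
    show "a \<odot>\<^bsub>?D\<^esub> x \<in> carrier ?D"
      unfolding direct_sum_simps(4) by (rule mk) (simp add: mem[OF x] smult_closed[OF a])
    fix b assume b: "b \<in> carrier R"
    show "(a \<oplus>\<^bsub>R\<^esub> b) \<odot>\<^bsub>?D\<^esub> x = a \<odot>\<^bsub>?D\<^esub> x \<oplus>\<^bsub>?D\<^esub> b \<odot>\<^bsub>?D\<^esub> x"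
      unfolding direct_sum_simps(3,4) by (rule eq) (simp add: mem[OF x] smult_l_distr[OF a b])
    show "(a \<otimes>\<^bsub>R\<^esub> b) \<odot>\<^bsub>?D\<^esub> x = a \<odot>\<^bsub>?D\<^esub> (b \<odot>\<^bsub>?D\<^esub> x)"
      unfolding direct_sum_simps(4) by (rule eq) (simp add: mem[OF x] smult_assoc[OF a b])
  next
    fix a x y assume a: "a \<in> carrier R" and x: "x \<in> carrier ?D" and y: "y \<in> carrier ?D"
    show "a \<odot>\<^bsub>?D\<^esub> (x \<oplus>\<^bsub>?D\<^esub> y) = a \<odot>\<^bsub>?D\<^esub> x \<oplus>\<^bsub>?D\<^esub> a \<odot>\<^bsub>?D\<^esub> y"
      unfolding direct_sum_simps(3,4) by (rule eq) (simp add: mem[OF x] mem[OF y] smult_r_distr[OF a])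
  qed
qed

lemma direct_sum_projection:
  assumes "i < n" shows "(\<lambda>x. x i) \<in> LinearCombinations.module_hom R (direct_sum_copies n M) M"
  by (rule module_homI) (use assms in auto)


lemma transcendental_power:
  fixes q :: "'k::field_char_0"
  assumes "\<not> algebraic q" "n > 0" shows "q ^ n \<noteq> 1"
proof
  assume "q ^ n = 1"
  let ?p = "monom 1 n - 1 :: 'k poly"
  have "poly ?p q = 0" using \<open>q ^ n = 1\<close> by (simp add: poly_monom)
  moreover have "coeff ?p n = 1" using assms(2) by simp
  then have "?p \<noteq> 0" by (metis coeff_0 zero_neq_one)
  moreover have "coeff ?p i \<in> \<int>" for i by (cases "i = 0") (auto simp: coeff_monom)
  ultimately show False using assms(1) algebraicI by blast
qed

text \<open>Transport of structure along the coordinates: the relations of the algebra, applied to elements of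
\<open>M\<close>, become the axioms of \<open>osc_operators\<close>.\<close>

lemma osc_operators_of_module:
  fixes q :: "'k::field_char_0" and M :: "((osc_gen, 'k) free_algebra set, 'm, 'z) module_scheme"
  assumes q: "q \<noteq> 0" "\<not> algebraic q"
  defines "C0 \<equiv> uq_class q (osc_C0 q)"
  assumes M: "left_module (osc_algebra q C0) M"
    and fd: "vectorspace.fin_dim class_ring (osc_vector_space q C0 M)"
  shows "\<exists>crd S D T. osc_operators fscale q S D (T (Uq gE)) (T (Uq gF)) (T (Uq gK)) (T (Uq gKinv)) (T gX) (T gY)
    \<and> bij_betw crd (carrier M) S
    \<and> (\<forall>x\<in>carrier M. \<forall>y\<in>carrier M. crd (x \<oplus>\<^bsub>M\<^esub> y) = (crd x + crd y :: 'm \<Rightarrow> 'k))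
    \<and> (\<forall>c. \<forall>x\<in>carrier M. crd (presented_class (osc_relations q C0) (const c) \<odot>\<^bsub>M\<^esub> x) = fscale c (crd x))
    \<and> (\<forall>g. \<forall>x\<in>carrier M. crd (presented_class (osc_relations q C0) (gen g) \<odot>\<^bsub>M\<^esub> x) = T g (crd x))"
proof -
  have q_pow: "\<And>n. n > 0 \<Longrightarrow> q ^ n \<noteq> 1" by (rule transcendental_power[OF q(2)])
  interpret M: sl2_module "osc_relations q C0" M q "Uq gE" "Uq gF" "Uq gK" "Uq gKinv"
    by (rule osc_sl2_module[OF M q(1) q_pow])
  obtain \<beta> crd where \<beta>: "finite \<beta>"
    and bij0: "bij_betw crd (carrier M) {f :: 'm \<Rightarrow> 'k. \<forall>b. b \<notin> \<beta> \<longrightarrow> f b = 0}"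
    and add0: "\<forall>x\<in>carrier M. \<forall>y\<in>carrier M. crd (x \<oplus>\<^bsub>M\<^esub> y) = crd x + crd y"
    and scl0: "\<forall>c. \<forall>x\<in>carrier M. crd (M.act (const c) x) = fscale c (crd x)"
    using osc_coordinates[OF M fd] by blast
  have add: "crd (x \<oplus>\<^bsub>M\<^esub> y) = crd x + crd y" if "x \<in> carrier M" "y \<in> carrier M" for x y
    using add0 that by blast
  have scl: "crd (M.act (const c) x) = fscale c (crd x)" if "x \<in> carrier M" for x c
    using scl0 that by blast
  define S where "S = {f :: 'm \<Rightarrow> 'k. \<forall>b. b \<notin> \<beta> \<longrightarrow> f b = 0}"
  have bij: "bij_betw crd (carrier M) S" using bij0 unfolding S_def .
  define D :: "('m \<Rightarrow> 'k) set" where "D = (\<lambda>b x. if x = b then 1 else 0) ` \<beta>"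
  have S: "fs.subspace S" unfolding fs.subspace_def S_def by (simp add: fscale_def)
  \<comment> \<open>operators have to be linear on all functions, so arguments are first cut off outside \<open>\<beta>\<close>\<close>
  define rs :: "('m \<Rightarrow> 'k) \<Rightarrow> 'm \<Rightarrow> 'k" where "rs f b = (if b \<in> \<beta> then f b else 0)" for f b
  have rsS: "rs f \<in> S" for f by (simp add: rs_def S_def)
  have rs: "rs f = f" if "f \<in> S" for f using that by (auto simp: rs_def S_def fun_eq_iff)
  have rs_add: "rs (f + g) = rs f + rs g" and rs_scl: "rs (fscale c f) = fscale c (rs f)" for f g c
    by (auto simp: rs_def fscale_def fun_eq_iff)
  define mk where "mk f = inv_into (carrier M) crd (rs f)" for f
  have mkM: "mk f \<in> carrier M" and crd_mk: "crd (mk f) = rs f" for f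
    using bij rsS[of f] by (auto simp: mk_def bij_betw_def inv_into_into f_inv_into_f)
  have inj: "x = y" if "x \<in> carrier M" "y \<in> carrier M" "crd x = crd y" for x y
    using bij that by (auto simp: bij_betw_def dest: inj_onD)
  have crdS: "crd x \<in> S" if "x \<in> carrier M" for x using bij that by (auto simp: bij_betw_def)
  have mk_crd: "mk (crd x) = x" if "x \<in> carrier M" for x
    by (rule inj) (use that mkM in \<open>simp_all add: crd_mk rs crdS\<close>)
  have mk_add: "mk (f + g) = mk f \<oplus>\<^bsub>M\<^esub> mk g" for f g
    by (rule inj) (simp_all add: mkM crd_mk add rs_add)
  have mk_scl: "mk (fscale c f) = M.act (const c) (mk f)" for c f
    by (rule inj) (simp_all add: mkM crd_mk scl rs_scl)
  define T where "T g f = crd (M.act (gen g) (mk f))" for g f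
  have Tc: "T g (crd x) = crd (M.act (gen g) x)" if "x \<in> carrier M" for g x
    using that by (simp add: T_def mk_crd)
  have T: "fs.endo (T g)" for g
  proof (rule fs.endoI)
    show "T g (x + y) = T g x + T g y" for x y
      by (simp add: T_def mk_add M.act_radd mkM add)
    show "T g (fscale c x) = fscale c (T g x)" for c x
      by (simp add: T_def mk_scl M.act_const_commute[OF mkM] mkM scl)
  qed
  have TS: "T g f \<in> S" for g f by (simp add: T_def crdS mkM)
  have ex: "\<exists>x\<in>carrier M. f = crd x" if "f \<in> S" for f
    using bij that by (auto simp: bij_betw_def)
  have neg: "fscale (-1) f = - f" for f :: "'m \<Rightarrow> 'k" by (auto simp: fscale_def fun_eq_iff)
  have rel: "gen (Uq gK) * gen gX * gen (Uq gKinv) - const q * gen gX \<in> osc_relations q C0"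
    "gen (Uq gK) * gen gY * gen (Uq gKinv) - const (inverse q) * gen gY \<in> osc_relations q C0"
    unfolding osc_relations_def Let_def by blast+
  have c0: "osc_C0 q \<in> C0" unfolding C0_def uq_class_def by (rule cls_self)
  have rel3: "const q * gen gY * gen gX - gen gX * gen gY - free_map Uq (osc_C0 q) \<in> osc_relations q C0"
    unfolding osc_relations_def Let_def using c0 by blast
  have DS: "S \<subseteq> fs.span D"
  proof
    fix f assume f: "f \<in> S"
    have "(\<Sum>b\<in>\<beta>. fscale (f b) (\<lambda>x. if x = b then 1 else 0)) x = f x" for x
    proof -
      have "(\<Sum>b\<in>\<beta>. fscale (f b) (\<lambda>x. if x = b then 1 else 0)) x = (\<Sum>b\<in>\<beta>. fscale (f b) (\<lambda>x. if x = b then 1 else 0) x)"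
        by (induction \<beta> rule: infinite_finite_induct) simp_all
      also have "\<dots> = (\<Sum>b\<in>\<beta>. if x = b then f b else 0)"
        by (rule sum.cong) (auto simp: fscale_def)
      also have "\<dots> = f x" using \<beta> f by (simp add: S_def)
      finally show ?thesis .
    qed
    then have "f = (\<Sum>b\<in>\<beta>. fscale (f b) (\<lambda>x. if x = b then 1 else 0))" by (simp add: fun_eq_iff)
    also have "\<dots> \<in> fs.span D"
      by (intro fs.span_sum fs.span_scale fs.span_base) (simp add: D_def)
    finally show "f \<in> fs.span D" .
  qed
  have "sl2_operators fscale q S D (T (Uq gE)) (T (Uq gF)) (T (Uq gK)) (T (Uq gKinv))"
  proof (intro sl2_operators.intro sl2_operators_axioms.intro fs.operator_space_axioms)
    show "finite D" using \<beta> by (simp add: D_def)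
    show "D \<subseteq> S" by (auto simp: D_def S_def)
  next
    fix f assume "f \<in> S"
    then obtain x where x: "x \<in> carrier M" "f = crd x" using ex by blast
    show "T (Uq gK) (T (Uq gKinv) f) = f" by (simp add: x Tc M.K_Ki)
    show "T (Uq gKinv) (T (Uq gK) f) = f" by (simp add: x Tc M.Ki_K)
    show "T (Uq gK) (T (Uq gE) f) = fscale (q ^ 2) (T (Uq gE) (T (Uq gK) f))"
      by (simp add: x Tc M.K_E scl)
    show "T (Uq gK) (T (Uq gF) f) = fscale (inverse q ^ 2) (T (Uq gF) (T (Uq gK) f))"
      by (simp only: x Tc M.act_closed M.K_F scl)
    show "T (Uq gE) (T (Uq gF) f) - T (Uq gF) (T (Uq gE) f)
      = fscale (1 / (q - inverse q)) (T (Uq gK) f - T (Uq gKinv) f)"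
      by (simp add: x Tc M.E_F[OF x(1)] add scl neg)
  qed (rule q(1) q_pow S DS T TS; assumption?)+
  moreover have "osc_operators_axioms fscale q S (T (Uq gE)) (T (Uq gF)) (T (Uq gK)) (T (Uq gKinv)) (T gX) (T gY)"
  proof (rule osc_operators_axioms.intro)
    fix f assume "f \<in> S"
    then obtain x where x: "x \<in> carrier M" "f = crd x" using ex by blast
    show "T (Uq gK) (T gX f) = fscale q (T gX (T (Uq gK) f))"
      using M.K_conj[OF x(1) M.act_rel[OF _ rel(1)]] by (simp add: x Tc scl)
    show "T (Uq gK) (T gY f) = fscale (inverse q) (T gY (T (Uq gK) f))"
      using M.K_conj[OF x(1) M.act_rel[OF _ rel(2)]] by (simp add: x Tc scl)
    define \<delta> where "\<delta> = q - inverse q"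
    have "const q * gen gY * gen gX - (gen gX * gen gY + free_map Uq (osc_C0 q)) \<in> osc_relations q C0"
      using rel3 by (simp add: diff_diff_eq)
    then have e: "M.act (const q * gen gY * gen gX) x = M.act (gen gX * gen gY + free_map Uq (osc_C0 q)) x"
      by (rule M.act_eq_of_rel[OF x(1)])
    have "crd (M.act (const q * gen gY * gen gX) x) = fscale q (T gY (T gX f))"
      by (simp add: x Tc M.act_mult scl)
    moreover have "crd (M.act (gen gX * gen gY + free_map Uq (osc_C0 q)) x)
      = T gX (T gY f) + crd (M.act (free_map Uq (osc_C0 q)) x)"
      by (simp add: x Tc M.act_mult M.act_add add)
    moreover have "crd (M.act (free_map Uq (osc_C0 q)) x) =
      fscale (\<delta> ^ 3) (T (Uq gF) (T (Uq gE) f) + fscale (1 / \<delta> ^ 2) (fscale q (T (Uq gK) f) + fscale (inverse q) (T (Uq gKinv) f)))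
      - fscale (\<delta> * (inverse q ^ 2 + q ^ 2)) f"
      unfolding osc_C0_def casimir_def free_map_diff free_map_mult free_map_add free_map_gen free_map_const \<delta>_def[symmetric]
      by (simp add: x Tc M.act_diff' M.act_mult M.act_add add scl neg)
    ultimately have "fscale q (T gY (T gX f)) = T gX (T gY f) +
      (fscale (\<delta> ^ 3) (T (Uq gF) (T (Uq gE) f) + fscale (1 / \<delta> ^ 2) (fscale q (T (Uq gK) f) + fscale (inverse q) (T (Uq gKinv) f)))
      - fscale (\<delta> * (inverse q ^ 2 + q ^ 2)) f)"
      using e by (simp only:)
    then show "fscale q (T gY (T gX f)) - T gX (T gY f) =
      fscale ((q - inverse q) ^ 3) (T (Uq gF) (T (Uq gE) f)
        + fscale (1 / (q - inverse q) ^ 2) (fscale q (T (Uq gK) f) + fscale (inverse q) (T (Uq gKinv) f)))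
      - fscale ((q - inverse q) * (inverse q ^ 2 + q ^ 2)) f"
      unfolding \<delta>_def[symmetric] by (simp only: add_diff_cancel_left')
  qed (rule q(2) T TS)+
  ultimately have "osc_operators fscale q S D (T (Uq gE)) (T (Uq gF)) (T (Uq gK)) (T (Uq gKinv)) (T gX) (T gY)"
    by (rule osc_operators.intro)
  moreover have "\<forall>g. \<forall>x\<in>carrier M. crd (M.act (gen g) x) = T g (crd x)" using Tc by simp
  ultimately show ?thesis using bij add0 scl0 by blast
qed


text \<open>Each basis vector of \<open>ker_E\<close> yields a homomorphism to the plane, which sends \<open>m\<close> to the pair of its
coordinates in \<open>top_part m\<close> and in \<open>E m\<close>. Together these homomorphisms are bijective because
\<open>m = top_part m + F (E m)\<close>, with arbitrary components in \<open>ker_E\<close>.\<close>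

lemma fin_dim_osc_modules:
  fixes q :: "'k::field_char_0" and M :: "((osc_gen, 'k) free_algebra set, 'm) module"
  assumes q: "q \<noteq> 0" "\<not> algebraic q"
  defines "C0 \<equiv> uq_class q (osc_C0 q)"
  defines "A \<equiv> osc_algebra q C0"
  defines "V \<equiv> osc_simple q C0 q"
  assumes fd: "fin_dim_osc_module q C0 M"
  shows "\<exists>n. isomorphic_modules A M (direct_sum_copies n V)" and "completely_reducible A M"
proof -
  have q_pow: "\<And>n. n > 0 \<Longrightarrow> q ^ n \<noteq> 1" by (rule transcendental_power[OF q(2)])
  have qi: "q - inverse q \<noteq> 0"
    using q_pow[of 2] q(1) by (auto simp: power2_eq_square field_simps)
  define S where "S = osc_relations q C0"
  have AS: "A = presented_algebra S" by (simp add: A_def S_def osc_algebra_def)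
  have M: "left_module A M" and fdM: "vectorspace.fin_dim class_ring (osc_vector_space q C0 M)"
    using fd by (simp_all add: fin_dim_osc_module_def A_def)
  have V: "left_module A V" unfolding A_def V_def C0_def by (rule osc_simple_plane(2)[OF q(1) q_pow])
  interpret M: presented_module S M using M by (simp add: presented_module_def AS)
  interpret V: presented_module S V using V by (simp add: presented_module_def AS)
  let ?P = "plane.rep_module (osc_plane q)"
  have sm: "presented_class S p \<odot>\<^bsub>?P\<^esub> v = plane.word_eval (osc_plane q) p v" for p v
    unfolding S_def C0_def by (rule plane.rep_module_smult[OF osc_plane_endo osc_plane_relations[OF q(1) qi]])
  have "isomorphic_modules A ?P V"
    unfolding A_def V_def C0_def by (rule isomorphic_sym[OF osc_simple_plane[OF q(1) q_pow]])
  then obtain g where g: "g \<in> LinearCombinations.module_hom A ?P V" and g_bij: "bij_betw g UNIV (carrier V)"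
    unfolding isomorphic_modules_def by auto
  have gV: "g u \<in> carrier V" for u using LinearCombinations.module_hom_closed[OF g] by auto
  have g_add: "g (u + v) = g u \<oplus>\<^bsub>V\<^esub> g v" for u v
    using LinearCombinations.module_hom_add[OF g, of u v] by simp
  have g_act: "V.act p (g u) = g (plane.word_eval (osc_plane q) p u)" for p u
    using LinearCombinations.module_hom_smult[OF g, of "presented_class S p" u] by (simp add: AS sm)
  have g0: "g 0 = \<zero>\<^bsub>V\<^esub>"
    using g_act[of 0 0] gV[of 0] by simp
  have g_inj: "u = v" if "g u = g v" for u v using g_bij that by (auto simp: bij_betw_def dest: injD)
  obtain crd SS D T where
    O: "osc_operators fscale q SS D (T (Uq gE)) (T (Uq gF)) (T (Uq gK)) (T (Uq gKinv)) (T gX) (T gY)"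
    and crd_bij: "bij_betw crd (carrier M) SS"
    and crd_add0: "\<forall>x\<in>carrier M. \<forall>y\<in>carrier M. crd (x \<oplus>\<^bsub>M\<^esub> y) = (crd x + crd y :: 'm \<Rightarrow> 'k)"
    and crd_scl0: "\<forall>c. \<forall>x\<in>carrier M. crd (M.act (const c) x) = fscale c (crd x)"
    and crd_T0: "\<forall>g. \<forall>x\<in>carrier M. crd (M.act (gen g) x) = T g (crd x)"
    using osc_operators_of_module[OF q, folded C0_def, folded A_def, OF M fdM] unfolding S_def by blast
  interpret O: osc_operators fscale q SS D "T (Uq gE)" "T (Uq gF)" "T (Uq gK)" "T (Uq gKinv)" "T gX" "T gY" by (rule O)
  have crd_add: "crd (x \<oplus>\<^bsub>M\<^esub> y) = crd x + crd y" if "x \<in> carrier M" "y \<in> carrier M" for x y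
    using crd_add0 that by blast
  have crd_scl: "crd (M.act (const c) x) = fscale c (crd x)" if "x \<in> carrier M" for x c
    using crd_scl0 that by blast
  have crd_T: "crd (M.act (gen g) x) = T g (crd x)" if "x \<in> carrier M" for g x
    using crd_T0 that by blast
  have crdS: "crd x \<in> SS" if "x \<in> carrier M" for x using crd_bij that by (auto simp: bij_betw_def)
  have crd_inj: "x = y" if "x \<in> carrier M" "y \<in> carrier M" "crd x = crd y" for x y
    using crd_bij that by (auto simp: bij_betw_def dest: inj_onD)
  have crd_surj: "\<exists>x\<in>carrier M. crd x = f" if "f \<in> SS" for f
    using crd_bij that by (auto simp: bij_betw_def)
  have crd0: "crd \<zero>\<^bsub>M\<^esub> = 0"
    using crd_scl[of "\<zero>\<^bsub>M\<^esub>" 0] by (simp add: fscale_def fun_eq_iff)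
  note top_part = fs.endo_simps[OF O.endo_top] and E = fs.endo_simps[OF O.endo_E]
  obtain n :: nat and \<psi> where
    \<psi>_add0: "\<forall>i. \<forall>u\<in>O.ker_E. \<forall>v\<in>O.ker_E. \<psi> i (u + v) = \<psi> i u + (\<psi> i v :: 'k)"
    and \<psi>_scl0: "\<forall>i c. \<forall>u\<in>O.ker_E. \<psi> i (fscale c u) = c * \<psi> i u"
    and \<psi>_inj: "\<forall>u\<in>O.ker_E. (\<forall>i<n. \<psi> i u = 0) \<longrightarrow> u = 0"
    and \<psi>_surj: "\<forall>t. \<exists>u\<in>O.ker_E. \<forall>i<n. \<psi> i u = t i"
    using O.ker_E_coordinates by blast
  have \<psi>_0: "\<psi> i 0 = 0" for i
    using \<psi>_scl0[rule_format, of 0 i 0] fs.subspace_0[OF O.ker_E_subspace] by (simp add: fscale_def zero_fun_def)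
  define pr where "pr i f = (\<psi> i (O.top_part f), \<psi> i (T (Uq gE) f))" for i f
  have pr_add: "pr i (u + v) = pr i u + pr i v" if "u \<in> SS" "v \<in> SS" for i u v
    using that \<psi>_add0 by (simp add: pr_def top_part E O.top_part_in_ker O.E_in_ker)
  have pr_scl: "pr i (fscale c u) = scale2 c (pr i u)" if "u \<in> SS" for i c u
    using that \<psi>_scl0 by (simp add: pr_def top_part E O.top_part_in_ker O.E_in_ker scale2_def)
  have pr_T: "pr i (T x f) = osc_plane q x (pr i f)" if f: "f \<in> SS" for i x f
  proof -
    note k = O.top_part_in_ker[OF f] O.E_in_ker[OF f]
    show ?thesis
    proof (cases x)
      case (Uq y)
      then show ?thesis using k \<psi>_scl0
        by (cases y) (simp_all add: pr_def O.top_part_E[OF f] O.E_E[OF f] O.top_part_F[OF f] O.E_F[OF f] O.top_part_K[OF f]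
          O.E_K[OF f] O.top_part_L[OF f] O.E_L[OF f] \<psi>_0)
    qed (simp_all add: pr_def O.X_0[OF f] O.Y_0[OF f] top_part E \<psi>_0 zero_prod_def)
  qed
  define h where "h m = (\<lambda>i\<in>{..<n}. g (pr i (crd m)))" for m
  let ?D = "direct_sum_copies n V"
  have D: "left_module A ?D" by (rule left_module_direct_sum[OF V])
  have h: "h \<in> LinearCombinations.module_hom A M ?D"
    unfolding AS
  proof (rule act_homI[OF M[unfolded AS] D[unfolded AS]])
    fix x assume x: "x \<in> carrier M"
    show "h x \<in> carrier ?D" unfolding h_def direct_sum_simps restrict_PiE_iff using gV by blast
    show "h (M.act (const c) x) = presented_class S (const c) \<odot>\<^bsub>?D\<^esub> h x" for c
      unfolding direct_sum_simps(4) h_def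
      by (rule restrict_ext) (simp add: crd_scl[OF x] pr_scl[OF crdS[OF x]] g_act)
    show "h (M.act (gen y) x) = presented_class S (gen y) \<odot>\<^bsub>?D\<^esub> h x" for y
      unfolding direct_sum_simps(4) h_def
      by (rule restrict_ext) (simp add: crd_T[OF x] pr_T[OF crdS[OF x]] g_act)
    fix y assume y: "y \<in> carrier M"
    show "h (x \<oplus>\<^bsub>M\<^esub> y) = h x \<oplus>\<^bsub>?D\<^esub> h y"
      unfolding direct_sum_simps(3) h_def
      by (rule restrict_ext) (simp add: crd_add[OF x y] pr_add[OF crdS[OF x] crdS[OF y]] g_add)
  qed
  have "inj_on h (carrier M)"
  proof (rule injective_hom[OF M D h])
    fix x assume x: "x \<in> carrier M" and hx: "h x = \<zero>\<^bsub>?D\<^esub>"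
    have "pr i (crd x) = 0" if "i < n" for i
    proof (rule g_inj)
      have "h x i = \<zero>\<^bsub>?D\<^esub> i" by (simp only: hx)
      then show "g (pr i (crd x)) = g 0" using that by (simp add: h_def g0)
    qed
    then have "\<forall>i<n. \<psi> i (O.top_part (crd x)) = 0" "\<forall>i<n. \<psi> i (T (Uq gE) (crd x)) = 0"
      by (simp_all add: pr_def zero_prod_def)
    then have "O.top_part (crd x) = 0" "T (Uq gE) (crd x) = 0"
      using \<psi>_inj O.top_part_in_ker[OF crdS[OF x]] O.E_in_ker[OF crdS[OF x]] by blast+
    then have "crd x = 0" using O.top_part_plus[of "crd x"] by (simp add: O.lin)
    then show "x = \<zero>\<^bsub>M\<^esub>" by (intro crd_inj x M.zero_closed) (simp add: crd0)
  qed
  moreover have "h ` carrier M = carrier ?D"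
  proof
    show "h ` carrier M \<subseteq> carrier ?D" using LinearCombinations.module_hom_closed[OF h] by blast
    show "carrier ?D \<subseteq> h ` carrier M"
    proof
      fix t assume t: "t \<in> carrier ?D"
      define p where "p i = inv_into UNIV g (t i)" for i
      have p: "g (p i) = t i" if "i < n" for i
      proof -
        have "t i \<in> carrier V" using PiE_mem[of t "{..<n}" "\<lambda>_. carrier V" i] t that by simp
        then show ?thesis unfolding p_def using g_bij by (intro f_inv_into_f) (simp add: bij_betw_def)
      qed
      obtain u where u: "u \<in> O.ker_E" "\<forall>i<n. \<psi> i u = fst (p i)" using \<psi>_surj[rule_format, of "\<lambda>i. fst (p i)"] by blast
      obtain w where w: "w \<in> O.ker_E" "\<forall>i<n. \<psi> i w = snd (p i)" using \<psi>_surj[rule_format, of "\<lambda>i. snd (p i)"] by blast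
      note uw = O.decomposition_unique[OF u(1) w(1)]
      obtain x where x: "x \<in> carrier M" "crd x = u + T (Uq gF) w" using crd_surj[OF uw(3)] by blast
      have "pr i (crd x) = p i" if "i < n" for i
        using u(2) w(2) that by (simp add: pr_def x(2) uw(1,2))
      then have "h x = (\<lambda>i\<in>{..<n}. t i)" unfolding h_def by (intro restrict_ext) (simp add: p)
      also have "\<dots> = t" using t by (simp only: direct_sum_simps PiE_restrict)
      finally show "t \<in> h ` carrier M" using x(1) by blast
    qed
  qed
  ultimately show "\<exists>n. isomorphic_modules A M (direct_sum_copies n V)"
    using h unfolding isomorphic_modules_def bij_betw_def by blast
  show "completely_reducible A M"
    unfolding completely_reducible_def
  proof (intro allI impI)
    fix N assume N: "Module.submodule N A M"
    note N' = M.submoduleD[folded AS, OF N]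
    have Nact: "M.act p x \<in> N" if "x \<in> N" for p x using N'(4)[OF _ that, of "presented_class S p"] by (simp add: AS)
    have NM: "x \<in> carrier M" if "x \<in> N" for x using N'(1) that by blast
    define NS where "NS = crd ` N"
    have sub: "fs.subspace NS"
      unfolding fs.subspace_def
    proof (intro conjI ballI allI)
      show "0 \<in> NS" unfolding NS_def using N'(2) crd0 by (metis imageI)
    next
      fix f f' assume "f \<in> NS" "f' \<in> NS"
      then obtain x y where xy: "x \<in> N" "y \<in> N" "f = crd x" "f' = crd y" unfolding NS_def by blast
      have "f + f' = crd (x \<oplus>\<^bsub>M\<^esub> y)" using xy NM by (simp add: crd_add)
      then show "f + f' \<in> NS" unfolding NS_def using N'(3)[OF xy(1,2)] by blast
    next
      fix f c assume "f \<in> NS"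
      then obtain x where x: "x \<in> N" "f = crd x" unfolding NS_def by blast
      have "fscale c f = crd (M.act (const c) x)" using x NM by (simp add: crd_scl)
      then show "fscale c f \<in> NS" unfolding NS_def using Nact[OF x(1)] by blast
    qed
    have NT: "T y f \<in> NS" if "f \<in> NS" for y f
    proof -
      obtain x where x: "x \<in> N" "f = crd x" using \<open>f \<in> NS\<close> unfolding NS_def by blast
      have "T y f = crd (M.act (gen y) x)" using x NM by (simp add: crd_T)
      then show ?thesis unfolding NS_def using Nact[OF x(1)] by blast
    qed
    have "NS \<subseteq> SS" unfolding NS_def using crdS NM by blast
    then obtain C where C: "fs.subspace C" "C \<subseteq> SS"
      "\<forall>v\<in>C. T (Uq gE) v \<in> C \<and> T (Uq gF) v \<in> C \<and> T (Uq gK) v \<in> C \<and> T (Uq gKinv) v \<in> C"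
      "NS \<inter> C = {0}" "\<forall>v\<in>SS. \<exists>a\<in>NS. \<exists>b\<in>C. v = a + b"
      using O.invariant_complement[OF sub _ NT NT] by blast
    define N2 where "N2 = {x \<in> carrier M. crd x \<in> C}"
    have N2M: "N2 \<subseteq> carrier M" by (auto simp: N2_def)
    have z: "\<zero>\<^bsub>M\<^esub> \<in> N2" using fs.subspace_0[OF C(1)] by (simp add: N2_def crd0)
    have "Module.submodule N2 A M"
      unfolding AS
    proof (rule M.act_submoduleI[OF N2M z])
      fix x y assume "x \<in> N2" "y \<in> N2"
      then show "x \<oplus>\<^bsub>M\<^esub> y \<in> N2" using fs.subspace_add[OF C(1)] by (simp add: N2_def crd_add)
    next
      fix c x assume "x \<in> N2"
      then show "M.act (const c) x \<in> N2" using fs.subspace_scale[OF C(1)] by (simp add: N2_def crd_scl)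
    next
      fix y x assume x: "x \<in> N2"
      then have xM: "x \<in> carrier M" and xC: "crd x \<in> C" by (simp_all add: N2_def)
      have "T y (crd x) \<in> C"
      proof (cases y)
        case (Uq w)
        then show ?thesis using C(3) xC by (cases w) auto
      qed (simp_all add: O.X_0 O.Y_0 crdS xM fs.subspace_0[OF C(1)])
      then show "M.act (gen y) x \<in> N2" using xM by (simp add: N2_def crd_T)
    qed
    moreover have "N \<inter> N2 = {\<zero>\<^bsub>M\<^esub>}"
    proof -
      have "x = \<zero>\<^bsub>M\<^esub>" if "x \<in> N" "x \<in> N2" for x
      proof -
        have "crd x \<in> NS \<inter> C" using that by (simp add: NS_def N2_def)
        then have "crd x = 0" using C(4) by blast
        then show ?thesis by (intro crd_inj NM that M.zero_closed) (simp add: crd0)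
      qed
      then show ?thesis using z N'(2) by blast
    qed
    moreover have "N <+>\<^bsub>M\<^esub> N2 = carrier M"
    proof
      show "N <+>\<^bsub>M\<^esub> N2 \<subseteq> carrier M" using N'(1) N2M by (auto simp: set_add_def')
      show "carrier M \<subseteq> N <+>\<^bsub>M\<^esub> N2"
      proof
        fix x assume x: "x \<in> carrier M"
        obtain a b where ab: "a \<in> NS" "b \<in> C" "crd x = a + b" using C(5) crdS[OF x] by blast
        obtain y where y: "y \<in> N" "a = crd y" using ab(1) unfolding NS_def by blast
        obtain w where w: "w \<in> carrier M" "crd w = b" using crd_surj ab(2) C(2) by blast
        have "x = y \<oplus>\<^bsub>M\<^esub> w" by (rule crd_inj) (use x y w ab NM in \<open>simp_all add: crd_add\<close>)
        moreover have "w \<in> N2" using w ab(2) by (simp add: N2_def)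
        ultimately show "x \<in> N <+>\<^bsub>M\<^esub> N2" using y(1) by (auto simp: set_add_def')
      qed
    qed
    ultimately show "\<exists>N'. Module.submodule N' A M \<and> N \<inter> N' = {\<zero>\<^bsub>M\<^esub>} \<and> N <+>\<^bsub>M\<^esub> N' = carrier M"
      by blast
  qed
qed

text \<open>There is at least one summand, and a nonzero projection of a simple module to it is injective.\<close>

lemma simple_direct_sum:
  assumes M: "simple_left_module R M" and V: "left_module R V" "carrier V \<noteq> {\<zero>\<^bsub>V\<^esub>}"
    and iso: "isomorphic_modules R M (direct_sum_copies n V)"
  shows "isomorphic_modules R M V"
proof -
  have M': "left_module R M" using M by (simp add: simple_left_module_def)
  interpret M: left_module R M by fact
  interpret V: left_module R V by fact
  obtain h where h: "h \<in> LinearCombinations.module_hom R M (direct_sum_copies n V)"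
    and bij: "bij_betw h (carrier M) (carrier (direct_sum_copies n V))"
    using iso unfolding isomorphic_modules_def by blast
  have "n \<noteq> 0"
  proof
    assume "n = 0"
    then have "h ` carrier M = {\<lambda>_. undefined}" using bij by (simp add: bij_betw_def)
    then have one: "h x = (\<lambda>_. undefined)" if "x \<in> carrier M" for x using that by blast
    have inj: "inj_on h (carrier M)" using bij by (simp add: bij_betw_def)
    have "x = \<zero>\<^bsub>M\<^esub>" if "x \<in> carrier M" for x
      by (rule inj_onD[OF inj _ that M.zero_closed]) (simp only: one[OF that] one[OF M.zero_closed])
    then have "carrier M = {\<zero>\<^bsub>M\<^esub>}" using M.zero_closed by blast
    then show False using M by (simp add: simple_left_module_def)
  qed
  then have n: "0 < n" by simp
  let ?f = "(\<lambda>t. t 0) \<circ> h"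
  have f: "?f \<in> LinearCombinations.module_hom R M V"
    by (rule hom_comp[OF h direct_sum_projection[OF n]])
  have "?f ` carrier M = (\<lambda>t. t 0) ` carrier (direct_sum_copies n V)"
    using bij unfolding bij_betw_def by (simp only: image_comp[symmetric])
  also have "\<dots> = carrier V"
  proof
    show "(\<lambda>t. t 0) ` carrier (direct_sum_copies n V) \<subseteq> carrier V" using n by auto
    show "carrier V \<subseteq> (\<lambda>t. t 0) ` carrier (direct_sum_copies n V)"
    proof
      fix v assume "v \<in> carrier V"
      then have "(\<lambda>i\<in>{..<n}. v) \<in> carrier (direct_sum_copies n V)" by simp
      then show "v \<in> (\<lambda>t. t 0) ` carrier (direct_sum_copies n V)" using n by (intro image_eqI[of _ _ "\<lambda>i\<in>{..<n}. v"]) simp_all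
    qed
  qed
  finally show ?thesis by (intro simple_surjection[OF M V f])
qed

theorem mainTheorem9:
  fixes q :: "'k::field_char_0"
  assumes "q \<noteq> 0" and "\<not> algebraic q"
  defines "C0 \<equiv> uq_class q
      (const ((q - inverse q) ^ 3) * casimir q
       - const ((q - inverse q) * (inverse q ^ 2 + q ^ 2)))"
  defines "A \<equiv> osc_algebra q C0"
  defines "V \<equiv> osc_simple q C0 q"
  shows "isomorphic_modules (uq_algebra q) (restrict_scalars (uq_to_osc q C0) V) (uq_simple q q) \<and>
    fin_dim_osc_module q C0 V \<and> simple_left_module A V \<and>
    vectorspace.dim class_ring (osc_vector_space q C0 V) = 2 \<and>
    (\<forall>M :: ((osc_gen, 'k) free_algebra set, 'm) module.
       fin_dim_osc_module q C0 M \<and> simple_left_module A M \<longrightarrow> isomorphic_modules A M V) \<and>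
    (\<forall>M :: ((osc_gen, 'k) free_algebra set, 'm) module.
       fin_dim_osc_module q C0 M \<longrightarrow>
         (\<exists>n. isomorphic_modules A M (direct_sum_copies n V)) \<and> completely_reducible A M)"
proof -
  have q_pow: "\<And>n. n > 0 \<Longrightarrow> q ^ n \<noteq> 1" by (rule transcendental_power[OF assms(2)])
  have qi: "q - inverse q \<noteq> 0"
    using q_pow[of 2] assms(1) by (auto simp: power2_eq_square field_simps)
  have C0: "C0 = uq_class q (osc_C0 q)" by (simp add: C0_def osc_C0_def)
  have V: "left_module A V" unfolding A_def V_def C0 by (rule osc_simple_plane(2)[OF assms(1) q_pow])
  have "simple_left_module A (plane.rep_module (osc_plane q))"
    unfolding A_def osc_algebra_def C0
    by (rule plane_simple[OF osc_plane_endo osc_plane_relations[OF assms(1) qi], where e = "Uq gE" and f = "Uq gF"]) simp_all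
  then have simple: "simple_left_module A V"
    using simple_module_iso V osc_simple_plane(1)[OF assms(1) q_pow] unfolding A_def V_def C0 by blast
  have dim: "vectorspace.fin_dim class_ring (osc_vector_space q C0 V)"
    "vectorspace.dim class_ring (osc_vector_space q C0 V) = 2"
    unfolding V_def C0 by (rule osc_simple_dim[OF assms(1) q_pow]; assumption)+
  have res: "isomorphic_modules (uq_algebra q) (restrict_scalars (uq_to_osc q C0) V) (uq_simple q q)"
    unfolding V_def C0 by (rule osc_simple_restricts[OF assms(1) q_pow])
  have fd: "(\<exists>n. isomorphic_modules A M (direct_sum_copies n V)) \<and> completely_reducible A M"
    if "fin_dim_osc_module q C0 M" for M :: "((osc_gen, 'k) free_algebra set, 'm) module"
    using fin_dim_osc_modules[OF assms(1,2), folded C0, OF that] unfolding A_def V_def by blast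
  have "isomorphic_modules A M V" if M: "fin_dim_osc_module q C0 M" "simple_left_module A M"
    for M :: "((osc_gen, 'k) free_algebra set, 'm) module"
  proof -
    obtain n where "isomorphic_modules A M (direct_sum_copies n V)" using fd[OF M(1)] by blast
    then show ?thesis
      using simple_direct_sum[OF M(2) V] simple by (simp add: simple_left_module_def)
  qed
  then show ?thesis using res dim simple fd V by (simp add: fin_dim_osc_module_def A_def)
qed

end
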